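(* Let $p\in[2,\infty)$ and $f\in C_0^\infty((a,b)\times\mathbb{R}^d,U)$, where $-\infty\le a<b\le\infty$ and $U=L_{1/H}((\alpha,\beta),V)$, with $-\infty\le\alpha<\beta\le\infty$, $1/2<H<1$ and $V$ a Hilbert space. Then $$\int_{\mathbb{R}^d}\int_a^b\left[\int_a^t\left(\int_\alpha^\beta|\nabla T_{t-s}f(s,\cdot,\theta)(x)|_V^{1/H}d\theta\right)^{2H}ds\right]^{p/2}dt\,dx\le N\int_a^b\left[\int_\alpha^\beta\left(\int_{\mathbb{R}^d}|f(t,x,\theta)|_V^pdx\right)^{1/(pH)}d\theta\right]^{pH}dt,$$ where $N$ is a constant depending only on $d$ and $p$.
   Context: $V$ is an arbitrary Hilbert space with norm $|\cdot|_V$. For $h\in L_p(\mathbb{R}^d,V)$, $T_th(x)=\int_{\mathbb{R}^d}h(x-y)G_t(y)dy$, where $G_t(x)=(4\pi t)^{-d/2}\exp\{-|x|^2/(4t)\}$, $t>0$, is the heat kernel; $\nabla$ is the gradient in $x$. For $f$ with values in $U$, $f(t,x,\theta)\in V$ denotes the value at $\theta\in(\alpha,\beta)$ of $f(t,x)\in U$, and $T_{t-s}f(s,\cdot,\theta)$ is the heat semigroup acting in the space variable. *)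

theory Defs
  imports "HOL-Analysis.Analysis"
begin

section \<open>Bochner integration in arbitrary normed spaces\<close>

text \<open>
  The library integral \<^const>\<open>has_bochner_integral\<close> is restricted to second countable codomains. To
  allow non-separable Hilbert spaces, measurability is replaced by strong (Bochner) measurability;
  otherwise the definition is the one of the library. The exceptional null set in
  \<open>strongly_measurable\<close> means that over \<^term>\<open>lborel\<close> this is measurability with respect to the
  completed measure.
\<close>

definition strongly_measurable :: "'a measure \<Rightarrow> ('a \<Rightarrow> 'b::real_normed_vector) \<Rightarrow> bool" where
  "strongly_measurable M g \<longleftrightarrow>
     (\<exists>s. (\<forall>i::nat. simple_function M (s i)) \<and> (AE x in M. (\<lambda>i. s i x) \<longlonglongrightarrow> g x))"

definition has_strong_integral :: "'a measure \<Rightarrow> ('a \<Rightarrow> 'b::real_normed_vector) \<Rightarrow> 'b \<Rightarrow> bool" where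
  "has_strong_integral M g v \<longleftrightarrow> strongly_measurable M g \<and>
     (\<exists>s. (\<forall>i::nat. Bochner_Integration.simple_bochner_integrable M (s i)) \<and>
          (\<lambda>i. \<integral>\<^sup>+x. ennreal (norm (g x - s i x)) \<partial>M) \<longlonglongrightarrow> 0 \<and>
          (\<lambda>i. Bochner_Integration.simple_bochner_integral M (s i)) \<longlonglongrightarrow> v)"

definition strong_integral :: "'a measure \<Rightarrow> ('a \<Rightarrow> 'b::real_normed_vector) \<Rightarrow> 'b" where
  "strong_integral M g =
     (if \<exists>v. has_strong_integral M g v then THE v. has_strong_integral M g v else 0)"


section \<open>Heat semigroup and gradient\<close>

definition heat_kernel :: "real \<Rightarrow> real ^ 'n \<Rightarrow> real" where
  "heat_kernel t x = (4 * pi * t) powr (- real CARD('n) / 2) * exp (- (norm x)\<^sup>2 / (4 * t))"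

definition heat_semigroup :: "real \<Rightarrow> (real ^ 'n \<Rightarrow> 'v::real_normed_vector) \<Rightarrow> real ^ 'n \<Rightarrow> 'v" where
  "heat_semigroup t h x = strong_integral lborel (\<lambda>y. heat_kernel t y *\<^sub>R h (x - y))"

text \<open>
  The gradient is the tuple of partial derivatives; its norm in \<^typ>\<open>'v ^ 'n\<close> is the square root of
  the sum of the squared norms of the components.
\<close>

definition gradient :: "(real ^ 'n \<Rightarrow> 'v::real_normed_vector) \<Rightarrow> real ^ 'n \<Rightarrow> 'v ^ 'n" where
  "gradient u x = (\<chi> i. vector_derivative (\<lambda>r. u (x + r *\<^sub>R axis i 1)) (at 0))"


section \<open>Test functions with values in an \<open>L\<^sub>q\<close>-space\<close>

text \<open>Meant for positive exponents \<open>r\<close>.\<close>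

definition epowr :: "ennreal \<Rightarrow> real \<Rightarrow> ennreal"  (infixr "epowr" 80) where
  "x epowr r = (if x = \<infinity> then \<infinity> else ennreal (enn2real x powr r))"

text \<open>
  Elements of \<open>U = L\<^sub>q(A, V)\<close> are represented by functions on \<open>A\<close>, two of them being
  identified when their difference has seminorm 0. A \<open>U\<close>-valued map on \<open>\<Omega>\<close> is thus a function of
  \<open>z \<in> \<Omega>\<close> and \<open>\<theta> \<in> A\<close>, and its limits and partial derivatives in \<open>z\<close> are taken in the seminorm of \<open>U\<close>.
\<close>

definition Lq_seminorm :: "real \<Rightarrow> real set \<Rightarrow> (real \<Rightarrow> 'v::real_normed_vector) \<Rightarrow> ennreal" where
  "Lq_seminorm q A g = (\<integral>\<^sup>+\<theta>\<in>A. ennreal (norm (g \<theta>) powr q) \<partial>lborel) epowr (1 / q)"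

definition in_Lq :: "real \<Rightarrow> real set \<Rightarrow> (real \<Rightarrow> 'v::real_normed_vector) \<Rightarrow> bool" where
  "in_Lq q A g \<longleftrightarrow> strongly_measurable (restrict_space lborel A) g \<and> Lq_seminorm q A g < \<infinity>"

definition Lq_continuous_on ::
  "real \<Rightarrow> real set \<Rightarrow> 'z::euclidean_space set \<Rightarrow> ('z \<Rightarrow> real \<Rightarrow> 'v::real_normed_vector) \<Rightarrow> bool" where
  "Lq_continuous_on q A \<Omega> F \<longleftrightarrow>
     (\<forall>z\<in>\<Omega>. in_Lq q A (F z) \<and>
            ((\<lambda>w. Lq_seminorm q A (\<lambda>\<theta>. F w \<theta> - F z \<theta>)) \<longlongrightarrow> 0) (at z within \<Omega>))"

definition Lq_has_partial_derivative_on ::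
  "real \<Rightarrow> real set \<Rightarrow> 'z::euclidean_space set \<Rightarrow> 'z \<Rightarrow>
   ('z \<Rightarrow> real \<Rightarrow> 'v::real_normed_vector) \<Rightarrow> ('z \<Rightarrow> real \<Rightarrow> 'v) \<Rightarrow> bool" where
  "Lq_has_partial_derivative_on q A \<Omega> e F G \<longleftrightarrow>
     (\<forall>z\<in>\<Omega>. ((\<lambda>r. Lq_seminorm q A (\<lambda>\<theta>. (F (z + r *\<^sub>R e) \<theta> - F z \<theta>) /\<^sub>R r - G z \<theta>)) \<longlongrightarrow> 0) (at 0))"

primrec Lq_C :: "nat \<Rightarrow> real \<Rightarrow> real set \<Rightarrow> 'z::euclidean_space set \<Rightarrow>
    ('z \<Rightarrow> real \<Rightarrow> 'v::real_normed_vector) \<Rightarrow> bool" where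
  "Lq_C 0 q A \<Omega> F \<longleftrightarrow> Lq_continuous_on q A \<Omega> F"
| "Lq_C (Suc k) q A \<Omega> F \<longleftrightarrow> Lq_continuous_on q A \<Omega> F \<and>
     (\<forall>e\<in>Basis. \<exists>G. Lq_has_partial_derivative_on q A \<Omega> e F G \<and> Lq_C k q A \<Omega> G)"

text \<open>
  \<open>C0_infty_Lq q a b A f\<close> says \<open>f \<in> C\<^sub>0\<^sup>\<infinity>((a,b) \<times> \<real>\<^sup>d, L\<^sub>q(A, V))\<close>. The first conjunct requires that the
  representatives \<^term>\<open>f (t, x)\<close> of the values have been chosen jointly measurably, as is needed for
  \<open>f(t,x,\<theta>)\<close> to be integrated in \<open>x\<close> for fixed \<open>\<theta>\<close>. A continuous \<open>L\<^sub>q\<close>-valued function always admits such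
  a choice, and any two choices agree for almost all \<open>(t, x, \<theta>)\<close>.
\<close>

definition C0_infty_Lq :: "real \<Rightarrow> ereal \<Rightarrow> ereal \<Rightarrow> real set \<Rightarrow>
    (real \<times> (real ^ 'n) \<Rightarrow> real \<Rightarrow> 'v::real_normed_vector) \<Rightarrow> bool" where
  "C0_infty_Lq q a b A f \<longleftrightarrow>
     strongly_measurable (restrict_space lborel ((einterval a b \<times> UNIV) \<times> A)) (\<lambda>(z, \<theta>). f z \<theta>) \<and>
     (\<forall>k. Lq_C k q A (einterval a b \<times> UNIV) f) \<and>
     (\<exists>K. compact K \<and> K \<subseteq> einterval a b \<times> UNIV \<and>
          (\<forall>z\<in>einterval a b \<times> UNIV - K. Lq_seminorm q A (f z) = 0))"


section \<open>The two sides of the estimate\<close>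

definition gradient_square_integral ::
  "real \<Rightarrow> real \<Rightarrow> ereal \<Rightarrow> ereal \<Rightarrow> ereal \<Rightarrow> ereal \<Rightarrow>
   (real \<times> (real ^ 'n) \<Rightarrow> real \<Rightarrow> 'v::real_normed_vector) \<Rightarrow> ennreal" where
  "gradient_square_integral p H a b \<alpha> \<beta> f =
     (\<integral>\<^sup>+x. (\<integral>\<^sup>+t\<in>einterval a b.
        (\<integral>\<^sup>+s\<in>einterval a (ereal t).
           (\<integral>\<^sup>+\<theta>\<in>einterval \<alpha> \<beta>.
              ennreal (norm (gradient (heat_semigroup (t - s) (\<lambda>y. f (s, y) \<theta>)) x) powr (1 / H))
            \<partial>lborel) epowr (2 * H)
         \<partial>lborel) epowr (p / 2)
      \<partial>lborel) \<partial>lborel)"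

definition mixed_norm_integral ::
  "real \<Rightarrow> real \<Rightarrow> ereal \<Rightarrow> ereal \<Rightarrow> ereal \<Rightarrow> ereal \<Rightarrow>
   (real \<times> (real ^ 'n) \<Rightarrow> real \<Rightarrow> 'v::real_normed_vector) \<Rightarrow> ennreal" where
  "mixed_norm_integral p H a b \<alpha> \<beta> f =
     (\<integral>\<^sup>+t\<in>einterval a b.
        (\<integral>\<^sup>+\<theta>\<in>einterval \<alpha> \<beta>.
           (\<integral>\<^sup>+x. ennreal (norm (f (t, x) \<theta>) powr p) \<partial>lborel) epowr (1 / (p * H))
         \<partial>lborel) epowr (p * H)
      \<partial>lborel)"


section \<open>A constant independent of the Hilbert space\<close>

text \<open>
  The constant in the estimate must not depend on \<open>V\<close>, but a quantifier inside a formula cannot range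
  over all Hilbert space types: in \<open>\<exists>N. \<forall>f :: _ \<Rightarrow> _ \<Rightarrow> 'v. \<dots>\<close> the witness may depend on the type
  \<open>'v\<close>. It is therefore named by a constant in which \<open>'v\<close> does not occur: a number for which the
  estimate holds when \<open>V\<close> is the sequence space \<open>\<ell>\<^sub>2\<close> (one with this property exists if the estimate
  is true at all). To assert the estimate with this number for an arbitrary \<open>'v\<close>, including \<open>\<ell>\<^sub>2\<close>, is
  to assert that there is one number serving all \<open>V\<close>. Nothing is lost by referring to \<open>\<ell>\<^sub>2\<close>, since a
  strongly measurable function takes almost all its values in a separable closed subspace, which
  embeds isometrically in \<open>\<ell>\<^sub>2\<close>.
\<close>

typedef ell2 = "{x :: nat \<Rightarrow> real. summable (\<lambda>n. (x n)\<^sup>2)}"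
  by (rule exI[of _ "\<lambda>_. 0"]) simp

setup_lifting type_definition_ell2

lemma summable_sq_mult:
  fixes x y :: "nat \<Rightarrow> real"
  assumes "summable (\<lambda>n. (x n)\<^sup>2)" "summable (\<lambda>n. (y n)\<^sup>2)"
  shows "summable (\<lambda>n. x n * y n)"
proof (rule summable_comparison_test'[OF summable_add[OF assms], of 0])
  fix n
  have "0 \<le> (\<bar>x n\<bar> - \<bar>y n\<bar>)\<^sup>2" by simp
  then have "2 * (\<bar>x n\<bar> * \<bar>y n\<bar>) \<le> (x n)\<^sup>2 + (y n)\<^sup>2" by (simp add: power2_diff)
  moreover have "0 \<le> \<bar>x n\<bar> * \<bar>y n\<bar>" by simp
  ultimately have "\<bar>x n\<bar> * \<bar>y n\<bar> \<le> (x n)\<^sup>2 + (y n)\<^sup>2" by linarith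
  then show "norm (x n * y n) \<le> (x n)\<^sup>2 + (y n)\<^sup>2" by (simp add: abs_mult)
qed

lemma summable_sq_add:
  fixes x y :: "nat \<Rightarrow> real"
  assumes "summable (\<lambda>n. (x n)\<^sup>2)" "summable (\<lambda>n. (y n)\<^sup>2)"
  shows "summable (\<lambda>n. (x n + y n)\<^sup>2)"
  using summable_add[OF summable_add[OF assms] summable_mult[OF summable_sq_mult[OF assms], of 2]]
  by (simp add: power2_sum mult.assoc)

lemma summable_sq_diff:
  fixes x y :: "nat \<Rightarrow> real"
  assumes "summable (\<lambda>n. (x n)\<^sup>2)" "summable (\<lambda>n. (y n)\<^sup>2)"
  shows "summable (\<lambda>n. (x n - y n)\<^sup>2)"
  using summable_sq_add[OF assms(1), of "\<lambda>n. - y n"] assms(2) by simp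

instantiation ell2 :: real_inner
begin

lift_definition zero_ell2 :: ell2 is "\<lambda>_. 0" by simp
lift_definition plus_ell2 :: "ell2 \<Rightarrow> ell2 \<Rightarrow> ell2" is "\<lambda>x y n. x n + y n"
  by (rule summable_sq_add)
lift_definition minus_ell2 :: "ell2 \<Rightarrow> ell2 \<Rightarrow> ell2" is "\<lambda>x y n. x n - y n"
  by (rule summable_sq_diff)
lift_definition uminus_ell2 :: "ell2 \<Rightarrow> ell2" is "\<lambda>x n. - x n" by simp
lift_definition scaleR_ell2 :: "real \<Rightarrow> ell2 \<Rightarrow> ell2" is "\<lambda>c x n. c * x n"
  by (simp add: power_mult_distrib summable_mult)
lift_definition inner_ell2 :: "ell2 \<Rightarrow> ell2 \<Rightarrow> real" is "\<lambda>x y. \<Sum>n. x n * y n" .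

definition norm_ell2 :: "ell2 \<Rightarrow> real" where "norm_ell2 x = sqrt (inner x x)"
definition sgn_ell2 :: "ell2 \<Rightarrow> ell2" where "sgn_ell2 x = inverse (norm x) *\<^sub>R x"
definition dist_ell2 :: "ell2 \<Rightarrow> ell2 \<Rightarrow> real" where "dist_ell2 x y = norm (x - y)"
definition uniformity_ell2 :: "(ell2 \<times> ell2) filter"
  where "uniformity_ell2 = (INF e\<in>{0<..}. principal {(x, y). dist x y < e})"
definition open_ell2 :: "ell2 set \<Rightarrow> bool"
  where "open_ell2 S = (\<forall>x\<in>S. \<forall>\<^sub>F (x', y) in uniformity. x' = x \<longrightarrow> y \<in> S)"

instance
proof
  fix x y z :: ell2 and c d :: real
  show "x + y + z = x + (y + z)" by transfer (simp add: add.assoc)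
  show "x + y = y + x" by transfer (simp add: add.commute)
  show "0 + x = x" by transfer simp
  show "- x + x = 0" by transfer simp
  show "x - y = x + - y" by transfer simp
  show "c *\<^sub>R (x + y) = c *\<^sub>R x + c *\<^sub>R y" by transfer (simp add: algebra_simps)
  show "(c + d) *\<^sub>R x = c *\<^sub>R x + d *\<^sub>R x" by transfer (simp add: algebra_simps)
  show "c *\<^sub>R d *\<^sub>R x = (c * d) *\<^sub>R x" by transfer (simp add: algebra_simps)
  show "1 *\<^sub>R x = x" by transfer simp
  show "inner x y = inner y x" by transfer (simp add: mult.commute)
  show "inner (x + y) z = inner x z + inner y z"
    by transfer (simp add: distrib_right suminf_add summable_sq_mult)
  show "inner (c *\<^sub>R x) y = c * inner x y"
    by transfer (simp add: mult.assoc suminf_mult summable_sq_mult)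
  show "0 \<le> inner x x"
    by transfer (simp add: suminf_nonneg summable_sq_mult)
  show "inner x x = 0 \<longleftrightarrow> x = 0"
    by transfer (simp add: suminf_eq_zero_iff summable_sq_mult fun_eq_iff)
qed (simp_all add: norm_ell2_def sgn_ell2_def dist_ell2_def uniformity_ell2_def open_ell2_def)

end

lemma norm_ell2_sq: "(norm x)\<^sup>2 = (\<Sum>n. (Rep_ell2 x n)\<^sup>2)" for x :: ell2
  unfolding power2_norm_eq_inner by (simp add: inner_ell2.rep_eq power2_eq_square)

lemma summable_ell2: "summable (\<lambda>n. (Rep_ell2 x n)\<^sup>2)"
  using Rep_ell2[of x] by simp

lemma sum_le_norm_ell2: "(\<Sum>n<k. (Rep_ell2 x n)\<^sup>2) \<le> (norm x)\<^sup>2"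
  unfolding norm_ell2_sq by (rule sum_le_suminf[OF summable_ell2]) auto

instance ell2 :: complete_space
proof
  fix X :: "nat \<Rightarrow> ell2"
  assume X: "Cauchy X"
  define c where "c m n = Rep_ell2 (X m) n" for m n
  have c_diff: "Rep_ell2 (X m - X l) n = c m n - c l n" for m l n
    by (simp add: c_def minus_ell2.rep_eq)
  have "Cauchy (\<lambda>m. c m n)" for n
  proof (rule metric_CauchyI)
    fix e :: real assume "0 < e"
    then obtain M where M: "\<And>m l. m \<ge> M \<Longrightarrow> l \<ge> M \<Longrightarrow> norm (X m - X l) < e"
      using X by (meson CauchyD)
    have "\<bar>c m n - c l n\<bar> \<le> norm (X m - X l)" for m l
    proof -
      have "(c m n - c l n)\<^sup>2 \<le> (\<Sum>i<Suc n. (Rep_ell2 (X m - X l) i)\<^sup>2)"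
        by (simp add: c_diff sum_nonneg)
      also have "\<dots> \<le> (norm (X m - X l))\<^sup>2" by (rule sum_le_norm_ell2)
      finally show ?thesis using abs_le_square_iff[of "c m n - c l n" "norm (X m - X l)"] by simp
    qed
    then show "\<exists>M. \<forall>m\<ge>M. \<forall>l\<ge>M. dist (c m n) (c l n) < e"
      using M unfolding dist_real_def by (meson le_less_trans)
  qed
  then have "\<forall>n. \<exists>l. (\<lambda>m. c m n) \<longlonglongrightarrow> l"
    by (simp add: Cauchy_convergent_iff convergent_def)
  then obtain L where L: "\<And>n. (\<lambda>m. c m n) \<longlonglongrightarrow> L n"
    by metis
  have key: "\<exists>M. \<forall>m\<ge>M. \<forall>k. (\<Sum>n<k. (c m n - L n)\<^sup>2) \<le> e\<^sup>2" if "0 < e" for e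
  proof -
    obtain M where M: "\<And>m l. m \<ge> M \<Longrightarrow> l \<ge> M \<Longrightarrow> norm (X m - X l) < e"
      using X \<open>0 < e\<close> by (meson CauchyD)
    have "(\<Sum>n<k. (c m n - L n)\<^sup>2) \<le> e\<^sup>2" if "m \<ge> M" for m k
    proof (rule LIMSEQ_le_const2)
      show "(\<lambda>l. \<Sum>n<k. (c m n - c l n)\<^sup>2) \<longlonglongrightarrow> (\<Sum>n<k. (c m n - L n)\<^sup>2)"
        by (intro tendsto_intros L)
      have "(\<Sum>n<k. (c m n - c l n)\<^sup>2) \<le> e\<^sup>2" if "l \<ge> M" for l
      proof -
        have "(\<Sum>n<k. (c m n - c l n)\<^sup>2) \<le> (norm (X m - X l))\<^sup>2"
          using sum_le_norm_ell2[where x = "X m - X l" and k = k] by (simp add: c_diff)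
        also have "\<dots> \<le> e\<^sup>2"
          using M[OF \<open>m \<ge> M\<close> that] by (intro power_mono) auto
        finally show ?thesis .
      qed
      then show "\<exists>N. \<forall>l\<ge>N. (\<Sum>n<k. (c m n - c l n)\<^sup>2) \<le> e\<^sup>2" by blast
    qed
    then show ?thesis by blast
  qed
  have bound: "summable (\<lambda>n. (c m n - L n)\<^sup>2) \<and> (\<Sum>n. (c m n - L n)\<^sup>2) \<le> e\<^sup>2"
    if "\<forall>k. (\<Sum>n<k. (c m n - L n)\<^sup>2) \<le> e\<^sup>2" for m e
  proof -
    have s: "summable (\<lambda>n. (c m n - L n)\<^sup>2)"
      using that by (intro summableI_nonneg_bounded[of _ "e\<^sup>2"]) auto
    then show ?thesis using that by (intro conjI suminf_le_const) auto
  qed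
  obtain M1 where "\<forall>k. (\<Sum>n<k. (c M1 n - L n)\<^sup>2) \<le> 1\<^sup>2"
    using key[of 1] by auto
  then have "summable (\<lambda>n. (c M1 n - L n)\<^sup>2)" using bound by blast
  from summable_sq_diff[OF summable_ell2 this, of "X M1", folded c_def]
  have sL: "summable (\<lambda>n. (L n)\<^sup>2)" by simp
  define l where "l = Abs_ell2 L"
  have Rl: "Rep_ell2 l = L" using sL by (simp add: l_def Abs_ell2_inverse)
  have "X \<longlonglongrightarrow> l"
  proof (rule metric_LIMSEQ_I)
    fix e :: real assume "0 < e"
    then obtain M where M: "\<forall>m\<ge>M. \<forall>k. (\<Sum>n<k. (c m n - L n)\<^sup>2) \<le> (e / 2)\<^sup>2"
      using key[of "e / 2"] by auto
    have "dist (X m) l < e" if "m \<ge> M" for m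
    proof -
      have "(norm (X m - l))\<^sup>2 = (\<Sum>n. (c m n - L n)\<^sup>2)"
        by (simp add: norm_ell2_sq minus_ell2.rep_eq c_def Rl)
      also have "\<dots> \<le> (e / 2)\<^sup>2" using M that bound by blast
      finally have "norm (X m - l) \<le> e / 2"
        using \<open>0 < e\<close> by (simp add: power2_le_iff_abs_le)
      then show ?thesis using \<open>0 < e\<close> by (simp add: dist_norm)
    qed
    then show "\<exists>M. \<forall>m\<ge>M. dist (X m) l < e" by blast
  qed
  then show "convergent X" by (rule convergentI)
qed

definition gradient_estimate_ell2 :: "'n::finite itself \<Rightarrow> real \<Rightarrow> real \<Rightarrow> bool" where
  "gradient_estimate_ell2 _ p N \<longleftrightarrow>
     (\<forall>H a b \<alpha> \<beta>. \<forall>f :: real \<times> (real ^ 'n) \<Rightarrow> real \<Rightarrow> ell2.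
        1 / 2 < H \<and> H < 1 \<and> a < b \<and> \<alpha> < \<beta> \<and> C0_infty_Lq (1 / H) a b (einterval \<alpha> \<beta>) f \<longrightarrow>
        gradient_square_integral p H a b \<alpha> \<beta> f \<le> ennreal N * mixed_norm_integral p H a b \<alpha> \<beta> f)"

definition gradient_const :: "'n::finite itself \<Rightarrow> real \<Rightarrow> real" where
  "gradient_const d p = (SOME N. gradient_estimate_ell2 d p N)"

end

theory Submission
  imports Defs "HOL-Probability.Distributions"
begin

text \<open>
  Let \<open>n(s,\<theta>)\<close> be the \<open>L\<^sub>p\<close>-norm of \<open>f(s,\<cdot>,\<theta>)\<close> and \<open>\<kappa>(s) = \<integral> n(s,\<theta>)\<^bsup>1/H\<^esup> d\<theta>\<close>. Jensen's inequality for the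
  probability density \<open>n\<^bsup>1/H\<^esup> / \<kappa>\<close> in \<open>\<theta>\<close> bounds the squared norm of \<open>\<nabla>T\<^bsub>t-s\<^esub>f(s,\<cdot>)(x)\<close> in \<open>L\<^bsub>1/H\<^esub>\<close> by a
  weighted integral of \<open>|\<nabla>T\<^bsub>t-s\<^esub>f(s,\<cdot>,\<theta>)(x)|\<^sup>2\<close> over \<open>\<theta>\<close>. This reduces the estimate, by duality with a
  weight \<open>w(t,x)\<close>, to bounding \<open>\<integral>\<integral> w(s+\<tau>,x) |\<nabla>T\<^bsub>\<tau>\<^esub>h(x)|\<^sup>2 dx d\<tau>\<close> for a single \<open>h\<close> and fixed \<open>s\<close>.

  Since \<open>|\<nabla>T\<^bsub>\<tau>\<^esub>h|\<^sup>2 \<le> T\<^bsub>\<tau>-\<sigma>\<^esub>|\<nabla>T\<^bsub>\<sigma>\<^esub>h|\<^sup>2\<close>, averaging over \<open>\<tau>\<close> comparable to \<open>\<sigma>\<close> replaces \<open>w\<close> by \<open>T\<^bsub>\<sigma>\<^esub>Z\<close>, where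
  \<open>Z\<close> is a one-sided maximal function of \<open>w\<close> in time only. Bessel's inequality in \<open>L\<^sub>2\<close> of a Gaussian,
  \<open>2\<delta> |\<nabla>T\<^bsub>\<delta>\<^esub>u|\<^sup>2 \<le> T\<^bsub>\<delta>\<^esub>|u|\<^sup>2 - |T\<^bsub>\<delta>\<^esub>u|\<^sup>2\<close>, and a Bellman function of \<open>|T\<^bsub>\<sigma>\<^esub>h|\<^sup>2\<close> and \<open>T\<^bsub>\<sigma>\<^esub>Z\<close> then make the sum over
  a geometric sequence of \<open>\<sigma>\<close> telescope. The values of \<open>f\<close> lie almost everywhere in a separable subspace
  of \<open>V\<close>, in which coordinates with respect to an orthonormal basis lead to the case \<open>V = \<ell>\<^sub>2\<close>.
\<close>

subsection \<open>Gaussian kernels\<close>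

text \<open>The quadratic identities of the heat flow are Hilbert space identities, while the values
  lie in \<open>L_(1/H)\<close> with \<open>1/H\<close> strictly between 1 and 2; this forces the
  detour through Jensen's inequality. The second obstacle is that the weight is read at time
  \<open>s + \<tau>\<close> and so moves while \<tau> runs. Averaging over a window of \<tau>
  freezes it into a majorant \<open>Z\<close> that no longer depends on \<tau>, and self-adjointness
  of the semigroup lets \<open>Z\<close> evolve by the same flow as \<open>h\<close>. Hence neither
  a maximal function in space nor a derivative in \<tau> occurs. In probabilistic terms
  \<open>T h\<close> and \<open>T Z\<close> are martingales when time is run backwards, and the
  Bellman function of them grows in the mean by at least the increments of the weighted square
  function. Everything starts at a positive time \<sigma>, with bounds uniform in \<sigma>, and
  \<sigma> tends to 0 only at the end. The weight lives in the dual exponent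
  \<open>p/(p - 2)\<close> of \<open>p/2\<close>, so \<open>p = 2\<close> is treated separately,
  with weight 1. Truncations supply the finiteness that allows terms to be absorbed.\<close>

lemma distr_lborel_reflect:
  fixes x :: "'a::euclidean_space"
  shows "distr lborel borel (\<lambda>y. x - y) = lborel"
  using lborel_affine[of "-1" x] by (simp add: density_1)

lemma nn_integral_lborel_reflect:
  fixes x :: "'a::euclidean_space"
  assumes [measurable]: "f \<in> borel_measurable borel"
  shows "(\<integral>\<^sup>+y. f (x - y) \<partial>lborel) = (\<integral>\<^sup>+y. f y \<partial>lborel)"
  by (subst (2) distr_lborel_reflect[symmetric, of x]) (simp add: nn_integral_distr)

lemma has_bochner_integral_lborel_reflect:
  fixes x :: "'a::euclidean_space" and f :: "'a \<Rightarrow> 'b::{banach, second_countable_topology}"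
  assumes "has_bochner_integral lborel f I"
  shows "has_bochner_integral lborel (\<lambda>y. f (x - y)) I"
proof -
  have [measurable]: "f \<in> borel_measurable borel"
    using assms by (auto dest: borel_measurable_has_bochner_integral)
  have "has_bochner_integral (distr lborel borel (\<lambda>y. x - y)) f I"
    using assms by (simp add: distr_lborel_reflect)
  then show ?thesis
    by (simp add: has_bochner_integral_iff integrable_distr_eq integral_distr)
qed

lemma AE_lborel_reflect:
  fixes x :: "'a::euclidean_space"
  assumes "AE y in lborel. P y"
  shows "AE y in lborel. P (x - y)"
proof -
  obtain N where N: "{y \<in> space lborel. \<not> P y} \<subseteq> N" "emeasure lborel N = 0" "N \<in> sets lborel"
    using AE_E[OF assms] by blast
  have "emeasure (distr lborel borel (\<lambda>y. x - y)) N = 0"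
    using N by (simp add: distr_lborel_reflect)
  then have "emeasure lborel ((\<lambda>y. x - y) -` N) = 0"
    using N by (subst (asm) emeasure_distr) auto
  moreover have "(\<lambda>y. x - y) -` N \<in> sets lborel"
    using N(3) measurable_sets[of "\<lambda>y. x - y" borel borel N] by simp
  ultimately show ?thesis
    using N(1) by (intro AE_I[of _ _ "(\<lambda>y. x - y) -` N"]) auto
qed

lemma has_bochner_integral_lborel_shift:
  fixes x :: "'a::euclidean_space" and f :: "'a \<Rightarrow> 'b::{banach, second_countable_topology}"
  assumes "has_bochner_integral lborel f I"
  shows "has_bochner_integral lborel (\<lambda>y. f (y - x)) I"
  using has_bochner_integral_lborel_reflect[OF has_bochner_integral_lborel_reflect[OF assms, of 0], of x]
  by simp

text \<open>Lebesgue measure is the image of a product measure indexed by \<open>Basis\<close>, on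
  which integrals of products factor. This reduces Gaussian moments on \<open>real^'n\<close> to
  moments on the line.\<close>

lemma has_bochner_integral_lborel_prod:
  fixes f :: "'a::euclidean_space \<Rightarrow> real \<Rightarrow> real"
  assumes f: "\<And>b. b \<in> Basis \<Longrightarrow> has_bochner_integral lborel (f b) (I b)"
  shows "has_bochner_integral lborel (\<lambda>x. \<Prod>b\<in>Basis. f b (x \<bullet> b)) (\<Prod>b\<in>Basis. I b)"
proof -
  interpret P: product_sigma_finite "\<lambda>_::'a. lborel :: real measure" by standard
  have [measurable]: "b \<in> Basis \<Longrightarrow> f b \<in> borel_measurable borel" for b
    using f by (auto dest: borel_measurable_has_bochner_integral)
  have i: "b \<in> Basis \<Longrightarrow> integrable lborel (f b)" for b
    using f by (simp add: has_bochner_integral_iff)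
  have eq: "(\<Prod>b\<in>Basis. f b ((\<Sum>b\<in>Basis. g b *\<^sub>R b) \<bullet> b)) = (\<Prod>b\<in>Basis. f b (g b))" for g :: "'a \<Rightarrow> real"
    by (intro prod.cong refl) simp
  have m: "(\<lambda>x::'a. \<Prod>b\<in>Basis. f b (x \<bullet> b)) \<in> borel_measurable borel"
    by measurable
  have "has_bochner_integral (Pi\<^sub>M Basis (\<lambda>_. lborel)) (\<lambda>x. \<Prod>b\<in>Basis. f b (x b)) (\<Prod>b\<in>Basis. I b)"
    using P.product_integrable_prod[OF finite_Basis i] P.product_integral_prod[OF finite_Basis i] f
    by (simp add: has_bochner_integral_iff)
  then show ?thesis
    using m unfolding has_bochner_integral_iff
    by (subst lborel_eq, subst (2) lborel_eq) (simp add: integrable_distr_eq integral_distr eq)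
qed

section \<open>The heat kernel: moments, products and convolutions\<close>

lemma heat_kernel_nonneg [simp]: "0 \<le> heat_kernel t x"
  by (simp add: heat_kernel_def)

lemma heat_kernel_commute: "heat_kernel t (x - y) = heat_kernel t (y - x)"
  by (simp add: heat_kernel_def norm_minus_commute)

lemma borel_measurable_heat_kernel [measurable (raw)]:
  assumes [measurable]: "f \<in> borel_measurable M" "g \<in> borel_measurable M"
  shows "(\<lambda>z. heat_kernel (f z) (g z :: real^'n)) \<in> borel_measurable M"
  unfolding heat_kernel_def by measurable

text \<open>The heat kernel is the joint density of independent centred normal coordinates; their
  variance is \<open>2 * t\<close>, which explains the standard deviation
  \<open>sqrt (2 * t)\<close>.\<close>

lemma heat_kernel_prod:
  assumes "0 < t"
  shows "heat_kernel t (x :: real^'n) = (\<Prod>b\<in>Basis. normal_density 0 (sqrt (2 * t)) (x \<bullet> b))"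
proof -
  have n: "(norm x)\<^sup>2 = (\<Sum>b\<in>Basis. (x \<bullet> b)\<^sup>2)"
    by (simp only: power2_norm_eq_inner) (subst euclidean_inner, simp add: power2_eq_square)
  have "(4 * pi * t) powr (- real CARD('n) / 2) = (\<Prod>b\<in>(Basis::(real^'n) set). (4 * pi * t) powr (- 1 / 2))"
    using assms by (simp add: powr_powr[symmetric] powr_realpow[symmetric] powr_powr)
  also have "\<dots> = (\<Prod>b\<in>(Basis::(real^'n) set). 1 / sqrt (2 * pi * (sqrt (2 * t))\<^sup>2))"
    using assms by (intro prod.cong refl) (simp add: powr_minus_divide powr_half_sqrt)
  finally have p: "(4 * pi * t) powr (- real CARD('n) / 2) =
    (\<Prod>b\<in>(Basis::(real^'n) set). 1 / sqrt (2 * pi * (sqrt (2 * t))\<^sup>2))" .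
  have "exp (- (norm x)\<^sup>2 / (4 * t)) = (\<Prod>b\<in>Basis. exp (- (x \<bullet> b)\<^sup>2 / (4 * t)))"
    by (simp add: n exp_sum[symmetric] sum_negf sum_divide_distrib)
  with p show ?thesis
    using assms unfolding heat_kernel_def normal_density_def prod.distrib by simp
qed

lemma heat_kernel_moments_aux:
  fixes k :: "real^'n \<Rightarrow> nat"
  assumes t: "0 < t"
    and I: "\<And>b. b \<in> Basis \<Longrightarrow> has_bochner_integral lborel (\<lambda>u. normal_density 0 (sqrt (2 * t)) u * u ^ k b) (I b)"
  shows "has_bochner_integral lborel (\<lambda>x. heat_kernel t x * (\<Prod>b\<in>Basis. (x \<bullet> b) ^ k b)) (\<Prod>b\<in>Basis. I b)"
  using has_bochner_integral_lborel_prod[OF I] by (simp add: heat_kernel_prod[OF t] prod.distrib)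

lemma normal_moments:
  assumes "0 < t"
  shows "has_bochner_integral lborel (\<lambda>u. normal_density 0 (sqrt (2 * t)) u * u ^ 0) 1"
    and "has_bochner_integral lborel (\<lambda>u. normal_density 0 (sqrt (2 * t)) u * u ^ 1) 0"
    and "has_bochner_integral lborel (\<lambda>u. normal_density 0 (sqrt (2 * t)) u * u ^ 2) (2 * t)"
proof -
  have s: "0 < sqrt (2 * t)" using assms by simp
  show "has_bochner_integral lborel (\<lambda>u. normal_density 0 (sqrt (2 * t)) u * u ^ 0) 1"
    using normal_moment_even[OF s, of 0 0] by simp
  show "has_bochner_integral lborel (\<lambda>u. normal_density 0 (sqrt (2 * t)) u * u ^ 1) 0"
    using normal_moment_odd[OF s, of 0 0] by simp
  show "has_bochner_integral lborel (\<lambda>u. normal_density 0 (sqrt (2 * t)) u * u ^ 2) (2 * t)"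
    using normal_moment_even[OF s, of 0 1] assms by (simp add: fact_numeral)
qed

lemma heat_kernel_integral:
  assumes t: "0 < t"
  shows "has_bochner_integral lborel (heat_kernel t :: real^'n \<Rightarrow> real) 1"
  using heat_kernel_moments_aux[OF t, of "\<lambda>_. 0" "\<lambda>_. 1"] normal_moments[OF t] by simp

lemma heat_kernel_moment1:
  assumes t: "0 < t"
  shows "has_bochner_integral lborel (\<lambda>x::real^'n. heat_kernel t x * x $ i) 0"
proof -
  let ?e = "axis i 1 :: real^'n"
  have e: "?e \<in> Basis" unfolding Basis_vec_def by auto
  have "has_bochner_integral lborel (\<lambda>x::real^'n. heat_kernel t x * (\<Prod>b\<in>Basis. (x \<bullet> b) ^ (if b = ?e then 1 else 0)))
     (\<Prod>b\<in>Basis. if b = ?e then 0 else 1)"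
    using normal_moments[OF t] by (intro heat_kernel_moments_aux[OF t]) auto
  moreover have "(\<Prod>b\<in>Basis. (x \<bullet> b) ^ (if b = ?e then 1 else 0)) = x $ i" for x :: "real^'n"
  proof -
    have "(\<Prod>b\<in>Basis. (x \<bullet> b) ^ (if b = ?e then 1 else 0)) = (\<Prod>b\<in>Basis. if b = ?e then x \<bullet> b else 1)"
      by (intro prod.cong) auto
    also have "\<dots> = x $ i" using e by (simp add: inner_axis)
    finally show ?thesis .
  qed
  ultimately show ?thesis
    using e by (simp add: prod_zero_iff)
qed

lemma heat_kernel_moment2:
  assumes t: "0 < t"
  shows "has_bochner_integral lborel (\<lambda>x::real^'n. heat_kernel t x * (x $ i * x $ j)) (if i = j then 2 * t else 0)"
proof -
  let ?e = "axis i 1 :: real^'n" and ?f = "axis j 1 :: real^'n"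
  have e: "?e \<in> Basis" "?f \<in> Basis" unfolding Basis_vec_def by auto
  have ef: "?e = ?f \<longleftrightarrow> i = j" by (simp add: axis_eq_axis)
  \<comment> \<open>\<open>?k\<close> counts how often a coordinate occurs in the monomial, so
    \<open>i = j\<close> gives exponent 2 at one basis vector and \<open>i \<noteq> j\<close> gives
    exponent 1 at two of them.\<close>
  let ?k = "\<lambda>b. (if b = ?e then 1 else 0) + (if b = ?f then 1 else 0) :: nat"
  let ?I = "\<lambda>b. if b = ?e \<and> b = ?f then 2 * t else if b = ?e \<or> b = ?f then 0 else 1"
  have "has_bochner_integral lborel (\<lambda>x::real^'n. heat_kernel t x * (\<Prod>b\<in>Basis. (x \<bullet> b) ^ ?k b)) (\<Prod>b\<in>Basis. ?I b)"
    using normal_moments[OF t] by (intro heat_kernel_moments_aux[OF t]) (auto simp: numeral_2_eq_2)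
  moreover have "(\<Prod>b\<in>Basis. (x \<bullet> b) ^ ?k b) = x $ i * x $ j" for x :: "real^'n"
  proof -
    have "(\<Prod>b\<in>Basis. (x \<bullet> b) ^ ?k b) = (\<Prod>b\<in>Basis. if b = ?e then x \<bullet> b else 1) * (\<Prod>b\<in>Basis. if b = ?f then x \<bullet> b else 1)"
      unfolding prod.distrib[symmetric] by (intro prod.cong) auto
    also have "\<dots> = x $ i * x $ j" using e by (simp add: inner_axis)
    finally show ?thesis .
  qed
  moreover have "(\<Prod>b\<in>Basis. ?I b) = (if i = j then 2 * t else 0)"
  proof (cases "i = j")
    case True
    then have "(\<Prod>b\<in>Basis. ?I b) = (\<Prod>b\<in>Basis. if b = ?e then 2 * t else 1)"
      by (intro prod.cong) auto
    then show ?thesis using True e by simp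
  next
    case False
    then show ?thesis using e ef by (auto simp: prod_zero_iff intro!: bexI[of _ ?e])
  qed
  ultimately show ?thesis by simp
qed

lemma nn_integral_heat_kernel:
  assumes t: "0 < t"
  shows "(\<integral>\<^sup>+y. ennreal (heat_kernel t (y :: real^'n)) \<partial>lborel) = 1"
  using heat_kernel_integral[OF t, where 'n='n] by (simp add: has_bochner_integral_iff nn_integral_eq_integral)

lemma nn_integral_heat_kernel_shift:
  assumes t: "0 < t"
  shows "(\<integral>\<^sup>+y. ennreal (heat_kernel t (x - y :: real^'n)) \<partial>lborel) = 1"
    and "(\<integral>\<^sup>+y. ennreal (heat_kernel t (y - x :: real^'n)) \<partial>lborel) = 1"
  using nn_integral_lborel_reflect[of "\<lambda>y. ennreal (heat_kernel t y)" x] nn_integral_heat_kernel[OF t, where 'n='n]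
  by (simp_all add: heat_kernel_commute[of t _ x])

text \<open>Completing the square in \<open>y\<close>. The second factor on the right is the density
  of the Brownian bridge from \<open>z\<close> to \<open>x\<close>, with centre on the segment
  between them and time parameter \<open>a * b / (a + b)\<close>; convolutions thereby become
  moments of a single centred Gaussian.\<close>

lemma heat_kernel_mult:
  fixes x y z :: "real^'n"
  assumes a: "0 < a" and b: "0 < b"
  shows "heat_kernel a (x - y) * heat_kernel b (y - z) =
    heat_kernel (a + b) (x - z) * heat_kernel (a * b / (a + b)) (y - (z + (b / (a + b)) *\<^sub>R (x - z)))"
proof -
  define p where "p = x - y"
  define q where "q = y - z"
  have ab: "0 < a + b" using a b by simp
  have xz: "x - z = p + q" by (simp add: p_def q_def)
  have "(a + b) *\<^sub>R (y - (z + (b / (a + b)) *\<^sub>R (x - z))) = (a + b) *\<^sub>R q - b *\<^sub>R (p + q)"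
    using ab by (simp add: xz q_def scaleR_diff_right scaleR_add_right)
  also have "\<dots> = a *\<^sub>R q - b *\<^sub>R p" by (simp add: algebra_simps)
  finally have yc: "(a + b) *\<^sub>R (y - (z + (b / (a + b)) *\<^sub>R (x - z))) = a *\<^sub>R q - b *\<^sub>R p" .
  then have yc: "y - (z + (b / (a + b)) *\<^sub>R (x - z)) = (1 / (a + b)) *\<^sub>R (a *\<^sub>R q - b *\<^sub>R p)"
    using ab by (metis (no_types, lifting) divide_self less_irrefl scaleR_one scaleR_scaleR times_divide_eq_left mult_1)
  have n1: "(norm (p + q))\<^sup>2 = (norm p)\<^sup>2 + 2 * (p \<bullet> q) + (norm q)\<^sup>2"
    by (simp add: power2_norm_eq_inner inner_add_left inner_add_right inner_commute)
  have "(norm (a *\<^sub>R q - b *\<^sub>R p))\<^sup>2 = a\<^sup>2 * (norm q)\<^sup>2 - 2 * a * b * (p \<bullet> q) + b\<^sup>2 * (norm p)\<^sup>2"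
    unfolding power2_norm_eq_inner
    by (simp add: inner_diff_left inner_diff_right inner_commute power2_eq_square algebra_simps)
  then have n2: "(norm ((1 / (a + b)) *\<^sub>R (a *\<^sub>R q - b *\<^sub>R p)))\<^sup>2 =
     (a\<^sup>2 * (norm q)\<^sup>2 - 2 * a * b * (p \<bullet> q) + b\<^sup>2 * (norm p)\<^sup>2) / (a + b)\<^sup>2"
    using ab by (simp add: power_divide)
  have ex: "(norm p)\<^sup>2 / (4 * a) + (norm q)\<^sup>2 / (4 * b) =
     (norm (p + q))\<^sup>2 / (4 * (a + b)) + (norm ((1 / (a + b)) *\<^sub>R (a *\<^sub>R q - b *\<^sub>R p)))\<^sup>2 / (4 * (a * b / (a + b)))"
  proof -
    \<comment> \<open>Clearing this common denominator turns the equality of exponents into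
      \<open>(b |p|^2 + a |q|^2) (a + b) = a b |p + q|^2 + |a q - b p|^2\<close>.\<close>
    let ?S = "4 * a * b * (a + b)"
    have "0 < ?S" using a b ab by simp
    moreover have "((norm p)\<^sup>2 / (4 * a) + (norm q)\<^sup>2 / (4 * b)) * ?S = (b * (norm p)\<^sup>2 + a * (norm q)\<^sup>2) * (a + b)"
      using a b by (simp add: field_simps)
    moreover have "((norm (p + q))\<^sup>2 / (4 * (a + b))) * ?S = a * b * (norm (p + q))\<^sup>2"
      using a b ab by (simp add: field_simps)
    moreover have "((norm ((1 / (a + b)) *\<^sub>R (a *\<^sub>R q - b *\<^sub>R p)))\<^sup>2 / (4 * (a * b / (a + b)))) * ?S =
       a\<^sup>2 * (norm q)\<^sup>2 - 2 * a * b * (p \<bullet> q) + b\<^sup>2 * (norm p)\<^sup>2"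
      unfolding n2 using a b ab by (simp add: divide_simps) (simp add: power2_eq_square algebra_simps)
    moreover have "(b * (norm p)\<^sup>2 + a * (norm q)\<^sup>2) * (a + b) = a * b * (norm (p + q))\<^sup>2 +
       (a\<^sup>2 * (norm q)\<^sup>2 - 2 * a * b * (p \<bullet> q) + b\<^sup>2 * (norm p)\<^sup>2)"
      unfolding n1 by (simp add: power2_eq_square algebra_simps)
    ultimately have "((norm p)\<^sup>2 / (4 * a) + (norm q)\<^sup>2 / (4 * b)) * ?S =
      ((norm (p + q))\<^sup>2 / (4 * (a + b)) + (norm ((1 / (a + b)) *\<^sub>R (a *\<^sub>R q - b *\<^sub>R p)))\<^sup>2 / (4 * (a * b / (a + b)))) * ?S"
      by (simp only: distrib_right)
    then show ?thesis by (rule mult_right_cancel[THEN iffD1, rotated]) (use a b ab in simp)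
  qed
  have pw: "(4 * pi * a) powr u * (4 * pi * b) powr u = (4 * pi * (a + b)) powr u * (4 * pi * (a * b / (a + b))) powr u" for u
  proof -
    have "(4 * pi * a) * (4 * pi * b) = (4 * pi * (a + b)) * (4 * pi * (a * b / (a + b)))"
      using ab by (simp add: field_simps)
    moreover have "(4 * pi * a) powr u * (4 * pi * b) powr u = ((4 * pi * a) * (4 * pi * b)) powr u"
      using a b by (subst powr_mult[symmetric]) auto
    moreover have "(4 * pi * (a + b)) powr u * (4 * pi * (a * b / (a + b))) powr u = ((4 * pi * (a + b)) * (4 * pi * (a * b / (a + b)))) powr u"
      using a b ab by (subst powr_mult[symmetric]) auto
    ultimately show ?thesis by simp
  qed
  define P where "P t = (4 * pi * t) powr (- real CARD('n) / 2)" for t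
  have E: "heat_kernel t y = P t * exp (- ((norm y)\<^sup>2 / (4 * t)))" for t and y :: "real^'n"
    by (simp add: heat_kernel_def P_def)
  have "heat_kernel a p * heat_kernel b q = (P a * P b) * exp (- ((norm p)\<^sup>2 / (4 * a) + (norm q)\<^sup>2 / (4 * b)))"
    by (simp only: E minus_add_distrib exp_add mult_ac)
  also have "\<dots> = heat_kernel (a + b) (p + q) * heat_kernel (a * b / (a + b)) ((1 / (a + b)) *\<^sub>R (a *\<^sub>R q - b *\<^sub>R p))"
    unfolding ex pw[of "- real CARD('n) / 2", folded P_def] by (simp only: E minus_add_distrib exp_add mult_ac)
  finally show ?thesis unfolding yc by (simp add: p_def q_def)
qed

text \<open>The partial derivative of the kernel in closed form. Convolution identities and bounds
  are algebra on this formula; it is tied to actual differentiation only by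
  \<open>heat_kernel_taylor\<close>.\<close>

definition heat_kernel_deriv :: "real \<Rightarrow> 'n \<Rightarrow> real ^ 'n \<Rightarrow> real" where
  "heat_kernel_deriv t i x = - (x $ i) / (2 * t) * heat_kernel t x"

lemma borel_measurable_heat_kernel_deriv [measurable (raw)]:
  assumes [measurable]: "f \<in> borel_measurable M" "g \<in> borel_measurable M"
  shows "(\<lambda>z. heat_kernel_deriv (f z) i (g z :: real^'n)) \<in> borel_measurable M"
proof -
  have [measurable]: "(\<lambda>z. g z $ i) \<in> borel_measurable M"
    using borel_measurable_inner[OF assms(2) measurable_const[of "axis i 1"]] by (simp add: inner_axis)
  show ?thesis unfolding heat_kernel_deriv_def by measurable
qed

text \<open>By \<open>heat_kernel_mult\<close> the integrand is a Gaussian centred at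
  \<open>c\<close>. For the derivative, split \<open>y - z = (y - c) + (c - z)\<close>: the first
  part integrates to 0, and \<open>c - z = b / (a + b) * (x - z)\<close> turns the factor
  \<open>1 / (2 * b)\<close> into \<open>1 / (2 * (a + b))\<close>.\<close>

lemma heat_kernel_conv:
  fixes x z :: "real^'n"
  assumes a: "0 < a" and b: "0 < b"
  shows "has_bochner_integral lborel (\<lambda>y. heat_kernel a (x - y) * heat_kernel b (y - z)) (heat_kernel (a + b) (x - z))"
    and "has_bochner_integral lborel (\<lambda>y. heat_kernel a (x - y) * heat_kernel_deriv b i (y - z)) (heat_kernel_deriv (a + b) i (x - z))"
proof -
  define c where "c = z + (b / (a + b)) *\<^sub>R (x - z)"
  define r where "r = a * b / (a + b)"
  have r: "0 < r" using a b by (simp add: r_def)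
  note m = heat_kernel_mult[OF a b, of x _ z, folded r_def c_def]
  note i0 = has_bochner_integral_lborel_shift[OF heat_kernel_integral[OF r], where x=c]
  note i1 = has_bochner_integral_lborel_shift[OF heat_kernel_moment1[OF r, of i], where x=c]
  show "has_bochner_integral lborel (\<lambda>y. heat_kernel a (x - y) * heat_kernel b (y - z)) (heat_kernel (a + b) (x - z))"
    unfolding m using has_bochner_integral_mult_right[OF i0, of "heat_kernel (a + b) (x - z)"] by simp
  let ?K = "- heat_kernel (a + b) (x - z) / (2 * b)"
  have "has_bochner_integral lborel (\<lambda>y. ?K * (heat_kernel r (y - c) * (y - c) $ i + (c - z) $ i * heat_kernel r (y - c)))
     (?K * (0 + (c - z) $ i * 1))"
    by (intro has_bochner_integral_mult_right has_bochner_integral_add i0 i1)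
  moreover have "?K * (heat_kernel r (y - c) * (y - c) $ i + (c - z) $ i * heat_kernel r (y - c)) =
     heat_kernel a (x - y) * heat_kernel_deriv b i (y - z)" for y
  proof -
    have "heat_kernel a (x - y) * heat_kernel_deriv b i (y - z) = - ((y - z) $ i) / (2 * b) * (heat_kernel a (x - y) * heat_kernel b (y - z))"
      by (simp add: heat_kernel_deriv_def)
    also have "\<dots> = - ((y - c) $ i + (c - z) $ i) / (2 * b) * (heat_kernel (a + b) (x - z) * heat_kernel r (y - c))"
      unfolding m by simp
    also have "\<dots> = ?K * (heat_kernel r (y - c) * (y - c) $ i + (c - z) $ i * heat_kernel r (y - c))"
      using b by (simp add: field_simps del: vector_minus_component)
    finally show ?thesis by (rule sym)
  qed
  moreover have "(c - z) $ i = b / (a + b) * (x - z) $ i"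
    by (simp add: c_def)
  then have "?K * (0 + (c - z) $ i * 1) = heat_kernel_deriv (a + b) i (x - z)"
    using a b by (simp add: heat_kernel_deriv_def del: vector_minus_component)
  ultimately show "has_bochner_integral lborel (\<lambda>y. heat_kernel a (x - y) * heat_kernel_deriv b i (y - z)) (heat_kernel_deriv (a + b) i (x - z))"
    by simp
qed

text \<open>The exponential factor increases with time, so only the ratio of the normalising factors
  is lost. Its power \<open>d/2\<close> is the source of the dimension dependence of the final
  constant.\<close>

lemma heat_kernel_le:
  fixes x :: "real^'n"
  assumes "0 < s" "s \<le> t"
  shows "heat_kernel s x \<le> (t / s) powr (real CARD('n) / 2) * heat_kernel t x"
proof -
  let ?d = "real CARD('n) / 2"
  have "(4 * pi * s) powr (- ?d) = (t / s) powr ?d * (4 * pi * t) powr (- ?d)"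
    using assms by (simp add: powr_minus powr_mult powr_divide field_simps)
  moreover have "exp (- (norm x)\<^sup>2 / (4 * s)) \<le> exp (- (norm x)\<^sup>2 / (4 * t))"
    using assms by (simp add: divide_left_mono)
  ultimately show ?thesis
    unfolding heat_kernel_def
    by (simp only: minus_divide_left mult.assoc) (intro mult_left_mono, auto)
qed

lemma le_exp_square: "u \<le> exp (u\<^sup>2)" for u :: real
proof -
  have "u \<le> 1 + u\<^sup>2"
  proof -
    have "0 \<le> (u - 1/2)\<^sup>2" by simp
    then show ?thesis by (simp add: power2_eq_square algebra_simps)
  qed
  also have "\<dots> \<le> exp (u\<^sup>2)" by (rule exp_ge_add_one_self)
  finally show ?thesis .
qed

text \<open>Half of the exponent absorbs the linear factor: \<open>le_exp_square\<close> with
  \<open>u = norm x / sqrt (8 * t)\<close> spends \<open>1 / (8 * t)\<close> out of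
  \<open>1 / (4 * t)\<close>, and what remains is the exponent at time \<open>2 * t\<close>.\<close>

lemma norm_heat_kernel_le:
  fixes x :: "real^'n"
  assumes t: "0 < t"
  shows "norm x * heat_kernel t x \<le> sqrt (8 * t) * 2 powr (real CARD('n) / 2) * heat_kernel (2 * t) x"
proof -
  let ?d = "real CARD('n) / 2"
  have p: "(4 * pi * t) powr (- ?d) = 2 powr ?d * (4 * pi * (2 * t)) powr (- ?d)"
    using t powr_mult[of 2 "4 * pi * t" "- ?d"]
    by (simp add: powr_minus mult.assoc[symmetric] mult.left_commute[of 2])
  have "norm x / sqrt (8 * t) \<le> exp ((norm x)\<^sup>2 / (8 * t))"
    using le_exp_square[of "norm x / sqrt (8 * t)"] t by (simp add: power_divide)
  then have "norm x \<le> sqrt (8 * t) * exp ((norm x)\<^sup>2 / (8 * t))"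
    using t by (simp add: field_simps)
  then have "norm x * exp (- (norm x)\<^sup>2 / (4 * t)) \<le> sqrt (8 * t) * exp ((norm x)\<^sup>2 / (8 * t)) * exp (- (norm x)\<^sup>2 / (4 * t))"
    by (rule mult_right_mono) simp
  also have "\<dots> = sqrt (8 * t) * exp (- (norm x)\<^sup>2 / (4 * (2 * t)))"
    using t by (simp add: exp_add[symmetric] field_simps)
  finally have e: "norm x * exp (- (norm x)\<^sup>2 / (4 * t)) \<le> sqrt (8 * t) * exp (- (norm x)\<^sup>2 / (4 * (2 * t)))" .
  have "norm x * heat_kernel t x = 2 powr ?d * (4 * pi * (2 * t)) powr (- ?d) * (norm x * exp (- (norm x)\<^sup>2 / (4 * t)))"
    unfolding heat_kernel_def using p by simp
  also have "\<dots> \<le> 2 powr ?d * (4 * pi * (2 * t)) powr (- ?d) * (sqrt (8 * t) * exp (- (norm x)\<^sup>2 / (4 * (2 * t))))"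
    by (intro mult_left_mono e) simp
  finally show ?thesis by (simp add: heat_kernel_def mult_ac)
qed

text \<open>Domination by the kernel at the doubled time makes finiteness of Gaussian averages
  sufficient for convolutions with the derivative as well.\<close>

lemma heat_kernel_deriv_bound:
  assumes t: "0 < t"
  obtains C where "0 \<le> C" "\<And>i (x::real^'n). \<bar>heat_kernel_deriv t i x\<bar> \<le> C * heat_kernel (2 * t) x"
proof
  let ?C = "1 / (2 * t) * (sqrt (8 * t) * 2 powr (real CARD('n) / 2))"
  show "0 \<le> ?C" using t by simp
  fix i and x :: "real^'n"
  have "\<bar>heat_kernel_deriv t i x\<bar> = 1 / (2 * t) * (\<bar>x $ i\<bar> * heat_kernel t x)"
    using t by (simp add: heat_kernel_deriv_def abs_mult)
  also have "\<dots> \<le> 1 / (2 * t) * (norm x * heat_kernel t x)"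
    using t by (intro mult_left_mono mult_right_mono component_le_norm_cart) auto
  also have "\<dots> \<le> 1 / (2 * t) * (sqrt (8 * t) * 2 powr (real CARD('n) / 2) * heat_kernel (2 * t) x)"
    using t by (intro mult_left_mono norm_heat_kernel_le) auto
  finally show "\<bar>heat_kernel_deriv t i x\<bar> \<le> ?C * heat_kernel (2 * t) x" by (simp add: mult_ac)
qed

subsection \<open>The heat semigroup on nonnegative and on vector-valued functions\<close>

definition heat_nn :: "real \<Rightarrow> (real^'n \<Rightarrow> ennreal) \<Rightarrow> real^'n \<Rightarrow> ennreal" where
  "heat_nn t \<phi> x = (\<integral>\<^sup>+y. ennreal (heat_kernel t (x - y)) * \<phi> y \<partial>lborel)"

definition heat :: "real \<Rightarrow> (real^'n \<Rightarrow> 'v::{banach, second_countable_topology}) \<Rightarrow> real^'n \<Rightarrow> 'v" where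
  "heat t h x = (\<integral>y. heat_kernel t (x - y) *\<^sub>R h y \<partial>lborel)"

definition heat_deriv :: "real \<Rightarrow> 'n \<Rightarrow> (real^'n \<Rightarrow> 'v::{banach, second_countable_topology}) \<Rightarrow> real^'n \<Rightarrow> 'v" where
  "heat_deriv t i h x = (\<integral>y. heat_kernel_deriv t i (x - y) *\<^sub>R h y \<partial>lborel)"

definition heat_grad_sq :: "real \<Rightarrow> (real^'n \<Rightarrow> 'v::{banach, second_countable_topology}) \<Rightarrow> real^'n \<Rightarrow> real" where
  "heat_grad_sq t h x = (\<Sum>i\<in>UNIV. (norm (heat_deriv t i h x))\<^sup>2)"

text \<open>Finiteness of all Gaussian averages is a condition that holds for \<open>L_p\<close>
  functions and for bounded weights alike and is preserved by the flow, so data and weights are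
  treated together.\<close>

definition heat_admissible :: "(real^'n \<Rightarrow> 'v::{banach, second_countable_topology}) \<Rightarrow> bool" where
  "heat_admissible h \<longleftrightarrow> h \<in> borel_measurable borel \<and> (\<forall>t>0. \<forall>x. heat_nn t (\<lambda>y. ennreal (norm (h y))) x < \<infinity>)"

definition heat_admissible2 :: "(real^'n \<Rightarrow> 'v::{banach, second_countable_topology}) \<Rightarrow> bool" where
  "heat_admissible2 h \<longleftrightarrow> h \<in> borel_measurable borel \<and> (\<forall>t>0. \<forall>x. heat_nn t (\<lambda>y. ennreal ((norm (h y))\<^sup>2)) x < \<infinity>)"

lemma heat_admissibleD:
  assumes "heat_admissible h"
  shows "h \<in> borel_measurable borel" "0 < t \<Longrightarrow> heat_nn t (\<lambda>y. ennreal (norm (h y))) x < \<infinity>"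
  using assms by (auto simp: heat_admissible_def)

lemma heat_admissible2D:
  assumes "heat_admissible2 h"
  shows "h \<in> borel_measurable borel" "0 < t \<Longrightarrow> heat_nn t (\<lambda>y. ennreal ((norm (h y))\<^sup>2)) x < \<infinity>"
  using assms by (auto simp: heat_admissible2_def)

lemma borel_measurable_heat_nn [measurable (raw)]:
  fixes \<phi> :: "'z \<Rightarrow> real^'n \<Rightarrow> ennreal"
  assumes [measurable]: "t \<in> borel_measurable M" "x \<in> borel_measurable M" "case_prod \<phi> \<in> borel_measurable (M \<Otimes>\<^sub>M borel)"
  shows "(\<lambda>z. heat_nn (t z) (\<phi> z) (x z)) \<in> borel_measurable M"
  unfolding heat_nn_def by measurable

lemma borel_measurable_heat [measurable (raw)]:
  fixes h :: "'z \<Rightarrow> real^'n \<Rightarrow> 'v::{banach, second_countable_topology}"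
  assumes [measurable]: "t \<in> borel_measurable M" "x \<in> borel_measurable M" "case_prod h \<in> borel_measurable (M \<Otimes>\<^sub>M borel)"
  shows "(\<lambda>z. heat (t z) (h z) (x z)) \<in> borel_measurable M"
  unfolding heat_def by measurable

lemma borel_measurable_heat_deriv [measurable (raw)]:
  fixes h :: "'z \<Rightarrow> real^'n \<Rightarrow> 'v::{banach, second_countable_topology}"
  assumes [measurable]: "t \<in> borel_measurable M" "x \<in> borel_measurable M" "case_prod h \<in> borel_measurable (M \<Otimes>\<^sub>M borel)"
  shows "(\<lambda>z. heat_deriv (t z) i (h z) (x z)) \<in> borel_measurable M"
  unfolding heat_deriv_def by measurable

lemma borel_measurable_heat_grad_sq [measurable (raw)]:
  fixes h :: "'z \<Rightarrow> real^'n \<Rightarrow> 'v::{banach, second_countable_topology}"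
  assumes [measurable]: "t \<in> borel_measurable M" "x \<in> borel_measurable M" "case_prod h \<in> borel_measurable (M \<Otimes>\<^sub>M borel)"
  shows "(\<lambda>z. heat_grad_sq (t z) (h z) (x z)) \<in> borel_measurable M"
  unfolding heat_grad_sq_def by measurable

lemma heat_nn_mono: "(\<And>y. \<phi> y \<le> \<psi> y) \<Longrightarrow> heat_nn t \<phi> x \<le> heat_nn t \<psi> x"
  unfolding heat_nn_def by (intro nn_integral_mono mult_left_mono) auto

lemma heat_nn_add:
  assumes [measurable]: "\<phi> \<in> borel_measurable borel" "\<psi> \<in> borel_measurable borel"
  shows "heat_nn t (\<lambda>y. \<phi> y + \<psi> y) x = heat_nn t \<phi> x + heat_nn t \<psi> x"
  unfolding heat_nn_def by (simp add: distrib_left nn_integral_add)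

lemma heat_nn_cmult:
  assumes [measurable]: "\<phi> \<in> borel_measurable borel"
  shows "heat_nn t (\<lambda>y. c * \<phi> y) x = c * heat_nn t \<phi> x"
  unfolding heat_nn_def by (simp add: mult.left_commute[of _ c] nn_integral_cmult)

lemma heat_nn_const:
  assumes "0 < t" shows "heat_nn t (\<lambda>y. c) x = c"
  unfolding heat_nn_def by (simp add: nn_integral_multc nn_integral_heat_kernel_shift[OF assms])

text \<open>Self-adjointness of the semigroup, from the symmetry of the kernel. It later moves the
  flow from \<open>|\<nabla> T h|^2\<close> to the weight.\<close>

lemma nn_integral_mult_heat_nn:
  fixes \<phi> \<psi> :: "real^'n \<Rightarrow> ennreal"
  assumes [measurable]: "\<phi> \<in> borel_measurable borel" "\<psi> \<in> borel_measurable borel"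
  shows "(\<integral>\<^sup>+x. \<psi> x * heat_nn t \<phi> x \<partial>lborel) = (\<integral>\<^sup>+x. heat_nn t \<psi> x * \<phi> x \<partial>lborel)"
proof -
  have "(\<integral>\<^sup>+x. \<psi> x * heat_nn t \<phi> x \<partial>lborel) = (\<integral>\<^sup>+x. \<integral>\<^sup>+y. \<psi> x * (ennreal (heat_kernel t (x - y)) * \<phi> y) \<partial>lborel \<partial>lborel)"
    unfolding heat_nn_def by (simp add: nn_integral_cmult)
  also have "\<dots> = (\<integral>\<^sup>+y. \<integral>\<^sup>+x. \<psi> x * (ennreal (heat_kernel t (x - y)) * \<phi> y) \<partial>lborel \<partial>lborel)"
    by (rule lborel_pair.Fubini') measurable
  also have "\<dots> = (\<integral>\<^sup>+y. \<integral>\<^sup>+x. ennreal (heat_kernel t (y - x)) * \<psi> x * \<phi> y \<partial>lborel \<partial>lborel)"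
    by (simp add: heat_kernel_commute[of t] mult_ac)
  also have "\<dots> = (\<integral>\<^sup>+x. heat_nn t \<psi> x * \<phi> x \<partial>lborel)"
    unfolding heat_nn_def by (simp add: nn_integral_multc)
  finally show ?thesis .
qed

lemma nn_integral_heat_nn:
  fixes \<phi> :: "real^'n \<Rightarrow> ennreal"
  assumes [measurable]: "\<phi> \<in> borel_measurable borel" and t: "0 < t"
  shows "(\<integral>\<^sup>+x. heat_nn t \<phi> x \<partial>lborel) = (\<integral>\<^sup>+x. \<phi> x \<partial>lborel)"
  using nn_integral_mult_heat_nn[of \<phi> "\<lambda>_. 1" t] by (simp add: heat_nn_const[OF t])

lemma nn_integral_heat_kernel_conv:
  fixes x z :: "real^'n"
  assumes "0 < a" "0 < b"
  shows "(\<integral>\<^sup>+y. ennreal (heat_kernel a (x - y)) * ennreal (heat_kernel b (y - z)) \<partial>lborel) = ennreal (heat_kernel (a + b) (x - z))"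
  using heat_kernel_conv(1)[OF assms, of x z]
  by (simp add: has_bochner_integral_iff nn_integral_eq_integral ennreal_mult[symmetric])

lemma heat_nn_heat_nn:
  fixes \<phi> :: "real^'n \<Rightarrow> ennreal"
  assumes [measurable]: "\<phi> \<in> borel_measurable borel" and a: "0 < a" and b: "0 < b"
  shows "heat_nn a (heat_nn b \<phi>) x = heat_nn (a + b) \<phi> x"
proof -
  have "heat_nn a (heat_nn b \<phi>) x =
    (\<integral>\<^sup>+y. \<integral>\<^sup>+z. ennreal (heat_kernel a (x - y)) * (ennreal (heat_kernel b (y - z)) * \<phi> z) \<partial>lborel \<partial>lborel)"
    unfolding heat_nn_def by (simp add: nn_integral_cmult)
  also have "\<dots> = (\<integral>\<^sup>+z. \<integral>\<^sup>+y. ennreal (heat_kernel a (x - y)) * (ennreal (heat_kernel b (y - z)) * \<phi> z) \<partial>lborel \<partial>lborel)"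
    by (rule lborel_pair.Fubini') measurable
  also have "\<dots> = (\<integral>\<^sup>+z. \<integral>\<^sup>+y. ennreal (heat_kernel a (x - y)) * ennreal (heat_kernel b (y - z)) * \<phi> z \<partial>lborel \<partial>lborel)"
    by (simp add: mult.assoc)
  also have "\<dots> = heat_nn (a + b) \<phi> x"
    unfolding heat_nn_def by (simp add: nn_integral_multc nn_integral_heat_kernel_conv[OF a b])
  finally show ?thesis .
qed

lemma heat_nn_le:
  fixes \<phi> :: "real^'n \<Rightarrow> ennreal"
  assumes [measurable]: "\<phi> \<in> borel_measurable borel" and s: "0 < s" "s \<le> t"
  shows "heat_nn s \<phi> x \<le> ennreal ((t / s) powr (real CARD('n) / 2)) * heat_nn t \<phi> x"
proof -
  have "heat_nn s \<phi> x \<le> (\<integral>\<^sup>+y. ennreal ((t / s) powr (real CARD('n) / 2)) * (ennreal (heat_kernel t (x - y)) * \<phi> y) \<partial>lborel)"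
    unfolding heat_nn_def mult.assoc[symmetric]
    using heat_kernel_le[OF s, where 'n='n]
    by (intro nn_integral_mono mult_right_mono) (auto simp: ennreal_mult'[symmetric] intro!: ennreal_leI)
  then show ?thesis unfolding heat_nn_def by (simp add: nn_integral_cmult)
qed

lemma heat_admissible2_imp:
  assumes "heat_admissible2 h" shows "heat_admissible h"
  unfolding heat_admissible_def
proof (intro conjI allI impI)
  show [measurable]: "h \<in> borel_measurable borel" using assms by (rule heat_admissible2D)
  fix t :: real and x assume t: "0 < t"
  have "heat_nn t (\<lambda>y. ennreal (norm (h y))) x \<le> heat_nn t (\<lambda>y. 1 + ennreal ((norm (h y))\<^sup>2)) x"
  proof (rule heat_nn_mono)
    fix y
    have "0 \<le> (norm (h y) - 1/2)\<^sup>2" by simp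
    then have "norm (h y) \<le> 1 + (norm (h y))\<^sup>2" by (simp add: power2_eq_square algebra_simps)
    then show "ennreal (norm (h y)) \<le> 1 + ennreal ((norm (h y))\<^sup>2)"
      by (metis ennreal_1 ennreal_leI ennreal_plus zero_le_one zero_le_power2)
  qed
  also have "\<dots> = 1 + heat_nn t (\<lambda>y. ennreal ((norm (h y))\<^sup>2)) x"
    by (simp add: heat_nn_add heat_nn_const[OF t])
  also have "\<dots> < \<infinity>" using heat_admissible2D(2)[OF assms t, of x] by simp
  finally show "heat_nn t (\<lambda>y. ennreal (norm (h y))) x < \<infinity>" .
qed

lemma integrable_heat:
  assumes h: "heat_admissible h" and t: "0 < t"
  shows "integrable lborel (\<lambda>y. heat_kernel t (x - y) *\<^sub>R h y)"
proof (rule integrableI_bounded)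
  note [measurable] = heat_admissibleD(1)[OF h]
  show "(\<lambda>y. heat_kernel t (x - y) *\<^sub>R h y) \<in> borel_measurable lborel" by measurable
  show "(\<integral>\<^sup>+y. ennreal (norm (heat_kernel t (x - y) *\<^sub>R h y)) \<partial>lborel) < \<infinity>"
    using heat_admissibleD(2)[OF h t, of x] by (simp add: heat_nn_def ennreal_mult)
qed

lemma norm_heat_le:
  assumes h: "heat_admissible h" and t: "0 < t"
  shows "ennreal (norm (heat t h x)) \<le> heat_nn t (\<lambda>y. ennreal (norm (h y))) x"
  using integral_norm_bound_ennreal[OF integrable_heat[OF assms, of x]]
  by (simp add: heat_def heat_nn_def ennreal_mult)

lemma heat_deriv_bound:
  assumes h: "heat_admissible (h :: real^'n \<Rightarrow> 'v::{banach, second_countable_topology})" and t: "0 < t"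
    and C: "0 \<le> C" "\<And>x::real^'n. \<bar>heat_kernel_deriv t i x\<bar> \<le> C * heat_kernel (2 * t) x"
  shows "integrable lborel (\<lambda>y. heat_kernel_deriv t i (x - y) *\<^sub>R h y)"
    and "ennreal (norm (heat_deriv t i h x)) \<le> ennreal C * heat_nn (2 * t) (\<lambda>y. ennreal (norm (h y))) x"
proof -
  note [measurable] = heat_admissibleD(1)[OF h]
  have "(\<integral>\<^sup>+y. ennreal (norm (heat_kernel_deriv t i (x - y) *\<^sub>R h y)) \<partial>lborel) \<le>
     (\<integral>\<^sup>+y. ennreal C * (ennreal (heat_kernel (2 * t) (x - y)) * ennreal (norm (h y))) \<partial>lborel)"
    using C mult_right_mono[OF C(2)]
    by (intro nn_integral_mono) (auto simp: ennreal_mult'[symmetric] mult.assoc[symmetric] intro!: ennreal_leI)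
  also have "\<dots> = ennreal C * heat_nn (2 * t) (\<lambda>y. ennreal (norm (h y))) x"
    by (simp add: heat_nn_def nn_integral_cmult)
  finally have b: "(\<integral>\<^sup>+y. ennreal (norm (heat_kernel_deriv t i (x - y) *\<^sub>R h y)) \<partial>lborel) \<le>
     ennreal C * heat_nn (2 * t) (\<lambda>y. ennreal (norm (h y))) x" .
  show i: "integrable lborel (\<lambda>y. heat_kernel_deriv t i (x - y) *\<^sub>R h y)"
  proof (rule integrableI_bounded)
    have "ennreal C * heat_nn (2 * t) (\<lambda>y. ennreal (norm (h y))) x < \<infinity>"
      using heat_admissibleD(2)[OF h, of "2 * t" x] t by (simp add: ennreal_mult_less_top)
    with b show "(\<integral>\<^sup>+y. ennreal (norm (heat_kernel_deriv t i (x - y) *\<^sub>R h y)) \<partial>lborel) < \<infinity>"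
      by (rule le_less_trans)
  qed measurable
  show "ennreal (norm (heat_deriv t i h x)) \<le> ennreal C * heat_nn (2 * t) (\<lambda>y. ennreal (norm (h y))) x"
    using integral_norm_bound_ennreal[OF i] b unfolding heat_deriv_def by (rule order_trans)
qed

lemma integrable_heat_deriv:
  assumes h: "heat_admissible (h :: real^'n \<Rightarrow> 'v::{banach, second_countable_topology})" and t: "0 < t"
  shows "integrable lborel (\<lambda>y. heat_kernel_deriv t i (x - y) *\<^sub>R h y)"
  by (rule heat_kernel_deriv_bound[OF t, where 'n='n]) (rule heat_deriv_bound(1)[OF h t], auto)

text \<open>One use of Fubini behind all the semigroup laws below, with or without a derivative on
  either factor. The Gaussian majorants at times \<open>a\<close> and \<open>b\<close> give absolute
  integrability, because they convolve to the kernel at time \<open>a + b\<close>.\<close>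

lemma Gaussian_conv_Fubini:
  fixes h :: "real^'n \<Rightarrow> 'v::{banach, second_countable_topology}"
  assumes h: "heat_admissible h" and a: "0 < a" and b: "0 < b" and A: "0 \<le> A" and C: "0 \<le> C"
    and l [measurable]: "l \<in> borel_measurable borel" and lA: "\<And>z::real^'n. \<bar>l z\<bar> \<le> A * heat_kernel a z"
    and k [measurable]: "k \<in> borel_measurable borel" and kC: "\<And>z::real^'n. \<bar>k z\<bar> \<le> C * heat_kernel b z"
    and kk: "\<And>x z. has_bochner_integral lborel (\<lambda>y. l (x - y) * k (y - z)) (k' (x - z))"
  shows "(\<integral>y. l (x - y) *\<^sub>R (\<integral>z. k (y - z) *\<^sub>R h z \<partial>lborel) \<partial>lborel) = (\<integral>z. k' (x - z) *\<^sub>R h z \<partial>lborel)"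
proof -
  note [measurable] = heat_admissibleD(1)[OF h]
  let ?F = "\<lambda>y z. (l (x - y) * k (y - z)) *\<^sub>R h z"
  have int: "integrable (lborel \<Otimes>\<^sub>M lborel) (case_prod ?F)"
  proof (rule integrableI_bounded)
    show "case_prod ?F \<in> borel_measurable (lborel \<Otimes>\<^sub>M lborel)" by measurable
    have "(\<integral>\<^sup>+p. ennreal (norm (case_prod ?F p)) \<partial>(lborel \<Otimes>\<^sub>M lborel)) =
       (\<integral>\<^sup>+y. \<integral>\<^sup>+z. ennreal (norm (?F y z)) \<partial>lborel \<partial>lborel)"
      by (subst lborel.nn_integral_fst[symmetric]) (simp_all add: split_beta')
    also have "\<dots> \<le> (\<integral>\<^sup>+y. \<integral>\<^sup>+z. ennreal (A * C) * (ennreal (heat_kernel a (x - y)) * (ennreal (heat_kernel b (y - z)) * ennreal (norm (h z)))) \<partial>lborel \<partial>lborel)"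
    proof (intro nn_integral_mono)
      fix y z
      have "norm (?F y z) = \<bar>l (x - y)\<bar> * (\<bar>k (y - z)\<bar> * norm (h z))" by (simp add: abs_mult)
      also have "\<dots> \<le> (A * heat_kernel a (x - y)) * ((C * heat_kernel b (y - z)) * norm (h z))"
        using A C by (intro mult_mono lA kC) auto
      finally show "ennreal (norm (?F y z)) \<le> ennreal (A * C) * (ennreal (heat_kernel a (x - y)) * (ennreal (heat_kernel b (y - z)) * ennreal (norm (h z))))"
        using A C by (simp add: ennreal_mult[symmetric] ennreal_leI mult_ac)
    qed
    also have "\<dots> = ennreal (A * C) * heat_nn a (heat_nn b (\<lambda>z. ennreal (norm (h z)))) x"
      unfolding heat_nn_def by (simp add: nn_integral_cmult)
    also have "\<dots> < \<infinity>"
      using heat_admissibleD(2)[OF h, of "a + b" x] a b by (simp add: heat_nn_heat_nn ennreal_mult_less_top)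
    finally show "(\<integral>\<^sup>+p. ennreal (norm (case_prod ?F p)) \<partial>(lborel \<Otimes>\<^sub>M lborel)) < \<infinity>" .
  qed
  have "(\<integral>y. l (x - y) *\<^sub>R (\<integral>z. k (y - z) *\<^sub>R h z \<partial>lborel) \<partial>lborel) = (\<integral>y. (\<integral>z. ?F y z \<partial>lborel) \<partial>lborel)"
    by (simp add: scaleR_scaleR[symmetric] del: scaleR_scaleR)
  also have "\<dots> = (\<integral>z. (\<integral>y. ?F y z \<partial>lborel) \<partial>lborel)"
    using lborel_pair.Fubini_integral[OF int] by simp
  also have "\<dots> = (\<integral>z. k' (x - z) *\<^sub>R h z \<partial>lborel)"
  proof (rule Bochner_Integration.integral_cong[OF refl])
    fix z
    show "(\<integral>y. ?F y z \<partial>lborel) = k' (x - z) *\<^sub>R h z"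
      using has_bochner_integral_scaleR_left[OF kk[of x z], of "h z"] by (simp add: has_bochner_integral_iff)
  qed
  finally show ?thesis .
qed

text \<open>The derivative kernel is odd and the heat kernel even; reflecting both factors exchanges
  their roles in \<open>heat_kernel_conv\<close>.\<close>

lemma heat_kernel_conv_deriv:
  fixes x z :: "real^'n"
  assumes a: "0 < a" and b: "0 < b"
  shows "has_bochner_integral lborel (\<lambda>y. heat_kernel_deriv a i (x - y) * heat_kernel b (y - z)) (heat_kernel_deriv (a + b) i (x - z))"
proof -
  have m: "heat_kernel_deriv c i (u - v) = - heat_kernel_deriv c i (v - u)" for c and u v :: "real^'n"
    by (simp add: heat_kernel_deriv_def heat_kernel_commute[of c u] minus_divide_left[symmetric] diff_divide_distrib left_diff_distrib)
  have "has_bochner_integral lborel (\<lambda>y. heat_kernel b (z - y) * heat_kernel_deriv a i (y - x)) (heat_kernel_deriv (b + a) i (z - x))"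
    by (rule heat_kernel_conv(2)[OF b a])
  from has_bochner_integral_minus[OF this] show ?thesis
    by (subst (1 2) m) (simp add: heat_kernel_commute[of b] add.commute mult.commute)
qed

lemma heat_heat:
  fixes h :: "real^'n \<Rightarrow> 'v::{banach, second_countable_topology}"
  assumes h: "heat_admissible h" and a: "0 < a" and b: "0 < b"
  shows "heat a (heat b h) x = heat (a + b) h x"
  unfolding heat_def
  by (rule Gaussian_conv_Fubini[OF h a b, of 1 1]) (use heat_kernel_conv(1)[OF a b] in auto)

lemma heat_heat_deriv:
  fixes h :: "real^'n \<Rightarrow> 'v::{banach, second_countable_topology}"
  assumes h: "heat_admissible h" and a: "0 < a" and b: "0 < b"
  shows "heat a (heat_deriv b i h) x = heat_deriv (a + b) i h x"
    and "heat_deriv a i (heat b h) x = heat_deriv (a + b) i h x"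
proof -
  obtain C where C: "0 \<le> C" "\<And>x::real^'n. \<bar>heat_kernel_deriv b i x\<bar> \<le> C * heat_kernel (2 * b) x"
    using heat_kernel_deriv_bound[OF b, where 'n='n] by metis
  show "heat a (heat_deriv b i h) x = heat_deriv (a + b) i h x"
    unfolding heat_def heat_deriv_def
    by (rule Gaussian_conv_Fubini[OF h a, of "2 * b" 1 C])
      (use heat_kernel_conv(2)[OF a b] b C in auto)
  obtain A where A: "0 \<le> A" "\<And>x::real^'n. \<bar>heat_kernel_deriv a i x\<bar> \<le> A * heat_kernel (2 * a) x"
    using heat_kernel_deriv_bound[OF a, where 'n='n] by metis
  show "heat_deriv a i (heat b h) x = heat_deriv (a + b) i h x"
    unfolding heat_def heat_deriv_def
    by (rule Gaussian_conv_Fubini[OF h _ b, of "2 * a" A 1])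
      (use heat_kernel_conv_deriv[OF a b] a A in auto)
qed

lemma ennreal_heat:
  fixes \<phi> :: "real^'n \<Rightarrow> real"
  assumes h: "heat_admissible \<phi>" and t: "0 < t" and nn: "\<And>y. 0 \<le> \<phi> y"
  shows "ennreal (heat t \<phi> x) = heat_nn t (\<lambda>y. ennreal (\<phi> y)) x"
  using nn_integral_eq_integral[OF integrable_heat[OF h t, of x]] nn
  by (simp add: heat_def heat_nn_def ennreal_mult)

lemma heat_nonneg: "(\<And>y. 0 \<le> \<phi> y) \<Longrightarrow> 0 \<le> heat t \<phi> x" for \<phi> :: "real^'n \<Rightarrow> real"
  unfolding heat_def by (rule integral_nonneg_AE) simp

lemma heat_admissible_square:
  "heat_admissible2 h \<Longrightarrow> heat_admissible (\<lambda>y. (norm (h y))\<^sup>2)"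
  unfolding heat_admissible_def heat_admissible2_def by (auto intro!: borel_measurable_power)

lemma heat_admissible_heat:
  assumes h: "heat_admissible h" and t: "0 < t"
  shows "heat_admissible (heat t h)"
  unfolding heat_admissible_def
proof (intro conjI allI impI)
  note [measurable] = heat_admissibleD(1)[OF h]
  show [measurable]: "heat t h \<in> borel_measurable borel" by measurable
  fix s :: real and x assume s: "0 < s"
  have "heat_nn s (\<lambda>y. ennreal (norm (heat t h y))) x \<le> heat_nn s (heat_nn t (\<lambda>y. ennreal (norm (h y)))) x"
    by (intro heat_nn_mono norm_heat_le[OF h t])
  also have "\<dots> < \<infinity>" using heat_admissibleD(2)[OF h, of "s + t" x] s t by (simp add: heat_nn_heat_nn)
  finally show "heat_nn s (\<lambda>y. ennreal (norm (heat t h y))) x < \<infinity>" .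
qed

text \<open>Bessel's inequality in \<open>L\<^sub>2\<close> of a Gaussian: constants and coordinates are orthogonal, and testing
  against the coordinates differentiates the heat semigroup.\<close>

lemma heat_grad_sq_Bessel:
  fixes u :: "real^'n \<Rightarrow> 'v::{real_inner, banach, second_countable_topology}"
  assumes u2: "heat_admissible2 u" and t: "0 < t"
  shows "2 * t * heat_grad_sq t u x + (norm (heat t u x))\<^sup>2 \<le> heat t (\<lambda>y. (norm (u y))\<^sup>2) x"
proof -
  have u: "heat_admissible u" by (rule heat_admissible2_imp[OF u2])
  note [measurable] = heat_admissibleD(1)[OF u]
  define m where "m = heat t u x"
  define D where "D i = heat_deriv t i u x" for i
  define G where "G y = heat_kernel t (x - y)" for y :: "real^'n"
  define \<zeta> where "\<zeta> i y = (x - y) $ i" for i y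
  \<comment> \<open>\<open>L\<close> is the orthogonal projection of \<open>u\<close> to the span of
    1 and the coordinates \<open>\<zeta> i\<close> in \<open>L_2\<close> of the measure
    \<open>G\<close>. The coefficient of \<open>\<zeta> i\<close> is \<open>- D i\<close>, since
    \<open>u\<close> has inner product \<open>- 2 * t * D i\<close> with \<open>\<zeta> i\<close>,
    whose squared norm is \<open>2 * t\<close>.\<close>
  define L where "L y = m - (\<Sum>i\<in>UNIV. \<zeta> i y *\<^sub>R D i)" for y
  have hm: "has_bochner_integral lborel (\<lambda>y. G y *\<^sub>R u y) m"
    using integrable_heat[OF u t, of x] by (simp add: m_def heat_def has_bochner_integral_iff G_def)
  have hD: "has_bochner_integral lborel (\<lambda>y. heat_kernel_deriv t i (x - y) *\<^sub>R u y) (D i)" for i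
    using integrable_heat_deriv[OF u t, of i x] by (simp add: D_def heat_deriv_def has_bochner_integral_iff)
  have hD': "has_bochner_integral lborel (\<lambda>y. - (G y * \<zeta> i y * (u y \<bullet> D i))) (2 * t * (D i \<bullet> D i))" for i
  proof -
    have "has_bochner_integral lborel (\<lambda>y. (2 * t) * ((heat_kernel_deriv t i (x - y) *\<^sub>R u y) \<bullet> D i)) (2 * t * (D i \<bullet> D i))"
      by (intro has_bochner_integral_mult_right has_bochner_integral_inner_left hD)
    then show ?thesis using t by (simp add: heat_kernel_deriv_def G_def \<zeta>_def mult_ac del: vector_minus_component)
  qed
  have i0: "has_bochner_integral lborel G 1"
    unfolding G_def by (rule has_bochner_integral_lborel_reflect[OF heat_kernel_integral[OF t]])
  have i1: "has_bochner_integral lborel (\<lambda>y. G y * \<zeta> i y) 0" for i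
    unfolding G_def \<zeta>_def by (rule has_bochner_integral_lborel_reflect[OF heat_kernel_moment1[OF t]])
  have i2: "has_bochner_integral lborel (\<lambda>y. G y * (\<zeta> i y * \<zeta> j y)) (if i = j then 2 * t else 0)" for i j
    unfolding G_def \<zeta>_def by (rule has_bochner_integral_lborel_reflect[OF heat_kernel_moment2[OF t]])
  have uL: "has_bochner_integral lborel (\<lambda>y. G y * (u y \<bullet> L y)) (m \<bullet> m + (\<Sum>i\<in>UNIV. 2 * t * (D i \<bullet> D i)))"
  proof -
    have "has_bochner_integral lborel (\<lambda>y. (G y *\<^sub>R u y) \<bullet> m + (\<Sum>i\<in>UNIV. - (G y * \<zeta> i y * (u y \<bullet> D i))))
       (m \<bullet> m + (\<Sum>i\<in>UNIV. 2 * t * (D i \<bullet> D i)))"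
      by (intro has_bochner_integral_add has_bochner_integral_inner_left hm has_bochner_integral_sum hD')
    then show ?thesis
      by (simp add: L_def inner_diff_right inner_sum_right right_diff_distrib sum_distrib_left sum_negf mult_ac)
  qed
  have LL: "has_bochner_integral lborel (\<lambda>y. G y * (L y \<bullet> L y)) (m \<bullet> m + (\<Sum>i\<in>UNIV. 2 * t * (D i \<bullet> D i)))"
  proof -
    have "has_bochner_integral lborel
       (\<lambda>y. G y * (m \<bullet> m) - (\<Sum>i\<in>UNIV. G y * \<zeta> i y * (2 * (m \<bullet> D i))) + (\<Sum>i\<in>UNIV. \<Sum>j\<in>UNIV. G y * (\<zeta> i y * \<zeta> j y) * (D i \<bullet> D j)))
       (1 * (m \<bullet> m) - (\<Sum>i\<in>UNIV. 0 * (2 * (m \<bullet> D i))) + (\<Sum>i\<in>UNIV. \<Sum>j\<in>UNIV. (if i = j then 2 * t else 0) * (D i \<bullet> D j)))"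
      by (intro has_bochner_integral_add has_bochner_integral_diff has_bochner_integral_sum
          has_bochner_integral_mult_left i0 i1 i2)
    moreover have "(\<Sum>i\<in>UNIV. \<Sum>j\<in>UNIV. (if i = j then 2 * t else 0) * (D i \<bullet> D j)) = (\<Sum>i\<in>UNIV. 2 * t * (D i \<bullet> D i))"
      by (simp add: if_distrib[where f="\<lambda>c. c * _"] cong: if_cong)
    moreover have "G y * (L y \<bullet> L y) = G y * (m \<bullet> m) - (\<Sum>i\<in>UNIV. G y * \<zeta> i y * (2 * (m \<bullet> D i))) + (\<Sum>i\<in>UNIV. \<Sum>j\<in>UNIV. G y * (\<zeta> i y * \<zeta> j y) * (D i \<bullet> D j))" for y
    proof -
      let ?S = "\<Sum>i\<in>UNIV. \<zeta> i y *\<^sub>R D i"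
      have "L y \<bullet> L y = m \<bullet> m - 2 * (m \<bullet> ?S) + ?S \<bullet> ?S"
        by (simp add: L_def inner_diff_left inner_diff_right inner_commute)
      moreover have "G y * (2 * (m \<bullet> ?S)) = (\<Sum>i\<in>UNIV. G y * \<zeta> i y * (2 * (m \<bullet> D i)))"
        by (simp add: inner_sum_right sum_distrib_left mult_ac)
      moreover have "G y * (?S \<bullet> ?S) = (\<Sum>i\<in>UNIV. \<Sum>j\<in>UNIV. G y * (\<zeta> i y * \<zeta> j y) * (D i \<bullet> D j))"
        by (simp add: inner_sum_right inner_sum_left sum_distrib_left mult_ac inner_commute)
      ultimately show ?thesis by (simp only: right_diff_distrib distrib_left)
    qed
    ultimately show ?thesis by simp
  qed
  have uu: "integrable lborel (\<lambda>y. G y * (norm (u y))\<^sup>2)"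
    using integrable_heat[OF heat_admissible_square[OF u2] t, of x] by (simp add: G_def)
  have "m \<bullet> m + (\<Sum>i\<in>UNIV. 2 * t * (D i \<bullet> D i)) = (\<integral>y. 2 * (G y * (u y \<bullet> L y)) - G y * (L y \<bullet> L y) \<partial>lborel)"
    using has_bochner_integral_diff[OF has_bochner_integral_mult_right[OF uL, of 2] LL]
    by (simp add: has_bochner_integral_iff)
  also have "\<dots> \<le> (\<integral>y. G y * (norm (u y))\<^sup>2 \<partial>lborel)"
  proof (rule integral_mono)
    show "integrable lborel (\<lambda>y. 2 * (G y * (u y \<bullet> L y)) - G y * (L y \<bullet> L y))"
      using uL LL by (simp add: has_bochner_integral_iff)
    fix y
    \<comment> \<open>Integrated against \<open>G\<close>, the pointwise inequality
      \<open>2 u.L - L.L \<le> |u|^2\<close> yields Bessel's inequality, because \<open>u.L\<close>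
      and \<open>L.L\<close> have the same integral.\<close>
    have "0 \<le> (u y - L y) \<bullet> (u y - L y)" by simp
    then have "2 * (u y \<bullet> L y) - L y \<bullet> L y \<le> (norm (u y))\<^sup>2"
      by (simp add: power2_norm_eq_inner inner_diff_left inner_diff_right inner_commute)
    from mult_left_mono[OF this, of "G y"]
    show "2 * (G y * (u y \<bullet> L y)) - G y * (L y \<bullet> L y) \<le> G y * (norm (u y))\<^sup>2"
      by (simp add: G_def algebra_simps)
  qed (rule uu)
  finally show ?thesis
    by (simp add: heat_def[of t "\<lambda>y. u y \<bullet> u y"] G_def m_def D_def heat_grad_sq_def sum_distrib_left power2_norm_eq_inner)
qed

lemma heat_grad_sq_nonneg [simp]: "0 \<le> heat_grad_sq t h x"
  by (simp add: heat_grad_sq_def sum_nonneg)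

lemma norm_heat_sq_le:
  fixes u :: "real^'n \<Rightarrow> 'v::{real_inner, banach, second_countable_topology}"
  assumes u: "heat_admissible2 u" and t: "0 < t"
  shows "ennreal ((norm (heat t u x))\<^sup>2) \<le> heat_nn t (\<lambda>y. ennreal ((norm (u y))\<^sup>2)) x"
proof -
  have "0 \<le> 2 * t * heat_grad_sq t u x" using t by simp
  then have "(norm (heat t u x))\<^sup>2 \<le> heat t (\<lambda>y. (norm (u y))\<^sup>2) x"
    using heat_grad_sq_Bessel[OF u t, of x] by linarith
  then show ?thesis
    by (subst ennreal_heat[OF heat_admissible_square[OF u] t, symmetric]) (auto intro: ennreal_leI)
qed

lemma heat_admissible2_heat:
  fixes u :: "real^'n \<Rightarrow> 'v::{real_inner, banach, second_countable_topology}"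
  assumes u: "heat_admissible2 u" and t: "0 < t"
  shows "heat_admissible2 (heat t u)"
  unfolding heat_admissible2_def
proof (intro conjI allI impI)
  note [measurable] = heat_admissible2D(1)[OF u]
  show [measurable]: "heat t u \<in> borel_measurable borel" by measurable
  fix s :: real and x assume s: "0 < s"
  have "heat_nn s (\<lambda>y. ennreal ((norm (heat t u y))\<^sup>2)) x \<le> heat_nn s (heat_nn t (\<lambda>y. ennreal ((norm (u y))\<^sup>2))) x"
    by (intro heat_nn_mono norm_heat_sq_le[OF u t])
  also have "\<dots> < \<infinity>" using heat_admissible2D(2)[OF u, of "s + t" x] s t by (simp add: heat_nn_heat_nn)
  finally show "heat_nn s (\<lambda>y. ennreal ((norm (heat t u y))\<^sup>2)) x < \<infinity>" .
qed

text \<open>The derivative is dominated by the flow of the scalar function \<open>norm u\<close> at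
  time \<open>2 * t\<close>, to which \<open>heat_admissible2_heat\<close> applies.\<close>

lemma heat_admissible2_heat_deriv:
  fixes u :: "real^'n \<Rightarrow> 'v::{real_inner, banach, second_countable_topology}"
  assumes u: "heat_admissible2 u" and t: "0 < t"
  shows "heat_admissible2 (heat_deriv t i u)"
  unfolding heat_admissible2_def
proof (intro conjI allI impI)
  note [measurable] = heat_admissible2D(1)[OF u]
  show [measurable]: "heat_deriv t i u \<in> borel_measurable borel" by measurable
  fix s :: real and x assume s: "0 < s"
  obtain C where C: "0 \<le> C" "\<And>x::real^'n. \<bar>heat_kernel_deriv t i x\<bar> \<le> C * heat_kernel (2 * t) x"
    using heat_kernel_deriv_bound[OF t, where 'n='n] by metis
  have n2: "heat_admissible2 (\<lambda>y. norm (u y))"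
    using u unfolding heat_admissible2_def by auto
  note n = heat_admissible2_imp[OF n2]
  have t2: "0 < 2 * t" using t by simp
  have "norm (heat_deriv t i u y) \<le> C * heat (2 * t) (\<lambda>y. norm (u y)) y" for y
  proof -
    have "ennreal (norm (heat_deriv t i u y)) \<le> ennreal (C * heat (2 * t) (\<lambda>y. norm (u y)) y)"
      using heat_deriv_bound(2)[OF heat_admissible2_imp[OF u] t C, of y] ennreal_heat[OF n t2, of y] C(1)
      by (simp add: ennreal_mult')
    then show ?thesis
      using C(1) by (subst (asm) ennreal_le_iff) (auto intro!: mult_nonneg_nonneg heat_nonneg)
  qed
  then have "ennreal ((norm (heat_deriv t i u y))\<^sup>2) \<le> ennreal (C\<^sup>2) * ennreal ((norm (heat (2 * t) (\<lambda>y. norm (u y)) y))\<^sup>2)" for y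
    using power_mono[of "norm (heat_deriv t i u y)" "C * heat (2 * t) (\<lambda>y. norm (u y)) y" 2]
    by (simp add: ennreal_mult[symmetric] power_mult_distrib ennreal_leI)
  then have "heat_nn s (\<lambda>y. ennreal ((norm (heat_deriv t i u y))\<^sup>2)) x \<le>
      heat_nn s (\<lambda>y. ennreal (C\<^sup>2) * ennreal ((norm (heat (2 * t) (\<lambda>y. norm (u y)) y))\<^sup>2)) x"
    by (rule heat_nn_mono)
  also have "\<dots> = ennreal (C\<^sup>2) * heat_nn s (\<lambda>y. ennreal ((norm (heat (2 * t) (\<lambda>y. norm (u y)) y))\<^sup>2)) x"
    by (subst heat_nn_cmult) auto
  also have "\<dots> < \<infinity>"
    using heat_admissible2D(2)[OF heat_admissible2_heat[OF n2 t2] s, of x] by (simp add: ennreal_mult_less_top)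
  finally show "heat_nn s (\<lambda>y. ennreal ((norm (heat_deriv t i u y))\<^sup>2)) x < \<infinity>" .
qed

text \<open>Differentiation commutes with the flow, and each component satisfies
  \<open>|T v|^2 \<le> T |v|^2\<close>.\<close>

lemma heat_grad_sq_add_le:
  fixes u :: "real^'n \<Rightarrow> 'v::{real_inner, banach, second_countable_topology}"
  assumes u: "heat_admissible2 u" and a: "0 < a" and b: "0 < b"
  shows "ennreal (heat_grad_sq (a + b) u x) \<le> heat_nn a (\<lambda>y. ennreal (heat_grad_sq b u y)) x"
proof -
  note [measurable] = heat_admissible2D(1)[OF u]
  have "ennreal (heat_grad_sq (a + b) u x) = (\<Sum>i\<in>UNIV. ennreal ((norm (heat a (heat_deriv b i u) x))\<^sup>2))"
    by (simp add: heat_grad_sq_def heat_heat_deriv(1)[OF heat_admissible2_imp[OF u] a b] sum_ennreal)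
  also have "\<dots> \<le> (\<Sum>i\<in>UNIV. heat_nn a (\<lambda>y. ennreal ((norm (heat_deriv b i u y))\<^sup>2)) x)"
    by (intro sum_mono norm_heat_sq_le[OF heat_admissible2_heat_deriv[OF u b] a])
  also have "\<dots> = heat_nn a (\<lambda>y. ennreal (heat_grad_sq b u y)) x"
    unfolding heat_grad_sq_def heat_nn_def
    by (subst nn_integral_sum[symmetric]) (auto simp: sum_distrib_left[symmetric] sum_ennreal)
  finally show ?thesis .
qed

subsection \<open>A Bellman function\<close>

text \<open>The convex function \<open>a powr r\<close> lies above its tangent at \<open>c\<close>.
  This is used both for the Bellman function and for Jensen's inequality.\<close>

lemma powr_tangent_le:
  fixes a c r :: real
  assumes r: "1 < r" and a: "0 \<le> a" and c: "0 \<le> c"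
  shows "r * c powr (r - 1) * a \<le> a powr r + (r - 1) * c powr r"
proof (cases "a = 0 \<or> c = 0")
  case True
  then show ?thesis using r by auto
next
  case False
  then have p: "0 < a" "0 < c" using a c by auto
  have "(a powr r) powr (1 / r) * (c powr r) powr (1 - 1 / r) \<le> 1 / r * a powr r + (1 - 1 / r) * c powr r"
    using r p by (intro Youngs_inequality_0) (auto simp: field_simps)
  moreover have "(a powr r) powr (1 / r) = a" using r p by (simp add: powr_powr)
  moreover have "(c powr r) powr (1 - 1 / r) = c powr (r - 1)" using r by (simp add: powr_powr right_diff_distrib)
  ultimately have "a * c powr (r - 1) \<le> 1 / r * a powr r + (1 - 1 / r) * c powr r" by simp
  from mult_left_mono[OF this, of r] have "r * (a * c powr (r - 1)) \<le> r * (1 / r * a powr r + (1 - 1 / r) * c powr r)"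
    using r by simp
  also have "\<dots> = a powr r + (r - 1) * c powr r" using r by (simp add: field_simps)
  finally show ?thesis by (simp add: mult_ac)
qed

text \<open>The function of \<open>a\<close> under the supremum is linear in \<open>(y, z)\<close>; the two powers are such that replacing
  \<open>y\<close> by \<open>y + D\<close> and \<open>a\<close> by \<open>a + D\<close> increases it by at least \<open>z D\<close>. The variable \<open>a\<close> plays the part of the
  square function accumulated along the path of a martingale. Rational \<open>a\<close> make measurability evident.\<close>

definition bell :: "real \<Rightarrow> real \<Rightarrow> real \<Rightarrow> ennreal" where
  "bell r y z = (SUP a\<in>{a\<in>\<rat>. 0 \<le> a}. ennreal (z * a + r * a powr (r - 1) * y - a powr r))"

lemma borel_measurable_bell [measurable (raw)]:
  assumes [measurable]: "f \<in> borel_measurable M" "g \<in> borel_measurable M"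
  shows "(\<lambda>x. bell r (f x) (g x)) \<in> borel_measurable M"
proof -
  have "countable {a\<in>\<rat>. 0 \<le> (a::real)}"
    by (rule countable_subset[OF _ countable_rat]) auto
  then show ?thesis unfolding bell_def by (rule borel_measurable_SUP) measurable
qed

lemma bell_ge:
  assumes r: "1 < r" and a: "0 \<le> a"
  shows "ennreal (z * a + r * a powr (r - 1) * y - a powr r) \<le> bell r y z"
proof (cases "a = 0")
  case True
  then show ?thesis unfolding bell_def by (intro SUP_upper2[of 0]) auto
next
  case False
  then have a: "0 < a" using a by simp
  \<comment> \<open>For \<open>a > 0\<close> the expression is continuous in \<open>a\<close> and
    rationals approach \<open>a\<close> from above; the point 0 is itself a rational
    candidate.\<close>
  have "\<exists>q\<in>\<rat>. a < q \<and> q < a + 1 / real (Suc n)" for n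
    by (intro Rats_dense_in_real) simp
  then obtain q where q: "\<And>n. q n \<in> \<rat>" "\<And>n. a < q n" "\<And>n. q n < a + 1 / real (Suc n)"
    by metis
  have "(\<lambda>n. a + 1 / real (Suc n)) \<longlonglongrightarrow> a + 0"
    by (intro tendsto_add tendsto_const LIMSEQ_Suc[OF lim_1_over_n])
  then have "q \<longlonglongrightarrow> a"
    by (intro tendsto_sandwich[of "\<lambda>_. a" q sequentially "\<lambda>n. a + 1 / real (Suc n)"])
      (auto intro!: always_eventually less_imp_le q simp del: of_nat_Suc)
  then have "(\<lambda>n. ennreal (z * q n + r * q n powr (r - 1) * y - q n powr r)) \<longlonglongrightarrow> ennreal (z * a + r * a powr (r - 1) * y - a powr r)"
    using a by (intro tendsto_intros) auto
  moreover have "ennreal (z * q n + r * q n powr (r - 1) * y - q n powr r) \<le> bell r y z" for n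
    unfolding bell_def using q(1,2)[of n] a by (intro SUP_upper) (auto intro: less_imp_le less_trans)
  ultimately show ?thesis by (intro LIMSEQ_le_const2[where X="\<lambda>n. ennreal (z * q n + r * q n powr (r - 1) * y - q n powr r)"]) auto
qed

text \<open>Half of \<open>a powr r\<close> pays for each of the two positive terms unless
  \<open>a\<close> lies below a threshold, given by \<open>a powr (r - 1) = 2 * z\<close> and by
  \<open>a = 2 * r * y\<close>; below it the term is at most its value there. With
  \<open>y = |u|^2\<close> and \<open>r = p/2\<close> the growth is \<open>|u|^p\<close> plus the
  dual power \<open>p/(p - 2)\<close> of the weight.\<close>

lemma bell_le:
  assumes r: "1 < r" and y: "0 \<le> y" and z: "0 \<le> z"
  shows "bell r y z \<le> ennreal (r * (2 * r) powr (r - 1) * y powr r + 2 powr (1 / (r - 1)) * z powr (r / (r - 1)))"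
  unfolding bell_def
proof (intro SUP_least ennreal_leI)
  fix a :: real assume "a \<in> {a\<in>\<rat>. 0 \<le> a}"
  then have a: "0 \<le> a" by simp
  have "z * a \<le> a powr r / 2 + 2 powr (1 / (r - 1)) * z powr (r / (r - 1))"
  proof (cases "2 * z \<le> a powr (r - 1)")
    case True
    have "2 * z * a \<le> a powr (r - 1) * a" by (rule mult_right_mono[OF True a])
    also have "\<dots> = a powr r" using a powr_add[of a "r - 1" 1] by (cases "a = 0") auto
    finally have "z * a \<le> a powr r / 2" by simp
    moreover have "0 \<le> 2 powr (1 / (r - 1)) * z powr (r / (r - 1))" by simp
    ultimately show ?thesis by linarith
  next
    case False
    have "a = (a powr (r - 1)) powr (1 / (r - 1))" using r a by (cases "a = 0") (auto simp: powr_powr)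
    also have "\<dots> \<le> (2 * z) powr (1 / (r - 1))" using False r by (intro powr_mono2) auto
    finally have "z * a \<le> z * (2 * z) powr (1 / (r - 1))" using z by (rule mult_left_mono)
    also have "\<dots> = 2 powr (1 / (r - 1)) * (z powr 1 * z powr (1 / (r - 1)))" using z by (simp add: powr_mult)
    also have "z powr 1 * z powr (1 / (r - 1)) = z powr (1 + 1 / (r - 1))" by (rule powr_add[symmetric])
    also have "1 + 1 / (r - 1) = r / (r - 1)" using r by (simp add: field_simps)
    finally have "z * a \<le> 2 powr (1 / (r - 1)) * z powr (r / (r - 1))" .
    moreover have "0 \<le> a powr r" by simp
    ultimately show ?thesis by linarith
  qed
  moreover have "r * a powr (r - 1) * y \<le> a powr r / 2 + r * (2 * r) powr (r - 1) * y powr r"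
  proof (cases "2 * r * y \<le> a")
    case True
    have "2 * (r * a powr (r - 1) * y) = a powr (r - 1) * (2 * r * y)" by simp
    also have "\<dots> \<le> a powr (r - 1) * a" by (rule mult_left_mono[OF True]) simp
    also have "\<dots> = a powr r" using a powr_add[of a "r - 1" 1] by (cases "a = 0") auto
    finally have "r * a powr (r - 1) * y \<le> a powr r / 2" by simp
    moreover have "0 \<le> r * (2 * r) powr (r - 1) * y powr r" using r by simp
    ultimately show ?thesis by linarith
  next
    case False
    have "a powr (r - 1) \<le> (2 * r * y) powr (r - 1)" using False a r by (intro powr_mono2) auto
    then have "r * a powr (r - 1) * y \<le> r * (2 * r * y) powr (r - 1) * y"
      using r y by (intro mult_right_mono mult_left_mono) auto
    also have "\<dots> = r * (2 * r) powr (r - 1) * (y powr (r - 1) * y powr 1)" using r y by (simp add: powr_mult)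
    also have "y powr (r - 1) * y powr 1 = y powr r" by (simp only: powr_add[symmetric]) simp
    finally have "r * a powr (r - 1) * y \<le> r * (2 * r) powr (r - 1) * y powr r" .
    moreover have "0 \<le> a powr r" by simp
    ultimately show ?thesis by linarith
  qed
  ultimately show "z * a + r * a powr (r - 1) * y - a powr r \<le>
      r * (2 * r) powr (r - 1) * y powr r + 2 powr (1 / (r - 1)) * z powr (r / (r - 1))"
    by linarith
qed

text \<open>The affine functions under the supremum in \<open>bell\<close> may be negative, and
  \<open>ennreal\<close> replaces them by their positive parts.\<close>

lemma ennreal_integral_le_nn_integral:
  fixes f :: "'a \<Rightarrow> real"
  assumes f: "integrable M f"
  shows "ennreal (integral\<^sup>L M f) \<le> (\<integral>\<^sup>+x. ennreal (f x) \<partial>M)"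
proof -
  have i: "integrable M (\<lambda>x. max 0 (f x))" using f by auto
  have "integral\<^sup>L M f \<le> (\<integral>x. max 0 (f x) \<partial>M)" using f i by (intro integral_mono) auto
  then have "ennreal (integral\<^sup>L M f) \<le> ennreal (\<integral>x. max 0 (f x) \<partial>M)" by (rule ennreal_leI)
  also have "\<dots> = (\<integral>\<^sup>+x. ennreal (max 0 (f x)) \<partial>M)" using i by (intro nn_integral_eq_integral[symmetric]) auto
  also have "\<dots> = (\<integral>\<^sup>+x. ennreal (f x) \<partial>M)" by (simp add: ennreal_max_0)
  finally show ?thesis .
qed

text \<open>Fix \<open>a\<close> and let \<open>D = T |u|^2 - |T u|^2\<close>, which by Bessel's
  inequality is at least \<open>2 * t * heat_grad_sq t u x\<close>. Under the integral use the
  affine function with parameter \<open>a + D\<close>; being affine, it integrates exactly. Compared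
  with parameter \<open>a\<close> after smoothing, the term in \<open>z\<close> gains
  \<open>z * D\<close>, the term in \<open>y\<close> can only increase, and the loss in
  \<open>- a powr r\<close> is covered by the tangent inequality at \<open>a + D\<close>.\<close>

lemma bell_step:
  fixes u :: "real^'n \<Rightarrow> 'v::{real_inner, banach, second_countable_topology}"
  assumes r: "1 < r" and u: "heat_admissible2 u" and Z: "heat_admissible Z" "\<And>y. 0 \<le> Z y" and t: "0 < t"
  shows "bell r ((norm (heat t u x))\<^sup>2) (heat t Z x) + ennreal (heat t Z x * (2 * t * heat_grad_sq t u x))
     \<le> heat_nn t (\<lambda>y. bell r ((norm (u y))\<^sup>2) (Z y)) x" (is "?b + ennreal ?c \<le> ?X")
proof -
  define z where "z = heat t Z x"
  define m where "m = (norm (heat t u x))\<^sup>2"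
  define D where "D = heat t (\<lambda>y. (norm (u y))\<^sup>2) x - m"
  have z0: "0 \<le> z" unfolding z_def by (intro heat_nonneg Z)
  have gD: "2 * t * heat_grad_sq t u x \<le> D"
    using heat_grad_sq_Bessel[OF u t, of x] by (simp add: D_def m_def)
  then have D0: "0 \<le> D" using t by (smt (verit) heat_grad_sq_nonneg mult_nonneg_nonneg)
  have c: "?c \<le> z * D" "0 \<le> ?c" using gD z0 t unfolding z_def[symmetric] by (auto intro!: mult_left_mono)
  have m0: "0 \<le> m" by (simp add: m_def)
  have hZ: "has_bochner_integral lborel (\<lambda>y. heat_kernel t (x - y) * Z y) z"
    using integrable_heat[OF Z(1) t, of x] by (simp add: z_def heat_def has_bochner_integral_iff)
  have hu: "has_bochner_integral lborel (\<lambda>y. heat_kernel t (x - y) * (norm (u y))\<^sup>2) (m + D)"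
    using integrable_heat[OF heat_admissible_square[OF u] t, of x] by (simp add: D_def heat_def has_bochner_integral_iff)
  have h1: "has_bochner_integral lborel (\<lambda>y. heat_kernel t (x - y)) 1"
    by (rule has_bochner_integral_lborel_reflect[OF heat_kernel_integral[OF t]])
  have key: "ennreal (z * a + r * a powr (r - 1) * m - a powr r + ?c) \<le> ?X" if a: "0 \<le> a" for a
  proof -
    let ?a = "a + D"
    let ?\<psi> = "\<lambda>y. Z y * ?a + r * ?a powr (r - 1) * (norm (u y))\<^sup>2 - ?a powr r"
    have a': "0 \<le> ?a" using a D0 by simp
    have "has_bochner_integral lborel (\<lambda>y. heat_kernel t (x - y) * Z y * ?a +
        r * ?a powr (r - 1) * (heat_kernel t (x - y) * (norm (u y))\<^sup>2) - heat_kernel t (x - y) * ?a powr r)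
      (z * ?a + r * ?a powr (r - 1) * (m + D) - 1 * ?a powr r)"
      by (intro has_bochner_integral_add has_bochner_integral_diff has_bochner_integral_mult_left
          has_bochner_integral_mult_right hZ hu h1)
    then have h\<psi>: "has_bochner_integral lborel (\<lambda>y. heat_kernel t (x - y) * ?\<psi> y)
      (z * ?a + r * ?a powr (r - 1) * (m + D) - ?a powr r)"
      by (simp add: algebra_simps)
    have "r * ?a powr (r - 1) * a \<le> a powr r + (r - 1) * ?a powr r"
      by (rule powr_tangent_le[OF r a a'])
    moreover have "?a powr (r - 1) * ?a = ?a powr r"
      using a' powr_add[of ?a "r - 1" 1] by (cases "?a = 0") auto
    ultimately have "- (a powr r) \<le> r * (?a powr (r - 1) * ?a) - r * ?a powr (r - 1) * a - ?a powr r"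
      by (simp add: algebra_simps)
    then have A: "- (a powr r) \<le> r * ?a powr (r - 1) * D - ?a powr r" by (simp add: algebra_simps)
    have B: "r * a powr (r - 1) * m \<le> r * ?a powr (r - 1) * m"
      using r a D0 m0 by (intro mult_right_mono mult_left_mono powr_mono2) auto
    have "z * a + r * a powr (r - 1) * m - a powr r + ?c \<le> z * ?a + r * ?a powr (r - 1) * (m + D) - ?a powr r"
      using A B c(1) by (simp add: algebra_simps)
    then have "ennreal (z * a + r * a powr (r - 1) * m - a powr r + ?c) \<le> ennreal (\<integral>y. heat_kernel t (x - y) * ?\<psi> y \<partial>lborel)"
      using h\<psi> by (simp add: has_bochner_integral_iff ennreal_leI)
    also have "\<dots> \<le> (\<integral>\<^sup>+y. ennreal (heat_kernel t (x - y) * ?\<psi> y) \<partial>lborel)"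
      using h\<psi> by (intro ennreal_integral_le_nn_integral) (simp add: has_bochner_integral_iff)
    also have "\<dots> \<le> ?X"
      unfolding heat_nn_def using bell_ge[OF r a', of "Z _" "(norm (u _))\<^sup>2"]
      by (intro nn_integral_mono) (auto simp: ennreal_mult' intro!: mult_left_mono)
    finally show ?thesis .
  qed
  have "?b + ennreal ?c = (SUP a\<in>{a\<in>\<rat>. 0 \<le> a}. ennreal (z * a + r * a powr (r - 1) * m - a powr r) + ennreal ?c)"
    unfolding bell_def z_def[symmetric] m_def[symmetric] by (intro ennreal_SUP_add_left[symmetric]) (auto intro: exI[of _ 0])
  also have "\<dots> \<le> ?X"
  proof (rule SUP_least)
    fix a :: real assume "a \<in> {a\<in>\<rat>. 0 \<le> a}"
    then have a: "0 \<le> a" by simp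
    show "ennreal (z * a + r * a powr (r - 1) * m - a powr r) + ennreal ?c \<le> ?X"
    proof (cases "0 \<le> z * a + r * a powr (r - 1) * m - a powr r")
      case True
      then show ?thesis using key[OF a] c(2) by (simp add: ennreal_plus)
    next
      \<comment> \<open>Here \<open>ennreal\<close> cuts the candidate off at 0, and the parameter
        \<open>a = 0\<close>, whose candidate has the value 0, already yields
        \<open>ennreal ?c\<close>.\<close>
      case False
      then show ?thesis using key[of 0] by (simp add: ennreal_neg)
    qed
  qed
  finally show ?thesis .
qed

text \<open>The flow preserves integrals, so integrating \<open>bell_step\<close> in
  \<open>x\<close> makes the integral of \<open>bell\<close> drop by at least one summand per step.
  The integral at \<open>s k\<close> stays on the left, which avoids subtracting quantities that may
  be infinite.\<close>

lemma heat_grad_sq_weighted_sum: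
  fixes h :: "real^'n \<Rightarrow> 'v::{real_inner, banach, second_countable_topology}"
  assumes r: "1 < r" and h: "heat_admissible2 h" and Z: "heat_admissible Z" "\<And>y. 0 \<le> Z y"
    and s: "0 < s 0" "\<And>k. s k < s (Suc k)"
  shows "(\<integral>\<^sup>+x. bell r ((norm (heat (s k) h x))\<^sup>2) (heat (s k) Z x) \<partial>lborel) +
     (\<Sum>j<k. \<integral>\<^sup>+x. ennreal (heat (s (Suc j)) Z x * (2 * (s (Suc j) - s j) * heat_grad_sq (s (Suc j)) h x)) \<partial>lborel)
     \<le> (\<integral>\<^sup>+x. bell r ((norm (heat (s 0) h x))\<^sup>2) (heat (s 0) Z x) \<partial>lborel)"
proof (induction k)
  case 0
  then show ?case by simp
next
  case (Suc k)
  note [measurable] = heat_admissible2D(1)[OF h] heat_admissibleD(1)[OF Z(1)]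
  have sk: "0 < s k"
    by (induction k) (use s in \<open>auto intro: less_trans\<close>)
  define t where "t = s (Suc k) - s k"
  have t: "0 < t" using s(2) by (simp add: t_def)
  have st: "t + s k = s (Suc k)" by (simp add: t_def)
  have e1: "heat t (heat (s k) h) x = heat (s (Suc k)) h x" for x
    using heat_heat[OF heat_admissible2_imp[OF h] t sk] by (simp add: st)
  have e2: "heat t (heat (s k) Z) x = heat (s (Suc k)) Z x" for x
    using heat_heat[OF Z(1) t sk] by (simp add: st)
  have e3: "heat_grad_sq t (heat (s k) h) x = heat_grad_sq (s (Suc k)) h x" for x
    using heat_heat_deriv(2)[OF heat_admissible2_imp[OF h] t sk] by (simp add: heat_grad_sq_def st)
  let ?I = "\<lambda>k. \<integral>\<^sup>+x. bell r ((norm (heat (s k) h x))\<^sup>2) (heat (s k) Z x) \<partial>lborel"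
  let ?J = "\<lambda>j. \<integral>\<^sup>+x. ennreal (heat (s (Suc j)) Z x * (2 * (s (Suc j) - s j) * heat_grad_sq (s (Suc j)) h x)) \<partial>lborel"
  have "?I (Suc k) + ?J k = (\<integral>\<^sup>+x. bell r ((norm (heat (s (Suc k)) h x))\<^sup>2) (heat (s (Suc k)) Z x) +
      ennreal (heat (s (Suc k)) Z x * (2 * (s (Suc k) - s k) * heat_grad_sq (s (Suc k)) h x)) \<partial>lborel)"
    by (rule nn_integral_add[symmetric]) measurable
  also have "\<dots> \<le> (\<integral>\<^sup>+x. heat_nn t (\<lambda>y. bell r ((norm (heat (s k) h y))\<^sup>2) (heat (s k) Z y)) x \<partial>lborel)"
    using bell_step[OF r heat_admissible2_heat[OF h sk] heat_admissible_heat[OF Z(1) sk] heat_nonneg[OF Z(2)] t, unfolded e1 e2 e3]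
    by (intro nn_integral_mono) (simp add: t_def)
  also have "\<dots> = ?I k"
    by (rule nn_integral_heat_nn[OF _ t]) measurable
  finally have "?I (Suc k) + ?J k \<le> ?I k" .
  then have "?I (Suc k) + (\<Sum>j<Suc k. ?J j) \<le> ?I k + (\<Sum>j<k. ?J j)"
    by (simp add: add.assoc[symmetric] add_right_mono add.commute[of "sum _ _"])
  then show ?case using Suc.IH by (rule order_trans)
qed

subsection \<open>Powers of extended nonnegative reals\<close>

lemma epowr_ennreal: "0 \<le> x \<Longrightarrow> ennreal x epowr r = ennreal (x powr r)"
  by (simp add: epowr_def)

lemma epowr_top [simp]: "top epowr r = top"
  by (simp add: epowr_def)

lemma epowr_0 [simp]: "0 epowr r = 0"
  by (simp add: epowr_def)

lemma epowr_1 [simp]: "x epowr 1 = x"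
  by (cases x) (simp_all add: epowr_ennreal)

lemma one_epowr [simp]: "1 epowr r = 1"
  using epowr_ennreal[of 1 r] by simp

lemma epowr_eq_top_iff [simp]: "x epowr r = top \<longleftrightarrow> x = top"
  by (cases x) (simp_all add: epowr_ennreal)

lemma epowr_eq_0_iff [simp]: "x epowr r = 0 \<longleftrightarrow> x = 0"
  by (cases x) (auto simp: epowr_ennreal)

lemma epowr_epowr: "(x epowr r) epowr s = x epowr (r * s)"
  by (cases x) (simp_all add: epowr_ennreal powr_powr)

lemma epowr_mono: "0 \<le> r \<Longrightarrow> x \<le> y \<Longrightarrow> x epowr r \<le> y epowr r"
  by (cases x; cases y) (auto simp: epowr_ennreal powr_mono2 top_unique)

lemma epowr_mult: "(x * y) epowr r = x epowr r * y epowr r"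
proof (cases "x = top \<or> y = top")
  case True
  then show ?thesis by (auto simp: ennreal_top_mult ennreal_mult_top)
next
  case False
  then show ?thesis
    by (cases x; cases y) (auto simp: epowr_ennreal powr_mult ennreal_mult[symmetric])
qed

lemma epowr_add: "x epowr (r + s) = x epowr r * x epowr s"
  by (cases x) (auto simp: epowr_ennreal powr_add ennreal_mult)

lemma borel_measurable_epowr [measurable (raw)]:
  assumes [measurable]: "f \<in> borel_measurable M"
  shows "(\<lambda>x. f x epowr r) \<in> borel_measurable M"
  unfolding epowr_def by measurable

lemma epowr_inverse:
  assumes "0 < r" shows "(x epowr (1 / r)) epowr r = x" "(x epowr r) epowr (1 / r) = x"
  using assms by (simp_all add: epowr_epowr)

text \<open>For \<open>r > 0\<close> the power is an order isomorphism with inverse the power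
  \<open>1 / r\<close>.\<close>

lemma SUP_epowr:
  fixes f :: "'i \<Rightarrow> ennreal"
  assumes r: "0 < r"
  shows "(SUP i\<in>I. f i) epowr r = (SUP i\<in>I. f i epowr r)"
proof (rule antisym)
  have "f i \<le> (SUP i\<in>I. f i epowr r) epowr (1 / r)" if "i \<in> I" for i
    using epowr_mono[OF _ SUP_upper[OF that, of "\<lambda>i. f i epowr r"], of "1 / r"] r by (simp add: epowr_inverse)
  then have "(SUP i\<in>I. f i) \<le> (SUP i\<in>I. f i epowr r) epowr (1 / r)" by (rule SUP_least)
  from epowr_mono[OF _ this, of r] show "(SUP i\<in>I. f i) epowr r \<le> (SUP i\<in>I. f i epowr r)"
    using r by (simp add: epowr_inverse)
  show "(SUP i\<in>I. f i epowr r) \<le> (SUP i\<in>I. f i) epowr r"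
    using r by (intro SUP_least epowr_mono SUP_upper) auto
qed

text \<open>Integrate the tangent inequality at the mean \<open>c\<close> against the probability
  density \<open>k\<close>.\<close>

lemma epowr_Jensen:
  fixes \<phi> k :: "'a \<Rightarrow> ennreal"
  assumes q: "1 \<le> q" and [measurable]: "k \<in> borel_measurable M" "\<phi> \<in> borel_measurable M"
    and k: "(\<integral>\<^sup>+x. k x \<partial>M) = 1"
  shows "(\<integral>\<^sup>+x. k x * \<phi> x \<partial>M) epowr q \<le> (\<integral>\<^sup>+x. k x * \<phi> x epowr q \<partial>M)"
proof (cases "q = 1")
  case True
  then show ?thesis by simp
next
  case False
  then have q: "1 < q" using q by simp
  define c where "c = (\<integral>\<^sup>+x. k x * \<phi> x \<partial>M)"
  let ?J = "\<integral>\<^sup>+x. k x * \<phi> x epowr q \<partial>M"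
  \<comment> \<open>An infinite mean has no tangent; this bound shows that the right-hand side is
    infinite as well.\<close>
  have ge: "y \<le> 1 + y epowr q" for y :: ennreal
  proof (cases "y \<le> 1")
    case False
    have "1 \<le> y epowr (q - 1)" using epowr_mono[of "q - 1" 1 y] False q by simp
    then have "y * 1 \<le> y epowr 1 * y epowr (q - 1)" unfolding epowr_1 by (intro mult_left_mono) auto
    also have "\<dots> = y epowr q" by (simp only: epowr_add[symmetric]) simp
    finally show ?thesis by (simp add: add_increasing)
  qed (simp add: add_increasing2)
  have "c \<le> (\<integral>\<^sup>+x. k x + k x * \<phi> x epowr q \<partial>M)"
    unfolding c_def using mult_left_mono[OF ge] by (intro nn_integral_mono) (auto simp: distrib_left)
  also have "\<dots> = 1 + ?J" by (simp add: nn_integral_add k)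
  finally have top: "?J = top" if "c = top" using that by (auto simp: top_unique)
  show ?thesis
  proof (cases c)
    case top
    then show ?thesis using \<open>c = top \<Longrightarrow> ?J = top\<close> by (simp add: c_def)
  next
    case (real d)
    have tan: "ennreal (q * d powr (q - 1)) * y \<le> y epowr q + ennreal ((q - 1) * d powr q)" for y :: ennreal
    proof (cases y)
      case (real e)
      then show ?thesis
        using powr_tangent_le[OF q, of e d] \<open>0 \<le> d\<close> q
        by (simp add: epowr_ennreal ennreal_mult[symmetric] ennreal_plus[symmetric] ennreal_leI del: ennreal_plus)
    qed simp
    have "ennreal (q * d powr (q - 1)) * c = (\<integral>\<^sup>+x. k x * (ennreal (q * d powr (q - 1)) * \<phi> x) \<partial>M)"
      by (simp add: c_def nn_integral_cmult mult.left_commute[of "k _"])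
    also have "\<dots> \<le> (\<integral>\<^sup>+x. k x * \<phi> x epowr q + k x * ennreal ((q - 1) * d powr q) \<partial>M)"
      using mult_left_mono[OF tan] by (intro nn_integral_mono) (auto simp: distrib_left)
    also have "\<dots> = ?J + ennreal ((q - 1) * d powr q)"
      by (simp add: nn_integral_add nn_integral_multc k)
    finally have "ennreal (q * d powr (q - 1)) * c \<le> ?J + ennreal ((q - 1) * d powr q)" .
    moreover have "ennreal (q * d powr (q - 1)) * c = ennreal (d powr q) + ennreal ((q - 1) * d powr q)"
    proof -
      have "d powr (q - 1) * d = d powr q" using powr_add[of d "q - 1" 1] \<open>0 \<le> d\<close> by (cases "d = 0") auto
      then have "q * d powr (q - 1) * d = d powr q + (q - 1) * d powr q" by (simp add: algebra_simps)
      then show ?thesis using q real by (simp add: ennreal_mult[symmetric] ennreal_plus[symmetric] del: ennreal_plus)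
    qed
    ultimately have "ennreal (d powr q) + ennreal ((q - 1) * d powr q) \<le> ?J + ennreal ((q - 1) * d powr q)" by simp
    then have "ennreal (d powr q) \<le> ?J"
      by (subst (asm) (1 2) add.commute) (simp add: ennreal_add_left_cancel_le)
    then show ?thesis using real by (simp add: c_def[symmetric] epowr_ennreal)
  qed
qed

subsection \<open>A one-sided maximal inequality on the line\<close>

text \<open>Translation by \<delta> plays the part of the measure preserving map in the ergodic
  theorem. Discrete averages suffice because the weight is first averaged over intervals of length
  \<delta>.\<close>

definition shift_avg :: "real \<Rightarrow> (real \<Rightarrow> real) \<Rightarrow> nat \<Rightarrow> real \<Rightarrow> real" where
  "shift_avg \<delta> g n s = (\<Sum>i<n. g (s + real i * \<delta>)) / real n"

text \<open>The range up to \<open>Suc N\<close> is never empty, as \<open>Max\<close>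
  requires.\<close>

definition shift_max :: "real \<Rightarrow> (real \<Rightarrow> real) \<Rightarrow> nat \<Rightarrow> real \<Rightarrow> real" where
  "shift_max \<delta> g N s = Max ((\<lambda>n. shift_avg \<delta> g n s) ` {1..Suc N})"

text \<open>Largest excess of the first \<open>n\<close> terms over \<open>\<kappa>\<close>, as in Garsia's proof of the maximal ergodic theorem.\<close>

primrec excess :: "real \<Rightarrow> (real \<Rightarrow> real) \<Rightarrow> real \<Rightarrow> nat \<Rightarrow> real \<Rightarrow> real" where
  "excess \<delta> g \<kappa> 0 s = 0"
| "excess \<delta> g \<kappa> (Suc n) s = max 0 (g s - \<kappa> + excess \<delta> g \<kappa> n (s + \<delta>))"

lemma borel_measurable_excess [measurable]:
  assumes [measurable]: "g \<in> borel_measurable borel"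
  shows "excess \<delta> g \<kappa> n \<in> borel_measurable borel"
proof (induction n)
  case 0
  then show ?case by (simp cong: measurable_cong)
next
  case (Suc n)
  note [measurable] = Suc
  have "(\<lambda>s. max 0 (g s - \<kappa> + excess \<delta> g \<kappa> n (s + \<delta>))) \<in> borel_measurable borel" by measurable
  then show ?case by simp
qed

lemma excess_nonneg: "0 \<le> excess \<delta> g \<kappa> n s"
  by (cases n) auto

lemma excess_mono: "excess \<delta> g \<kappa> n s \<le> excess \<delta> g \<kappa> (Suc n) s"
proof (induction n arbitrary: s)
  case (Suc n)
  show ?case using Suc[of "s + \<delta>"] by (auto simp del: excess.simps(2) simp: excess.simps(2)[of _ _ _ n] excess.simps(2)[of _ _ _ "Suc n"])
qed simp

text \<open>The recursion computes the maximum over \<open>n \<le> N\<close> of the sum of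
  \<open>n\<close> terms minus \<open>n * \<kappa>\<close>: here the value is attained, and in
  \<open>excess_ge\<close> it is an upper bound.\<close>

lemma excess_eq: "\<exists>n\<le>N. excess \<delta> g \<kappa> N s = (\<Sum>i<n. g (s + real i * \<delta>)) - real n * \<kappa>"
proof (induction N arbitrary: s)
  case (Suc N)
  obtain n where n: "n \<le> N" "excess \<delta> g \<kappa> N (s + \<delta>) = (\<Sum>i<n. g (s + \<delta> + real i * \<delta>)) - real n * \<kappa>"
    using Suc by blast
  have "(\<Sum>i<Suc n. g (s + real i * \<delta>)) = g s + (\<Sum>i<n. g (s + \<delta> + real i * \<delta>))"
    by (subst sum.lessThan_Suc_shift) (simp add: algebra_simps)
  then have "g s - \<kappa> + excess \<delta> g \<kappa> N (s + \<delta>) = (\<Sum>i<Suc n. g (s + real i * \<delta>)) - real (Suc n) * \<kappa>"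
    using n(2) by (simp add: algebra_simps)
  then show ?case using n(1)
    by (cases "0 \<le> g s - \<kappa> + excess \<delta> g \<kappa> N (s + \<delta>)") (force intro: exI[of _ "Suc n"] exI[of _ 0])+
qed simp

lemma excess_ge: "n \<le> N \<Longrightarrow> (\<Sum>i<n. g (s + real i * \<delta>)) - real n * \<kappa> \<le> excess \<delta> g \<kappa> N s"
proof (induction N arbitrary: s n)
  case (Suc N)
  show ?case
  proof (cases n)
    case 0
    then show ?thesis by simp
  next
    case (Suc k)
    have "(\<Sum>i<n. g (s + real i * \<delta>)) = g s + (\<Sum>i<k. g (s + \<delta> + real i * \<delta>))"
      unfolding Suc by (subst sum.lessThan_Suc_shift) (simp add: algebra_simps)
    moreover have "(\<Sum>i<k. g (s + \<delta> + real i * \<delta>)) - real k * \<kappa> \<le> excess \<delta> g \<kappa> N (s + \<delta>)"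
      using Suc.IH Suc.prems Suc by simp
    ultimately show ?thesis unfolding Suc by (simp add: algebra_simps le_max_iff_disj)
  qed
qed simp

lemma excess_pos_iff:
  assumes "0 < \<kappa>"
  shows "0 < excess \<delta> g \<kappa> (Suc N) s \<longleftrightarrow> \<kappa> < shift_max \<delta> g N s"
proof
  assume "0 < excess \<delta> g \<kappa> (Suc N) s"
  then obtain n where n: "n \<le> Suc N" "0 < (\<Sum>i<n. g (s + real i * \<delta>)) - real n * \<kappa>"
    using excess_eq[of "Suc N" \<delta> g \<kappa> s] by (metis (no_types, lifting))
  then have "n \<noteq> 0" by (intro notI) simp
  then have "\<kappa> < shift_avg \<delta> g n s" using n by (simp add: shift_avg_def field_simps)
  then show "\<kappa> < shift_max \<delta> g N s"
    unfolding shift_max_def using n(1) \<open>n \<noteq> 0\<close> by (subst Max_gr_iff) (auto intro!: bexI[of _ n])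
next
  assume "\<kappa> < shift_max \<delta> g N s"
  then obtain n where n: "1 \<le> n" "n \<le> Suc N" "\<kappa> < shift_avg \<delta> g n s"
    unfolding shift_max_def by (subst (asm) Max_gr_iff) auto
  then have "0 < (\<Sum>i<n. g (s + real i * \<delta>)) - real n * \<kappa>" by (simp add: shift_avg_def field_simps)
  then show "0 < excess \<delta> g \<kappa> (Suc N) s" using excess_ge[OF n(2), of g s \<delta> \<kappa>] by linarith
qed

lemma nn_integral_shift:
  fixes f :: "real \<Rightarrow> ennreal"
  assumes [measurable]: "f \<in> borel_measurable borel"
  shows "(\<integral>\<^sup>+s. f (s + c) \<partial>lborel) = (\<integral>\<^sup>+s. f s \<partial>lborel)"
  using nn_integral_real_affine[of f 1 c] by (simp add: add.commute)

lemma nn_integral_excess_finite: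
  assumes [measurable]: "g \<in> borel_measurable borel" and g: "\<And>s. 0 \<le> g s" "(\<integral>\<^sup>+s. ennreal (g s) \<partial>lborel) < \<infinity>" and \<kappa>: "0 \<le> \<kappa>"
  shows "(\<integral>\<^sup>+s. ennreal (excess \<delta> g \<kappa> n s) \<partial>lborel) < \<infinity>"
proof (induction n)
  case (Suc n)
  have "(\<integral>\<^sup>+s. ennreal (excess \<delta> g \<kappa> (Suc n) s) \<partial>lborel) \<le> (\<integral>\<^sup>+s. ennreal (g s) + ennreal (excess \<delta> g \<kappa> n (s + \<delta>)) \<partial>lborel)"
    using g(1) \<kappa> excess_nonneg[of \<delta> g \<kappa> n]
    by (intro nn_integral_mono) (auto simp: ennreal_plus[symmetric] simp del: ennreal_plus intro!: ennreal_leI)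
  also have "\<dots> = (\<integral>\<^sup>+s. ennreal (g s) \<partial>lborel) + (\<integral>\<^sup>+s. ennreal (excess \<delta> g \<kappa> n s) \<partial>lborel)"
    using nn_integral_shift[of "\<lambda>s. ennreal (excess \<delta> g \<kappa> n s)" \<delta>] by (simp add: nn_integral_add)
  finally show ?case using g(2) Suc by (simp add: less_top[symmetric] top_unique) (metis ennreal_add_eq_top top_unique)
qed simp

text \<open>Garsia's argument. Where \<open>?e (Suc N)\<close> is positive, adding \<kappa> gives
  \<open>g s + ?e N (s + \<delta>)\<close>; elsewhere it is 0. After integration, translation
  invariance and monotonicity in \<open>N\<close> leave the integral of \<open>?e (Suc N)\<close> on
  both sides, and being finite it cancels.\<close>

lemma shift_max_weak_type:
  assumes [measurable]: "g \<in> borel_measurable borel" and g: "\<And>s. 0 \<le> g s" "(\<integral>\<^sup>+s. ennreal (g s) \<partial>lborel) < \<infinity>" and \<kappa>: "0 < \<kappa>"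
  shows "ennreal \<kappa> * (\<integral>\<^sup>+s. indicator {s. \<kappa> < shift_max \<delta> g N s} s \<partial>lborel)
    \<le> (\<integral>\<^sup>+s. ennreal (g s) * indicator {s. \<kappa> < shift_max \<delta> g N s} s \<partial>lborel)"
proof -
  let ?e = "excess \<delta> g \<kappa>"
  let ?P = "{s. 0 < ?e (Suc N) s}"
  have P: "{s. \<kappa> < shift_max \<delta> g N s} = ?P" by (simp only: excess_pos_iff[OF \<kappa>])
  let ?I = "\<lambda>n. \<integral>\<^sup>+s. ennreal (?e n s) \<partial>lborel"
  have "?I (Suc N) + ennreal \<kappa> * (\<integral>\<^sup>+s. indicator ?P s \<partial>lborel) =
     (\<integral>\<^sup>+s. ennreal (?e (Suc N) s) + ennreal \<kappa> * indicator ?P s \<partial>lborel)"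
    by (simp add: nn_integral_add nn_integral_cmult del: excess.simps nn_integral_indicator)
  also have "\<dots> \<le> (\<integral>\<^sup>+s. ennreal (g s) * indicator ?P s + ennreal (?e N (s + \<delta>)) \<partial>lborel)"
    using g(1) \<kappa> excess_nonneg[of \<delta> g \<kappa> N]
    by (intro nn_integral_mono)
      (auto simp: ennreal_plus[symmetric] indicator_def max_def simp del: ennreal_plus intro!: ennreal_leI split: if_splits)
  also have "\<dots> = (\<integral>\<^sup>+s. ennreal (g s) * indicator ?P s \<partial>lborel) + ?I N"
    using nn_integral_shift[of "\<lambda>s. ennreal (?e N s)" \<delta>] by (simp add: nn_integral_add del: excess.simps)
  also have "\<dots> \<le> (\<integral>\<^sup>+s. ennreal (g s) * indicator ?P s \<partial>lborel) + ?I (Suc N)"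
    by (intro add_left_mono nn_integral_mono ennreal_leI excess_mono)
  finally have "?I (Suc N) + ennreal \<kappa> * (\<integral>\<^sup>+s. indicator ?P s \<partial>lborel) \<le> ?I (Suc N) + (\<integral>\<^sup>+s. ennreal (g s) * indicator ?P s \<partial>lborel)"
    by (simp add: add.commute)
  moreover have "?I (Suc N) \<noteq> top"
    using nn_integral_excess_finite[OF assms(1) g, of \<kappa> \<delta> "Suc N"] \<kappa> by (simp add: less_top[symmetric] del: excess.simps)
  ultimately show ?thesis unfolding P
    by (simp add: ennreal_add_left_cancel_le del: excess.simps nn_integral_indicator)
qed

lemma nn_integral_powr:
  assumes a: "-1 < a" and m: "0 \<le> m"
  shows "(\<integral>\<^sup>+l. ennreal (l powr a) * indicator {l. 0 < l \<and> l < m} l \<partial>lborel) = ennreal (m powr (a + 1) / (a + 1))"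
proof -
  have "(\<integral>\<^sup>+l. ennreal (l powr a) * indicator {l. 0 < l \<and> l < m} l \<partial>lborel) = (\<integral>\<^sup>+l. ennreal (if l \<in> {0..m} then l powr a else 0) \<partial>lborel)"
  proof (rule nn_integral_cong_AE)
    show "AE l in lborel. ennreal (l powr a) * indicator {l. 0 < l \<and> l < m} l = ennreal (if l \<in> {0..m} then l powr a else 0)"
      using AE_lborel_singleton[of 0] AE_lborel_singleton[of m] by eventually_elim (auto simp: indicator_def)
  qed
  also have "\<dots> = ennreal (m powr (a + 1) / (a + 1))"
    by (rule nn_integral_has_integral_lborel[OF _ _ has_integral_restrict_UNIV[THEN iffD2, OF has_integral_powr_from_0[OF a m]]]) auto
  finally show ?thesis .
qed

lemma borel_measurable_shift_max [measurable]:
  assumes [measurable]: "g \<in> borel_measurable borel"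
  shows "shift_max \<delta> g N \<in> borel_measurable borel"
  unfolding shift_max_def shift_avg_def by measurable

lemma shift_max_nonneg:
  assumes "\<And>s. 0 \<le> g s" shows "0 \<le> shift_max \<delta> g N s"
proof -
  have "0 \<le> shift_avg \<delta> g 1 s" using assms by (simp add: shift_avg_def)
  also have "\<dots> \<le> shift_max \<delta> g N s" unfolding shift_max_def by (intro Max_ge) auto
  finally show ?thesis .
qed

text \<open>Layer-cake integration of the weak type bound, as in Doob's inequality. Because that
  bound keeps \<open>g\<close> restricted to the level set, the integral over the level returns the
  power \<open>q - 1\<close> of the maximal function.\<close>

lemma nn_integral_shift_max_powr_le:
  assumes [measurable]: "g \<in> borel_measurable borel" and g: "\<And>s. 0 \<le> g s" "(\<integral>\<^sup>+s. ennreal (g s) \<partial>lborel) < \<infinity>" and q: "1 < q"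
  shows "(\<integral>\<^sup>+s. ennreal (shift_max \<delta> g N s powr q) \<partial>lborel) \<le>
    ennreal (q / (q - 1)) * (\<integral>\<^sup>+s. ennreal (g s * shift_max \<delta> g N s powr (q - 1)) \<partial>lborel)"
proof -
  let ?m = "shift_max \<delta> g N"
  let ?P = "\<lambda>l s. indicator {s. l < ?m s} s :: ennreal"
  have m0: "0 \<le> ?m s" for s by (intro shift_max_nonneg g)
  have cake: "ennreal (?m s powr (a + 1) / (a + 1)) = (\<integral>\<^sup>+l. ennreal (l powr a) * (indicator {0<..} l * ?P l s) \<partial>lborel)" if "-1 < a" for a s
    unfolding nn_integral_powr[OF that m0, symmetric]
    by (intro nn_integral_cong) (auto simp: indicator_def)
  have "(\<integral>\<^sup>+s. ennreal (?m s powr q / q) \<partial>lborel) = (\<integral>\<^sup>+s. \<integral>\<^sup>+l. ennreal (l powr (q - 1)) * (indicator {0<..} l * ?P l s) \<partial>lborel \<partial>lborel)"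
    using cake[of "q - 1"] q by simp
  also have "\<dots> = (\<integral>\<^sup>+l. \<integral>\<^sup>+s. ennreal (l powr (q - 1)) * (indicator {0<..} l * ?P l s) \<partial>lborel \<partial>lborel)"
    unfolding indicator_def by (rule lborel_pair.Fubini') measurable
  also have "\<dots> = (\<integral>\<^sup>+l. ennreal (l powr (q - 1)) * (indicator {0<..} l * (\<integral>\<^sup>+s. ?P l s \<partial>lborel)) \<partial>lborel)"
    by (simp add: nn_integral_cmult del: nn_integral_indicator)
  also have "\<dots> \<le> (\<integral>\<^sup>+l. ennreal (l powr (q - 2)) * (indicator {0<..} l * (\<integral>\<^sup>+s. ennreal (g s) * ?P l s \<partial>lborel)) \<partial>lborel)"
  proof (rule nn_integral_mono)
    fix l :: real
    show "ennreal (l powr (q - 1)) * (indicator {0<..} l * (\<integral>\<^sup>+s. ?P l s \<partial>lborel)) \<le>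
      ennreal (l powr (q - 2)) * (indicator {0<..} l * (\<integral>\<^sup>+s. ennreal (g s) * ?P l s \<partial>lborel))"
    proof (cases "0 < l")
      case True
      have "l powr (q - 1) = l powr (q - 2) * l powr 1" by (simp only: powr_add[symmetric]) simp
      then have "ennreal (l powr (q - 1)) = ennreal (l powr (q - 2)) * ennreal l" using True by (simp add: ennreal_mult)
      then show ?thesis using True mult_left_mono[OF shift_max_weak_type[OF assms(1) g True, of \<delta> N], of "ennreal (l powr (q - 2))"]
        by (simp add: mult.assoc del: nn_integral_indicator)
    qed simp
  qed
  also have "\<dots> = (\<integral>\<^sup>+l. \<integral>\<^sup>+s. ennreal (g s) * (ennreal (l powr (q - 2)) * (indicator {0<..} l * ?P l s)) \<partial>lborel \<partial>lborel)"
    by (simp add: nn_integral_cmult[symmetric] mult_ac)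
  also have "\<dots> = (\<integral>\<^sup>+s. \<integral>\<^sup>+l. ennreal (g s) * (ennreal (l powr (q - 2)) * (indicator {0<..} l * ?P l s)) \<partial>lborel \<partial>lborel)"
    unfolding indicator_def by (rule lborel_pair.Fubini') measurable
  also have "\<dots> = (\<integral>\<^sup>+s. ennreal (g s) * (\<integral>\<^sup>+l. ennreal (l powr (q - 2)) * (indicator {0<..} l * ?P l s) \<partial>lborel) \<partial>lborel)"
    unfolding indicator_def by (intro nn_integral_cong nn_integral_cmult) measurable
  also have "\<dots> = (\<integral>\<^sup>+s. ennreal (g s * (?m s powr (q - 1) / (q - 1))) \<partial>lborel)"
    using cake[of "q - 2", symmetric] q g(1) by (intro nn_integral_cong) (simp add: ennreal_mult[symmetric])
  finally have main: "(\<integral>\<^sup>+s. ennreal (?m s powr q / q) \<partial>lborel) \<le> (\<integral>\<^sup>+s. ennreal (g s * (?m s powr (q - 1) / (q - 1))) \<partial>lborel)" .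
  have "(\<integral>\<^sup>+s. ennreal (?m s powr q) \<partial>lborel) = (\<integral>\<^sup>+s. ennreal q * ennreal (?m s powr q / q) \<partial>lborel)"
    using q by (intro nn_integral_cong) (simp add: ennreal_mult[symmetric])
  also have "\<dots> = ennreal q * (\<integral>\<^sup>+s. ennreal (?m s powr q / q) \<partial>lborel)" by (simp add: nn_integral_cmult)
  also have "\<dots> \<le> ennreal q * (\<integral>\<^sup>+s. ennreal (g s * (?m s powr (q - 1) / (q - 1))) \<partial>lborel)"
    by (intro mult_left_mono main) auto
  also have "\<dots> = (\<integral>\<^sup>+s. ennreal q * ennreal (g s * (?m s powr (q - 1) / (q - 1))) \<partial>lborel)"
    by (rule nn_integral_cmult[symmetric]) measurable
  also have "\<dots> = (\<integral>\<^sup>+s. ennreal (q / (q - 1)) * ennreal (g s * ?m s powr (q - 1)) \<partial>lborel)"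
    using q g(1) by (intro nn_integral_cong) (simp add: ennreal_mult[symmetric] mult_ac)
  also have "\<dots> = ennreal (q / (q - 1)) * (\<integral>\<^sup>+s. ennreal (g s * ?m s powr (q - 1)) \<partial>lborel)"
    by (rule nn_integral_cmult) measurable
  finally show ?thesis .
qed

text \<open>Young's inequality splits \<open>g * M powr (q - 1)\<close> into half of
  \<open>M powr q\<close>, which is absorbed on the left, and a multiple of \<open>g powr q\<close>.
  The bounds on \<open>g\<close> only make the absorbed integral finite and leave no trace in the
  constant.\<close>

lemma shift_max_strong_type:
  assumes [measurable]: "g \<in> borel_measurable borel" and g: "\<And>s. 0 \<le> g s" "\<And>s. g s \<le> B" "(\<integral>\<^sup>+s. ennreal (g s) \<partial>lborel) < \<infinity>" and q: "1 < q"
  shows "(\<integral>\<^sup>+s. ennreal (shift_max \<delta> g N s powr q) \<partial>lborel) \<le>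
    ennreal (2 * (2 * q / (q - 1)) powr q) * (\<integral>\<^sup>+s. ennreal (g s powr q) \<partial>lborel)"
proof -
  let ?m = "shift_max \<delta> g N"
  let ?I = "\<integral>\<^sup>+s. ennreal (?m s powr q) \<partial>lborel"
  define c where "c = q / (q - 1)"
  have c: "0 < c" using q by (simp add: c_def)
  have m0: "0 \<le> ?m s" for s by (intro shift_max_nonneg g)
  have m_le: "?m s \<le> K" if "\<And>n. 1 \<le> n \<Longrightarrow> n \<le> Suc N \<Longrightarrow> shift_avg \<delta> g n s \<le> K" for s K
    unfolding shift_max_def using that by (subst Max_le_iff) auto
  have mB: "?m s \<le> B" for s
  proof (rule m_le)
    fix n :: nat assume n: "1 \<le> n"
    have "(\<Sum>i<n. g (s + real i * \<delta>)) \<le> (\<Sum>i<n. B)" by (intro sum_mono g)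
    then show "shift_avg \<delta> g n s \<le> B" using n by (simp add: shift_avg_def field_simps)
  qed
  have B0: "0 \<le> B" using g(1,2)[of 0] by linarith
  have mS: "?m s \<le> (\<Sum>i<Suc N. g (s + real i * \<delta>))" for s
  proof (rule m_le)
    fix n :: nat assume n: "1 \<le> n" "n \<le> Suc N"
    have "shift_avg \<delta> g n s \<le> (\<Sum>i<n. g (s + real i * \<delta>))"
      using n sum_nonneg[of "{..<n}" "\<lambda>i. g (s + real i * \<delta>)"] g(1)
        divide_left_mono[of 1 "real n" "\<Sum>i<n. g (s + real i * \<delta>)"] by (simp add: shift_avg_def)
    also have "\<dots> \<le> (\<Sum>i<Suc N. g (s + real i * \<delta>))"
      using n g(1) by (intro sum_mono2) auto
    finally show "shift_avg \<delta> g n s \<le> (\<Sum>i<Suc N. g (s + real i * \<delta>))" .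
  qed
  have powm: "?m s powr q = ?m s powr (q - 1) * ?m s" for s
    using powr_add[of "?m s" "q - 1" 1] m0[of s] by (cases "?m s = 0") auto
  \<comment> \<open>Crude finiteness: one factor of the maximal function is bounded by a finite sum
    of translates of \<open>g\<close>, the remaining power by a power of \<open>B\<close>.\<close>
  have "?I \<le> (\<integral>\<^sup>+s. ennreal (B powr (q - 1)) * (\<Sum>i<Suc N. ennreal (g (s + real i * \<delta>))) \<partial>lborel)"
  proof (rule nn_integral_mono)
    fix s
    have "?m s powr q \<le> B powr (q - 1) * (\<Sum>i<Suc N. g (s + real i * \<delta>))"
      unfolding powm using q m0 mB mS by (intro mult_mono powr_mono2) auto
    then show "ennreal (?m s powr q) \<le> ennreal (B powr (q - 1)) * (\<Sum>i<Suc N. ennreal (g (s + real i * \<delta>)))"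
      using g(1) by (subst sum_ennreal) (auto simp: ennreal_mult[symmetric] sum_nonneg simp del: sum.lessThan_Suc intro!: ennreal_leI)
  qed
  also have "\<dots> = ennreal (B powr (q - 1)) * (\<Sum>i<Suc N. \<integral>\<^sup>+s. ennreal (g s) \<partial>lborel)"
    using nn_integral_shift[of "\<lambda>s. ennreal (g s)"]
    by (simp add: nn_integral_cmult nn_integral_sum nn_integral_add del: sum_constant)
  also have "\<dots> < \<infinity>" using g(3) by (simp add: ennreal_mult_less_top of_nat_less_top)
  finally have fin: "?I < \<infinity>" .
  define \<eta> :: real where "\<eta> = 1 / 2"
  have \<eta>: "0 \<le> \<eta>" by (simp add: \<eta>_def)
  \<comment> \<open>Either \<open>g\<close> is so small that the left side is at most half of
    \<open>?m s powr q\<close>, or \<open>?m s < 2 * c * g s\<close> and \<open>?m s\<close> can be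
    replaced by that multiple of \<open>g s\<close>.\<close>
  have young: "c * (g s * ?m s powr (q - 1)) \<le> \<eta> * ?m s powr q + (2 * c) powr q * g s powr q" for s
  proof (cases "2 * c * g s \<le> ?m s")
    case True
    have "2 * (c * (g s * ?m s powr (q - 1))) = ?m s powr (q - 1) * (2 * c * g s)" by simp
    also have "\<dots> \<le> ?m s powr q" unfolding powm by (rule mult_left_mono[OF True]) simp
    finally have "c * (g s * ?m s powr (q - 1)) \<le> \<eta> * ?m s powr q" by (simp add: \<eta>_def)
    moreover have "0 \<le> (2 * c) powr q * g s powr q" by simp
    ultimately show ?thesis by linarith
  next
    case False
    have "c * (g s * ?m s powr (q - 1)) \<le> c * (g s * (2 * c * g s) powr (q - 1))"
      using False m0[of s] q c g(1) by (intro mult_left_mono powr_mono2) auto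
    also have "\<dots> \<le> (2 * c * g s) * (2 * c * g s) powr (q - 1)" using c g(1) by simp
    also have "\<dots> = (2 * c * g s) powr q"
      using powr_add[of "2 * c * g s" "q - 1" 1] c g(1)[of s] by (cases "g s = 0") auto
    also have "\<dots> = (2 * c) powr q * g s powr q" using c g(1) by (simp add: powr_mult)
    finally show ?thesis using \<eta> by (simp add: add_increasing)
  qed
  have "?I \<le> ennreal c * (\<integral>\<^sup>+s. ennreal (g s * ?m s powr (q - 1)) \<partial>lborel)"
    unfolding c_def by (rule nn_integral_shift_max_powr_le[OF assms(1) g(1,3) q])
  also have "\<dots> = (\<integral>\<^sup>+s. ennreal (c * (g s * ?m s powr (q - 1))) \<partial>lborel)"
    using c g(1) by (subst nn_integral_cmult[symmetric]) (auto simp: ennreal_mult)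
  also have "\<dots> \<le> (\<integral>\<^sup>+s. ennreal \<eta> * ennreal (?m s powr q) + ennreal ((2 * c) powr q) * ennreal (g s powr q) \<partial>lborel)"
    using young \<eta> by (intro nn_integral_mono) (auto simp: ennreal_mult[symmetric] ennreal_plus[symmetric] simp del: ennreal_plus intro!: ennreal_leI)
  also have "\<dots> = ennreal \<eta> * ?I + ennreal ((2 * c) powr q) * (\<integral>\<^sup>+s. ennreal (g s powr q) \<partial>lborel)"
    by (simp add: nn_integral_add nn_integral_cmult)
  finally have main: "?I \<le> ennreal \<eta> * ?I + ennreal ((2 * c) powr q) * (\<integral>\<^sup>+s. ennreal (g s powr q) \<partial>lborel)" .
  obtain i where i: "?I = ennreal i" "0 \<le> i" using fin by (cases ?I) auto
  have "?I \<le> ennreal 2 * (ennreal ((2 * c) powr q) * (\<integral>\<^sup>+s. ennreal (g s powr q) \<partial>lborel))"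
  proof (cases "\<integral>\<^sup>+s. ennreal (g s powr q) \<partial>lborel")
    case (real j)
    have "i \<le> \<eta> * i + (2 * c) powr q * j"
      using main real i \<eta> by (simp add: ennreal_mult[symmetric] ennreal_plus[symmetric] del: ennreal_plus)
    then have "i \<le> 2 * ((2 * c) powr q * j)" by (simp add: \<eta>_def)
    then have "ennreal i \<le> ennreal (2 * ((2 * c) powr q * j))" by (rule ennreal_leI)
    then show ?thesis using real i by (simp only: ennreal_mult mult_nonneg_nonneg powr_ge_zero zero_le_numeral)
  next
    case top
    then show ?thesis using c by (simp add: ennreal_mult_top)
  qed
  then show ?thesis by (simp add: ennreal_mult mult.assoc c_def)
qed

section \<open>From discrete to continuous averages in time\<close>

lemma nn_integral_shift_average:
  fixes k F :: "real \<Rightarrow> ennreal"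
  assumes [measurable]: "k \<in> borel_measurable borel" "F \<in> borel_measurable borel"
    and k: "(\<integral>\<^sup>+\<tau>. k \<tau> \<partial>lborel) = 1"
  shows "(\<integral>\<^sup>+s. \<integral>\<^sup>+\<tau>. k \<tau> * F (s + \<tau>) \<partial>lborel \<partial>lborel) = (\<integral>\<^sup>+s. F s \<partial>lborel)"
proof -
  have "(\<integral>\<^sup>+s. \<integral>\<^sup>+\<tau>. k \<tau> * F (s + \<tau>) \<partial>lborel \<partial>lborel) = (\<integral>\<^sup>+\<tau>. \<integral>\<^sup>+s. k \<tau> * F (s + \<tau>) \<partial>lborel \<partial>lborel)"
    by (rule lborel_pair.Fubini') measurable
  also have "\<dots> = (\<integral>\<^sup>+s. F s \<partial>lborel)"
    by (simp add: nn_integral_cmult nn_integral_multc nn_integral_shift k)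
  finally show ?thesis .
qed

text \<open>Only multiples of \<delta> occur as lengths: the supremum is countable, hence
  measurable, and every average is an exact discrete average of means over intervals of length
  \<delta>.\<close>

definition time_max :: "real \<Rightarrow> (real \<Rightarrow> ennreal) \<Rightarrow> real \<Rightarrow> ennreal" where
  "time_max \<delta> v s =
     (SUP n. ennreal (1 / (real (Suc n) * \<delta>)) * (\<integral>\<^sup>+\<tau>\<in>{0<..real (Suc n) * \<delta>}. v (s + \<tau>) \<partial>lborel))"

lemma borel_measurable_time_max [measurable (raw)]:
  fixes v :: "'z \<Rightarrow> real \<Rightarrow> ennreal"
  assumes [measurable]: "s \<in> borel_measurable M" "case_prod v \<in> borel_measurable (M \<Otimes>\<^sub>M borel)"
  shows "(\<lambda>z. time_max \<delta> (v z) (s z)) \<in> borel_measurable M"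
  unfolding time_max_def by measurable

lemma time_max_le:
  assumes "0 < \<delta>" "\<And>s. v s \<le> c"
  shows "time_max \<delta> v s \<le> c"
  unfolding time_max_def
proof (rule SUP_least)
  fix n
  let ?R = "real (Suc n) * \<delta>"
  have R: "0 < ?R" using assms(1) by simp
  have "ennreal (1 / ?R) * (\<integral>\<^sup>+\<tau>\<in>{0<..?R}. v (s + \<tau>) \<partial>lborel) \<le> ennreal (1 / ?R) * (\<integral>\<^sup>+\<tau>. c * indicator {0<..?R} \<tau> \<partial>lborel)"
    by (intro mult_left_mono nn_integral_mono mult_right_mono assms) auto
  also have "\<dots> = (ennreal (1 / ?R) * ennreal ?R) * c"
    using R by (simp add: nn_integral_cmult mult_ac del: of_nat_Suc)
  also have "\<dots> = c" using R assms(1) by (simp add: ennreal_mult[symmetric] del: of_nat_Suc)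
  finally show "ennreal (1 / ?R) * (\<integral>\<^sup>+\<tau>\<in>{0<..?R}. v (s + \<tau>) \<partial>lborel) \<le> c" .
qed

text \<open>Rounding \<open>R\<close> up to a multiple of \<delta> at most doubles it, since
  \<open>R\<close> is at least \<delta>.\<close>

lemma nn_integral_le_time_max:
  assumes \<delta>: "0 < \<delta>" "\<delta> \<le> R"
  shows "(\<integral>\<^sup>+\<tau>\<in>{0<..R}. v (s + \<tau>) \<partial>lborel) \<le> ennreal (2 * R) * time_max \<delta> v s"
proof -
  \<comment> \<open>The shift by 1 makes \<open>Suc n\<close>, the index used in
    \<open>time_max\<close>, equal to the rounded quotient.\<close>
  define n where "n = nat \<lceil>R / \<delta>\<rceil> - 1"
  have "1 \<le> R / \<delta>" using \<delta> by simp
  then have c: "1 \<le> \<lceil>R / \<delta>\<rceil>" by linarith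
  then have n: "real (Suc n) = of_int \<lceil>R / \<delta>\<rceil>" by (simp add: n_def of_nat_diff)
  let ?R = "real (Suc n) * \<delta>"
  have le: "R \<le> ?R" unfolding n using \<delta> mult_right_mono[OF le_of_int_ceiling[of "R / \<delta>"], of \<delta>] by simp
  have "real (Suc n) < R / \<delta> + 1" unfolding n by linarith
  then have "?R < R + \<delta>" using \<delta> by (simp add: field_simps)
  then have ge: "?R \<le> 2 * R" using \<delta> by simp
  have R: "0 < ?R" using \<delta> by simp
  have "(\<integral>\<^sup>+\<tau>\<in>{0<..R}. v (s + \<tau>) \<partial>lborel) \<le> (\<integral>\<^sup>+\<tau>\<in>{0<..?R}. v (s + \<tau>) \<partial>lborel)"
    using le by (intro nn_integral_mono mult_left_mono) (auto simp: indicator_def)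
  also have "\<dots> = ennreal ?R * (ennreal (1 / ?R) * (\<integral>\<^sup>+\<tau>\<in>{0<..?R}. v (s + \<tau>) \<partial>lborel))"
    using R by (simp add: mult.assoc[symmetric] ennreal_mult[symmetric] del: of_nat_Suc)
  also have "\<dots> \<le> ennreal ?R * time_max \<delta> v s"
    unfolding time_max_def by (intro mult_left_mono SUP_upper) auto
  also have "\<dots> \<le> ennreal (2 * R) * time_max \<delta> v s"
    by (intro mult_right_mono ennreal_leI ge) auto
  finally show ?thesis .
qed

text \<open>Let \<open>g s\<close> be the mean of \<open>v\<close> over the interval of length
  \<delta> starting at \<open>s\<close>. The averages in \<open>time_max\<close> are then the
  discrete averages of \<open>g\<close>, Jensen's inequality bounds \<open>g\<close> by
  \<open>v\<close> in \<open>L_q\<close>, and the discrete constant depends neither on \<delta> nor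
  on the number of averages.\<close>

lemma time_max_strong_type:
  fixes v :: "real \<Rightarrow> ennreal"
  assumes [measurable]: "v \<in> borel_measurable borel" and L: "\<And>s. v s \<le> ennreal L" and fin: "(\<integral>\<^sup>+s. v s \<partial>lborel) < \<infinity>"
    and q: "1 < q" and \<delta>: "0 < \<delta>"
  shows "(\<integral>\<^sup>+s. time_max \<delta> v s epowr q \<partial>lborel) \<le> ennreal (2 * (2 * q / (q - 1)) powr q) * (\<integral>\<^sup>+s. v s epowr q \<partial>lborel)"
proof -
  define k :: "real \<Rightarrow> ennreal" where "k \<tau> = ennreal (1 / \<delta>) * indicator {0<..\<delta>} \<tau>" for \<tau>
  have [measurable]: "k \<in> borel_measurable borel" unfolding k_def by measurable
  have k1: "(\<integral>\<^sup>+\<tau>. k \<tau> \<partial>lborel) = 1"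
    using \<delta> by (simp add: k_def nn_integral_cmult ennreal_mult[symmetric])
  define A where "A s = (\<integral>\<^sup>+\<tau>. k \<tau> * v (s + \<tau>) \<partial>lborel)" for s
  have [measurable]: "A \<in> borel_measurable borel" unfolding A_def by measurable
  have AL: "A s \<le> ennreal L" for s
  proof -
    have "A s \<le> (\<integral>\<^sup>+\<tau>. k \<tau> * ennreal L \<partial>lborel)"
      unfolding A_def by (intro nn_integral_mono mult_left_mono L) auto
    then show ?thesis by (simp add: nn_integral_multc k1)
  qed
  define g where "g s = enn2real (A s)" for s
  have [measurable]: "g \<in> borel_measurable borel" unfolding g_def by measurable
  have gA: "ennreal (g s) = A s" for s
    unfolding g_def using AL[of s] by (intro ennreal_enn2real) (auto simp: less_top[symmetric] top_unique)
  have g0: "0 \<le> g s" for s by (simp add: g_def)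
  have gB: "g s \<le> max 0 L" for s
    using AL[of s] unfolding gA[symmetric] by (metis ennreal_max_0 ennreal_le_iff max.cobounded1)
  have "(\<integral>\<^sup>+s. ennreal (g s) \<partial>lborel) = (\<integral>\<^sup>+s. v s \<partial>lborel)"
    unfolding gA unfolding A_def by (rule nn_integral_shift_average[OF _ _ k1]) measurable
  then have gfin: "(\<integral>\<^sup>+s. ennreal (g s) \<partial>lborel) < \<infinity>" using fin by simp
  have "(\<integral>\<^sup>+s. ennreal (g s powr q) \<partial>lborel) = (\<integral>\<^sup>+s. A s epowr q \<partial>lborel)"
    by (simp add: gA[symmetric] epowr_ennreal g0)
  also have "\<dots> \<le> (\<integral>\<^sup>+s. \<integral>\<^sup>+\<tau>. k \<tau> * v (s + \<tau>) epowr q \<partial>lborel \<partial>lborel)"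
    unfolding A_def using q k1 by (intro nn_integral_mono epowr_Jensen) auto
  also have "\<dots> = (\<integral>\<^sup>+s. v s epowr q \<partial>lborel)"
    by (rule nn_integral_shift_average[OF _ _ k1]) measurable
  finally have gq: "(\<integral>\<^sup>+s. ennreal (g s powr q) \<partial>lborel) \<le> (\<integral>\<^sup>+s. v s epowr q \<partial>lborel)" .
  have piece: "(\<integral>\<^sup>+\<tau>\<in>{0<..\<delta>}. v (s + \<tau>) \<partial>lborel) = ennreal \<delta> * ennreal (g s)" for s
  proof -
    have "A s = ennreal (1 / \<delta>) * (\<integral>\<^sup>+\<tau>\<in>{0<..\<delta>}. v (s + \<tau>) \<partial>lborel)"
      unfolding A_def k_def by (simp add: nn_integral_cmult[symmetric] mult_ac)
    then show ?thesis unfolding gA using \<delta> by (simp add: mult.assoc[symmetric] ennreal_mult[symmetric])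
  qed
  have pieces: "(\<integral>\<^sup>+\<tau>\<in>{0<..real n * \<delta>}. v (s + \<tau>) \<partial>lborel) = ennreal (\<delta> * (\<Sum>i<n. g (s + real i * \<delta>)))" for n s
  proof (induction n)
    case 0
    then show ?case by simp
  next
    case (Suc n)
    let ?a = "real n * \<delta>"
    have i: "indicator {0<..real (Suc n) * \<delta>} \<tau> = indicator {0<..?a} \<tau> + (indicator {?a<..?a + \<delta>} \<tau> :: ennreal)" for \<tau>
      using \<delta> by (auto simp: indicator_def algebra_simps) (smt (verit) mult_nonneg_nonneg of_nat_0_le_iff)+
    have "(\<integral>\<^sup>+\<tau>\<in>{0<..real (Suc n) * \<delta>}. v (s + \<tau>) \<partial>lborel) =
      (\<integral>\<^sup>+\<tau>\<in>{0<..?a}. v (s + \<tau>) \<partial>lborel) + (\<integral>\<^sup>+\<tau>\<in>{?a<..?a + \<delta>}. v (s + \<tau>) \<partial>lborel)"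
      unfolding i by (simp add: distrib_left nn_integral_add)
    also have "(\<integral>\<^sup>+\<tau>\<in>{?a<..?a + \<delta>}. v (s + \<tau>) \<partial>lborel) = (\<integral>\<^sup>+\<tau>\<in>{0<..\<delta>}. v ((s + ?a) + \<tau>) \<partial>lborel)"
      by (subst nn_integral_shift[symmetric, of _ ?a])
        (auto simp: indicator_def add_ac intro!: nn_integral_cong)
    finally show ?case
      unfolding Suc piece using \<delta> g0
      by (simp add: ennreal_plus[symmetric] ennreal_mult[symmetric] sum_nonneg distrib_left del: ennreal_plus)
  qed
  have avg: "ennreal (1 / (real (Suc n) * \<delta>)) * (\<integral>\<^sup>+\<tau>\<in>{0<..real (Suc n) * \<delta>}. v (s + \<tau>) \<partial>lborel) = ennreal (shift_avg \<delta> g (Suc n) s)" for n s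
    unfolding pieces using \<delta> g0
    by (subst ennreal_mult[symmetric]) (auto simp: sum_nonneg shift_avg_def divide_simps)
  have "time_max \<delta> v s \<le> (SUP N. ennreal (shift_max \<delta> g N s))" for s
    unfolding time_max_def avg
  proof (rule SUP_mono)
    fix n
    have "shift_avg \<delta> g (Suc n) s \<le> shift_max \<delta> g n s" unfolding shift_max_def by (intro Max_ge) auto
    then show "\<exists>m\<in>UNIV. ennreal (shift_avg \<delta> g (Suc n) s) \<le> ennreal (shift_max \<delta> g m s)"
      by (auto intro: ennreal_leI)
  qed
  then have "(\<integral>\<^sup>+s. time_max \<delta> v s epowr q \<partial>lborel) \<le> (\<integral>\<^sup>+s. (SUP N. ennreal (shift_max \<delta> g N s) epowr q) \<partial>lborel)"
    using q by (intro nn_integral_mono) (subst SUP_epowr[symmetric], auto intro: epowr_mono)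
  also have "\<dots> = (SUP N. \<integral>\<^sup>+s. ennreal (shift_max \<delta> g N s) epowr q \<partial>lborel)"
  proof (rule nn_integral_monotone_convergence_SUP)
    show "incseq (\<lambda>N s. ennreal (shift_max \<delta> g N s) epowr q)"
      using q unfolding shift_max_def
      by (intro incseq_SucI le_funI epowr_mono ennreal_leI Max_mono) auto
  qed measurable
  also have "\<dots> \<le> ennreal (2 * (2 * q / (q - 1)) powr q) * (\<integral>\<^sup>+s. ennreal (g s powr q) \<partial>lborel)"
  proof (rule SUP_least)
    fix N
    show "(\<integral>\<^sup>+s. ennreal (shift_max \<delta> g N s) epowr q \<partial>lborel) \<le> ennreal (2 * (2 * q / (q - 1)) powr q) * (\<integral>\<^sup>+s. ennreal (g s powr q) \<partial>lborel)"
      using shift_max_strong_type[OF _ g0 gB gfin q, of \<delta> N] shift_max_nonneg[of g \<delta> N, OF g0]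
      by (simp add: epowr_ennreal)
  qed
  also have "\<dots> \<le> ennreal (2 * (2 * q / (q - 1)) powr q) * (\<integral>\<^sup>+s. v s epowr q \<partial>lborel)"
    by (intro mult_left_mono gq) auto
  finally show ?thesis .
qed

subsection \<open>Weighted square function estimates for one initial datum\<close>

text \<open>The factors \<open>3/2\<close> make \<open>\<tau> - S\<close> lie between \<open>S/3\<close> and \<open>S\<close> for \<open>\<tau>\<close> between \<open>4S/3\<close> and \<open>2S\<close>, so that
  \<open>|\<nabla>T\<^bsub>\<tau>\<^esub>h|\<^sup>2 \<le> T\<^bsub>\<tau>-S\<^esub>|\<nabla>T\<^bsub>S\<^esub>h|\<^sup>2\<close> is at most a constant times \<open>T\<^bsub>S\<^esub>|\<nabla>T\<^bsub>S\<^esub>h|\<^sup>2\<close>.\<close>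

lemma heat_grad_sq_weighted_integral:
  fixes h :: "real^'n \<Rightarrow> 'v::{real_inner, banach, second_countable_topology}" and w :: "real \<Rightarrow> real^'n \<Rightarrow> ennreal"
  assumes h: "heat_admissible2 h" and Z: "heat_admissible Z" "\<And>y. 0 \<le> Z y" and \<sigma>: "0 < \<sigma>"
    and w [measurable]: "case_prod w \<in> borel_measurable (borel \<Otimes>\<^sub>M borel)"
    and wZ: "\<And>x R. 2 * \<sigma> \<le> R \<Longrightarrow> (\<integral>\<^sup>+\<tau>\<in>{0<..R}. w \<tau> x \<partial>lborel) \<le> ennreal (2 * R * Z x)"
    and s: "\<And>j. s j = (3 / 2) ^ j * \<sigma>"
    and Q: "\<And>k. (\<Sum>j<k. \<integral>\<^sup>+x. ennreal (heat (s (Suc j)) Z x * (2 * (s (Suc j) - s j) * heat_grad_sq (s (Suc j)) h x)) \<partial>lborel) \<le> Q"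
  shows "(\<integral>\<^sup>+\<tau>\<in>{2 * \<sigma><..}. (\<integral>\<^sup>+x. w \<tau> x * ennreal (heat_grad_sq \<tau> h x) \<partial>lborel) \<partial>lborel)
     \<le> ennreal (6 * 3 powr (real CARD('n) / 2)) * Q"
proof -
  note [measurable] = heat_admissible2D(1)[OF h] heat_admissibleD(1)[OF Z(1)]
  let ?c = "3 powr (real CARD('n) / 2)"
  define F where "F \<tau> = (\<integral>\<^sup>+x. w \<tau> x * ennreal (heat_grad_sq \<tau> h x) \<partial>lborel)" for \<tau>
  have [measurable]: "F \<in> borel_measurable borel" unfolding F_def by measurable
  define J where "J j = (\<integral>\<^sup>+x. ennreal (heat (s (Suc j)) Z x * (2 * (s (Suc j) - s j) * heat_grad_sq (s (Suc j)) h x)) \<partial>lborel)" for j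
  have s0: "0 < s j" for j using \<sigma> by (simp add: s)
  have s_Suc: "s (Suc j) = 3 / 2 * s j" for j by (simp add: s)
  have step: "(\<integral>\<^sup>+\<tau>\<in>{2 * s j<..2 * s (Suc j)}. F \<tau> \<partial>lborel) \<le> ennreal (6 * ?c) * J j" for j
  proof -
    define S where "S = s (Suc j)"
    have S: "0 < S" "2 * s j = 4 / 3 * S" "\<sigma> \<le> S" using s0 s_Suc[of j] \<sigma> one_le_power[of "3/2::real" "Suc j"] by (auto simp: S_def s simp del: power_Suc)
    let ?G = "\<lambda>y. ennreal (heat_grad_sq S h y)"
    have "(\<integral>\<^sup>+\<tau>\<in>{2 * s j<..2 * s (Suc j)}. F \<tau> \<partial>lborel) \<le>
       (\<integral>\<^sup>+\<tau>. \<integral>\<^sup>+x. indicator {0<..2 * S} \<tau> * w \<tau> x * (ennreal ?c * heat_nn S ?G x) \<partial>lborel \<partial>lborel)"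
    proof (intro nn_integral_mono)
      fix \<tau>
      show "F \<tau> * indicator {2 * s j<..2 * s (Suc j)} \<tau> \<le> (\<integral>\<^sup>+x. indicator {0<..2 * S} \<tau> * w \<tau> x * (ennreal ?c * heat_nn S ?G x) \<partial>lborel)"
      proof (cases "\<tau> \<in> {2 * s j<..2 * s (Suc j)}")
        case True
        then have \<tau>: "4 / 3 * S < \<tau>" "\<tau> \<le> 2 * S" using S(2) by (auto simp: S_def)
        then have a: "0 < \<tau> - S" "\<tau> - S \<le> S" using S by auto
        have r: "S / (\<tau> - S) \<le> 3" using \<tau> a by (simp add: field_simps)
        have "ennreal (heat_grad_sq \<tau> h x) \<le> ennreal ?c * heat_nn S ?G x" for x
        proof -
          have "ennreal (heat_grad_sq \<tau> h x) \<le> heat_nn (\<tau> - S) ?G x"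
            using heat_grad_sq_add_le[OF h a(1) S(1), of x] by simp
          also have "\<dots> \<le> ennreal ((S / (\<tau> - S)) powr (real CARD('n) / 2)) * heat_nn S ?G x"
            by (rule heat_nn_le[OF _ a]) measurable
          also have "\<dots> \<le> ennreal ?c * heat_nn S ?G x"
            using r a S by (intro mult_right_mono ennreal_leI powr_mono2) auto
          finally show ?thesis .
        qed
        then show ?thesis
          using True \<tau> S unfolding F_def by (auto intro!: nn_integral_mono mult_left_mono)
      qed simp
    qed
    also have "\<dots> = (\<integral>\<^sup>+x. \<integral>\<^sup>+\<tau>. indicator {0<..2 * S} \<tau> * w \<tau> x * (ennreal ?c * heat_nn S ?G x) \<partial>lborel \<partial>lborel)"
      by (rule lborel_pair.Fubini') measurable
    also have "\<dots> = (\<integral>\<^sup>+x. (\<integral>\<^sup>+\<tau>\<in>{0<..2 * S}. w \<tau> x \<partial>lborel) * (ennreal ?c * heat_nn S ?G x) \<partial>lborel)"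
      by (simp add: nn_integral_multc mult.commute)
    \<comment> \<open>This is where the weight loses its dependence on \<tau>: the window ends at
      \<open>2 * S\<close>, so \<open>wZ\<close> applies with \<open>R = 2 * S\<close> and gives
      \<open>4 * S * Z x\<close>.\<close>
    also have "\<dots> \<le> (\<integral>\<^sup>+x. ennreal (4 * S * Z x) * (ennreal ?c * heat_nn S ?G x) \<partial>lborel)"
      using wZ[of "2 * S"] S by (intro nn_integral_mono mult_right_mono) auto
    also have "\<dots> = (\<integral>\<^sup>+x. ennreal (4 * S * ?c) * (ennreal (Z x) * heat_nn S ?G x) \<partial>lborel)"
      using S Z(2) by (intro nn_integral_cong) (simp add: ennreal_mult mult_ac)
    \<comment> \<open>Self-adjointness moves the flow from the squared gradient to \<open>Z\<close>,
      which makes both factors functions at the same time \<open>S\<close>.\<close>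
    also have "\<dots> = ennreal (4 * S * ?c) * (\<integral>\<^sup>+x. heat_nn S (\<lambda>x. ennreal (Z x)) x * ?G x \<partial>lborel)"
      by (simp add: nn_integral_cmult nn_integral_mult_heat_nn)
    also have "\<dots> = (\<integral>\<^sup>+x. ennreal (4 * S * ?c) * (heat_nn S (\<lambda>x. ennreal (Z x)) x * ?G x) \<partial>lborel)"
      by (simp add: nn_integral_cmult)
    also have "\<dots> = (\<integral>\<^sup>+x. ennreal (6 * ?c) * ennreal (heat S Z x * (2 * (s (Suc j) - s j) * heat_grad_sq S h x)) \<partial>lborel)"
    proof (intro nn_integral_cong)
      fix x
      have "heat_nn S (\<lambda>x. ennreal (Z x)) x = ennreal (heat S Z x)" by (rule ennreal_heat[OF Z(1) S(1) Z(2), symmetric])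
      \<comment> \<open>Since \<open>s (Suc j) - s j = S / 3\<close>, the factor
        \<open>4 * S\<close> equals 6 times \<open>2 * (s (Suc j) - s j)\<close>.\<close>
      moreover have "4 * S * ?c * (heat S Z x * heat_grad_sq S h x) = 6 * ?c * (heat S Z x * (2 * (s (Suc j) - s j) * heat_grad_sq S h x))"
        using S(2) by (simp add: S_def s_Suc)
      ultimately show "ennreal (4 * S * ?c) * (heat_nn S (\<lambda>x. ennreal (Z x)) x * ?G x) =
          ennreal (6 * ?c) * ennreal (heat S Z x * (2 * (s (Suc j) - s j) * heat_grad_sq S h x))"
        using S heat_nonneg[of Z S x, OF Z(2)] s_Suc[of j] s0[of j] by (simp add: ennreal_mult[symmetric])
    qed
    also have "\<dots> = ennreal (6 * ?c) * J j"
      unfolding J_def S_def by (rule nn_integral_cmult) measurable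
    finally show ?thesis .
  qed
  have fin: "(\<integral>\<^sup>+\<tau>\<in>{2 * \<sigma><..2 * s k}. F \<tau> \<partial>lborel) \<le> ennreal (6 * ?c) * (\<Sum>j<k. J j)" for k
  proof (induction k)
    case 0
    then show ?case by (simp add: s)
  next
    case (Suc k)
    have "s 0 \<le> s k" using \<sigma> one_le_power[of "3/2::real" k] by (simp add: s)
    then have i: "indicator {2 * \<sigma><..2 * s (Suc k)} \<tau> = indicator {2 * \<sigma><..2 * s k} \<tau> + (indicator {2 * s k<..2 * s (Suc k)} \<tau> :: ennreal)" for \<tau>
      using s0[of k] s_Suc[of k] s[of 0] by (auto simp: indicator_def)
    have "(\<integral>\<^sup>+\<tau>\<in>{2 * \<sigma><..2 * s (Suc k)}. F \<tau> \<partial>lborel) =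
       (\<integral>\<^sup>+\<tau>\<in>{2 * \<sigma><..2 * s k}. F \<tau> \<partial>lborel) + (\<integral>\<^sup>+\<tau>\<in>{2 * s k<..2 * s (Suc k)}. F \<tau> \<partial>lborel)"
      unfolding i by (simp add: distrib_left nn_integral_add)
    also have "\<dots> \<le> ennreal (6 * ?c) * (\<Sum>j<k. J j) + ennreal (6 * ?c) * J k"
      by (intro add_mono Suc step)
    finally show ?case by (simp add: distrib_left)
  qed
  have unb: "\<exists>k. \<tau> \<le> 2 * s k" for \<tau>
  proof -
    obtain k where "\<tau> / (2 * \<sigma>) < (3 / 2) ^ k" using real_arch_pow[of "3/2" "\<tau> / (2 * \<sigma>)"] by auto
    then show ?thesis using \<sigma> by (intro exI[of _ k]) (simp add: s field_simps)
  qed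
  have mono: "s j \<le> s (Suc j)" for j using s_Suc[of j] s0[of j] by simp
  have "(\<integral>\<^sup>+\<tau>\<in>{2 * \<sigma><..}. F \<tau> \<partial>lborel) = (\<integral>\<^sup>+\<tau>. (SUP k. F \<tau> * indicator {2 * \<sigma><..2 * s k} \<tau>) \<partial>lborel)"
  proof (intro nn_integral_cong antisym)
    fix \<tau>
    obtain k where "\<tau> \<le> 2 * s k" using unb by blast
    then show "F \<tau> * indicator {2 * \<sigma><..} \<tau> \<le> (SUP k. F \<tau> * indicator {2 * \<sigma><..2 * s k} \<tau>)"
      by (intro SUP_upper2[of k]) (auto simp: indicator_def)
    show "(SUP k. F \<tau> * indicator {2 * \<sigma><..2 * s k} \<tau>) \<le> F \<tau> * indicator {2 * \<sigma><..} \<tau>"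
      by (intro SUP_least mult_left_mono) (auto simp: indicator_def)
  qed
  also have "\<dots> = (SUP k. \<integral>\<^sup>+\<tau>\<in>{2 * \<sigma><..2 * s k}. F \<tau> \<partial>lborel)"
  proof (rule nn_integral_monotone_convergence_SUP)
    show "incseq (\<lambda>k \<tau>. F \<tau> * indicator {2 * \<sigma><..2 * s k} \<tau>)"
      using mono by (intro incseq_SucI le_funI mult_left_mono) (auto simp: indicator_def intro: order_trans mult_left_mono)
  qed measurable
  also have "\<dots> \<le> ennreal (6 * ?c) * Q"
    using fin Q unfolding J_def by (intro SUP_least) (meson mult_left_mono order_trans zero_le)
  finally show ?thesis unfolding F_def .
qed

lemma heat_kernel_le_const: "0 < t \<Longrightarrow> heat_kernel t (x :: real^'n) \<le> (4 * pi * t) powr (- real CARD('n) / 2)"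
  unfolding heat_kernel_def by (rule mult_left_le) (auto simp: mult_nonneg_nonneg divide_nonneg_pos)

lemma heat_nn_finite:
  fixes \<phi> :: "real^'n \<Rightarrow> ennreal"
  assumes [measurable]: "\<phi> \<in> borel_measurable borel" and \<phi>: "(\<integral>\<^sup>+y. \<phi> y \<partial>lborel) < \<infinity>" and t: "0 < t"
  shows "heat_nn t \<phi> x < \<infinity>"
proof -
  have "heat_nn t \<phi> x \<le> (\<integral>\<^sup>+y. ennreal ((4 * pi * t) powr (- real CARD('n) / 2)) * \<phi> y \<partial>lborel)"
    unfolding heat_nn_def using heat_kernel_le_const[OF t, where 'n='n] by (intro nn_integral_mono mult_right_mono ennreal_leI) auto
  also have "\<dots> < \<infinity>" using \<phi> by (simp add: nn_integral_cmult ennreal_mult_less_top)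
  finally show ?thesis .
qed

lemma heat_nn_power_finite:
  fixes h :: "real^'n \<Rightarrow> 'v::{banach, second_countable_topology}"
  assumes [measurable]: "h \<in> borel_measurable borel" and a: "0 < a" "a \<le> p"
    and h: "(\<integral>\<^sup>+y. ennreal (norm (h y) powr p) \<partial>lborel) < \<infinity>" and t: "0 < t"
  shows "heat_nn t (\<lambda>y. ennreal (norm (h y) powr a)) x < \<infinity>"
proof -
  have "heat_nn t (\<lambda>y. ennreal (norm (h y) powr a)) x \<le> heat_nn t (\<lambda>y. 1 + ennreal (norm (h y) powr p)) x"
  proof (rule heat_nn_mono)
    fix y
    have "norm (h y) powr a \<le> 1 + norm (h y) powr p"
    proof (cases "norm (h y) \<le> 1")
      case True
      then have "norm (h y) powr a \<le> 1 powr a" using a by (intro powr_mono2) auto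
      then show ?thesis by (simp add: add_increasing2)
    next
      case False
      then have "norm (h y) powr a \<le> norm (h y) powr p" using a by (intro powr_mono) auto
      then show ?thesis by simp
    qed
    then show "ennreal (norm (h y) powr a) \<le> 1 + ennreal (norm (h y) powr p)"
      by (simp add: ennreal_1[symmetric] ennreal_plus[symmetric] ennreal_leI del: ennreal_1 ennreal_plus)
  qed
  also have "\<dots> = 1 + heat_nn t (\<lambda>y. ennreal (norm (h y) powr p)) x"
    by (simp add: heat_nn_add heat_nn_const[OF t])
  also have "\<dots> < \<infinity>" using heat_nn_finite[OF _ h t, of x] by simp
  finally show ?thesis .
qed

lemma heat_admissible2_Lp:
  fixes h :: "real^'n \<Rightarrow> 'v::{banach, second_countable_topology}"
  assumes [measurable]: "h \<in> borel_measurable borel" and p: "2 \<le> p"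
    and h: "(\<integral>\<^sup>+y. ennreal (norm (h y) powr p) \<partial>lborel) < \<infinity>"
  shows "heat_admissible2 h"
  unfolding heat_admissible2_def
  using heat_nn_power_finite[OF assms(1) _ p h] by (auto simp: powr_numeral)

lemma heat_admissible_Lp:
  fixes h :: "real^'n \<Rightarrow> 'v::{banach, second_countable_topology}"
  assumes [measurable]: "h \<in> borel_measurable borel" and p: "1 \<le> p"
    and h: "(\<integral>\<^sup>+y. ennreal (norm (h y) powr p) \<partial>lborel) < \<infinity>"
  shows "heat_admissible h"
  unfolding heat_admissible_def
  using heat_nn_power_finite[OF assms(1) _ p h] by (auto simp: powr_one)

lemma heat_admissible_bounded:
  fixes Z :: "real^'n \<Rightarrow> real"
  assumes [measurable]: "Z \<in> borel_measurable borel" and Z: "\<And>y. \<bar>Z y\<bar> \<le> L"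
  shows "heat_admissible Z"
  unfolding heat_admissible_def
proof (intro conjI allI impI)
  fix t :: real and x :: "real^'n" assume t: "0 < t"
  have "heat_nn t (\<lambda>y. ennreal (norm (Z y))) x \<le> heat_nn t (\<lambda>y. ennreal L) x"
    using Z by (intro heat_nn_mono ennreal_leI) auto
  also have "\<dots> < \<infinity>" by (simp add: heat_nn_const[OF t])
  finally show "heat_nn t (\<lambda>y. ennreal (norm (Z y))) x < \<infinity>" .
qed measurable

lemma heat_nn_epowr_le:
  fixes \<phi> :: "real^'n \<Rightarrow> ennreal"
  assumes [measurable]: "\<phi> \<in> borel_measurable borel" and q: "1 \<le> q" and t: "0 < t"
  shows "(\<integral>\<^sup>+x. heat_nn t \<phi> x epowr q \<partial>lborel) \<le> (\<integral>\<^sup>+x. \<phi> x epowr q \<partial>lborel)"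
proof -
  have "(\<integral>\<^sup>+x. heat_nn t \<phi> x epowr q \<partial>lborel) \<le> (\<integral>\<^sup>+x. heat_nn t (\<lambda>y. \<phi> y epowr q) x \<partial>lborel)"
    unfolding heat_nn_def using nn_integral_heat_kernel_shift(1)[OF t, where 'n='n]
    by (intro nn_integral_mono epowr_Jensen q) auto
  then show ?thesis by (simp add: nn_integral_heat_nn[OF _ t])
qed

definition bell_const1 :: "real \<Rightarrow> real" where "bell_const1 r = r * (2 * r) powr (r - 1)"
definition bell_const2 :: "real \<Rightarrow> real" where "bell_const2 r = 2 powr (1 / (r - 1))"

text \<open>With \<open>r = p/2\<close> the telescoping sum is bounded by the integral of
  \<open>bell\<close> at time \<sigma>. By the growth bound and the contractivity of the flow in
  Lebesgue spaces, this is at most a quantity in which \<sigma> occurs only through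
  \<open>Z\<close>.\<close>

lemma heat_grad_sq_weighted_Lp:
  fixes h :: "real^'n \<Rightarrow> 'v::{real_inner, banach, second_countable_topology}" and w :: "real \<Rightarrow> real^'n \<Rightarrow> ennreal"
  assumes p: "2 < p" and [measurable]: "h \<in> borel_measurable borel"
    and h: "(\<integral>\<^sup>+y. ennreal (norm (h y) powr p) \<partial>lborel) < \<infinity>"
    and Z: "heat_admissible Z" "\<And>y. 0 \<le> Z y" and \<sigma>: "0 < \<sigma>"
    and w: "case_prod w \<in> borel_measurable (borel \<Otimes>\<^sub>M borel)"
    and wZ: "\<And>x R. 2 * \<sigma> \<le> R \<Longrightarrow> (\<integral>\<^sup>+\<tau>\<in>{0<..R}. w \<tau> x \<partial>lborel) \<le> ennreal (2 * R * Z x)"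
  shows "(\<integral>\<^sup>+\<tau>\<in>{2 * \<sigma><..}. (\<integral>\<^sup>+x. w \<tau> x * ennreal (heat_grad_sq \<tau> h x) \<partial>lborel) \<partial>lborel)
     \<le> ennreal (6 * 3 powr (real CARD('n) / 2)) *
       (ennreal (bell_const1 (p / 2)) * (\<integral>\<^sup>+y. ennreal (norm (h y) powr p) \<partial>lborel) +
        ennreal (bell_const2 (p / 2)) * (\<integral>\<^sup>+y. ennreal (Z y powr (p / (p - 2))) \<partial>lborel))"
proof -
  note [measurable] = heat_admissibleD(1)[OF Z(1)]
  define r where "r = p / 2"
  have r: "1 < r" using p by (simp add: r_def)
  have q: "r / (r - 1) = p / (p - 2)" using p by (simp add: r_def field_simps)
  have h2: "heat_admissible2 h" using p by (intro heat_admissible2_Lp[OF _ _ h]) auto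
  define s where "s j = (3 / 2) ^ j * \<sigma>" for j :: nat
  have s0: "s 0 = \<sigma>" by (simp add: s_def)
  have s1: "s k < s (Suc k)" for k using \<sigma> by (simp add: s_def)
  have c1: "0 \<le> bell_const1 r" "0 \<le> bell_const2 r" using r by (auto simp: bell_const1_def bell_const2_def)
  have "(\<integral>\<^sup>+x. bell r ((norm (heat (s 0) h x))\<^sup>2) (heat (s 0) Z x) \<partial>lborel) \<le>
     (\<integral>\<^sup>+x. ennreal (bell_const1 r) * ennreal ((norm (heat \<sigma> h x))\<^sup>2) epowr r + ennreal (bell_const2 r) * ennreal (heat \<sigma> Z x) epowr (r / (r - 1)) \<partial>lborel)"
  proof (rule nn_integral_mono)
    fix x
    have z: "0 \<le> heat \<sigma> Z x" by (intro heat_nonneg Z)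
    show "bell r ((norm (heat (s 0) h x))\<^sup>2) (heat (s 0) Z x) \<le>
      ennreal (bell_const1 r) * ennreal ((norm (heat \<sigma> h x))\<^sup>2) epowr r + ennreal (bell_const2 r) * ennreal (heat \<sigma> Z x) epowr (r / (r - 1))"
      using bell_le[OF r zero_le_power2 z, of "norm (heat \<sigma> h x)"] c1 z
      by (simp add: s0 epowr_ennreal ennreal_mult[symmetric] ennreal_plus[symmetric] bell_const1_def[symmetric] bell_const2_def[symmetric] del: ennreal_plus)
  qed
  also have "\<dots> \<le> (\<integral>\<^sup>+x. ennreal (bell_const1 r) * heat_nn \<sigma> (\<lambda>y. ennreal ((norm (h y))\<^sup>2)) x epowr r + ennreal (bell_const2 r) * heat_nn \<sigma> (\<lambda>y. ennreal (Z y)) x epowr (r / (r - 1)) \<partial>lborel)"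
    using norm_heat_sq_le[OF h2 \<sigma>] r ennreal_heat[OF Z(1) \<sigma> Z(2)]
    by (intro nn_integral_mono add_mono mult_left_mono epowr_mono) auto
  also have "\<dots> = ennreal (bell_const1 r) * (\<integral>\<^sup>+x. heat_nn \<sigma> (\<lambda>y. ennreal ((norm (h y))\<^sup>2)) x epowr r \<partial>lborel) +
     ennreal (bell_const2 r) * (\<integral>\<^sup>+x. heat_nn \<sigma> (\<lambda>y. ennreal (Z y)) x epowr (r / (r - 1)) \<partial>lborel)"
    by (simp add: nn_integral_add nn_integral_cmult)
  also have "\<dots> \<le> ennreal (bell_const1 r) * (\<integral>\<^sup>+x. ennreal ((norm (h x))\<^sup>2) epowr r \<partial>lborel) +
     ennreal (bell_const2 r) * (\<integral>\<^sup>+x. ennreal (Z x) epowr (r / (r - 1)) \<partial>lborel)"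
    using r by (intro add_mono mult_left_mono heat_nn_epowr_le \<sigma>) auto
  also have "\<dots> = ennreal (bell_const1 (p / 2)) * (\<integral>\<^sup>+y. ennreal (norm (h y) powr p) \<partial>lborel) +
        ennreal (bell_const2 (p / 2)) * (\<integral>\<^sup>+y. ennreal (Z y powr (p / (p - 2))) \<partial>lborel)" (is "_ = ?Q")
  proof -
    have e: "ennreal ((norm (h x))\<^sup>2) epowr r = ennreal (norm (h x) powr p)" for x
    proof -
      have "((norm (h x))\<^sup>2) powr r = (norm (h x) powr 2) powr r" by (simp add: powr_numeral)
      also have "\<dots> = norm (h x) powr p" by (simp only: powr_powr r_def) simp
      finally show ?thesis by (simp add: epowr_ennreal)
    qed
    show ?thesis unfolding e by (simp add: epowr_ennreal Z(2) q) (simp add: r_def)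
  qed
  finally have Q0: "(\<integral>\<^sup>+x. bell r ((norm (heat (s 0) h x))\<^sup>2) (heat (s 0) Z x) \<partial>lborel) \<le> ?Q" .
  have s00: "0 < s 0" using s0 \<sigma> by simp
  show ?thesis
  proof (rule heat_grad_sq_weighted_integral[OF h2 Z \<sigma> w wZ s_def])
    fix k
    show "(\<Sum>j<k. \<integral>\<^sup>+x. ennreal (heat (s (Suc j)) Z x * (2 * (s (Suc j) - s j) * heat_grad_sq (s (Suc j)) h x)) \<partial>lborel) \<le> ?Q"
      using heat_grad_sq_weighted_sum[OF r h2 Z s00 s1, of k] Q0
      by (meson add_increasing order_trans zero_le order_refl add_mono)
  qed auto
qed

text \<open>At \<open>p = 2\<close> the Bellman exponent \<open>r\<close> becomes 1 and its dual
  exponent infinite. With weight 1, however, Bessel's inequality alone telescopes: it is the energy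
  identity of the heat equation in the form of an inequality.\<close>

lemma heat_grad_sq_L2:
  fixes h :: "real^'n \<Rightarrow> 'v::{real_inner, banach, second_countable_topology}"
  assumes [measurable]: "h \<in> borel_measurable borel"
    and h: "(\<integral>\<^sup>+y. ennreal (norm (h y) powr 2) \<partial>lborel) < \<infinity>" and \<sigma>: "0 < \<sigma>"
  shows "(\<integral>\<^sup>+\<tau>\<in>{2 * \<sigma><..}. (\<integral>\<^sup>+x. ennreal (heat_grad_sq \<tau> h x) \<partial>lborel) \<partial>lborel)
     \<le> ennreal (6 * 3 powr (real CARD('n) / 2)) * (\<integral>\<^sup>+y. ennreal (norm (h y) powr 2) \<partial>lborel)"
proof -
  have h2: "heat_admissible2 h" by (intro heat_admissible2_Lp[OF _ _ h]) auto
  define s where "s j = (3 / 2) ^ j * \<sigma>" for j :: nat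
  have s0: "0 < s k" for k using \<sigma> by (simp add: s_def)
  have s1: "0 < s (Suc k) - s k" for k using \<sigma> by (simp add: s_def)
  have Z: "heat_admissible (\<lambda>_::real^'n. 1::real)" by (rule heat_admissible_bounded[of _ 1]) auto
  have one: "heat t (\<lambda>_::real^'n. 1::real) x = 1" if "0 < t" for t x
    using heat_kernel_integral[OF that, where 'n='n, THEN has_bochner_integral_lborel_reflect, of x]
    by (simp add: heat_def has_bochner_integral_iff)
  let ?I = "\<lambda>k. \<integral>\<^sup>+x. ennreal ((norm (heat (s k) h x))\<^sup>2) \<partial>lborel"
  let ?J = "\<lambda>j. \<integral>\<^sup>+x. ennreal (2 * (s (Suc j) - s j) * heat_grad_sq (s (Suc j)) h x) \<partial>lborel"
  have tele: "?I k + (\<Sum>j<k. ?J j) \<le> ?I 0" for k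
  proof (induction k)
    case (Suc k)
    define t where "t = s (Suc k) - s k"
    have t: "0 < t" using s1 by (simp add: t_def)
    have st: "t + s k = s (Suc k)" by (simp add: t_def)
    note a = heat_admissible2_heat[OF h2 s0[of k]]
    have e1: "heat t (heat (s k) h) x = heat (s (Suc k)) h x" for x
      using heat_heat[OF heat_admissible2_imp[OF h2] t s0] by (simp add: st)
    have e3: "heat_grad_sq t (heat (s k) h) x = heat_grad_sq (s (Suc k)) h x" for x
      using heat_heat_deriv(2)[OF heat_admissible2_imp[OF h2] t s0] by (simp add: heat_grad_sq_def st)
    have "?I (Suc k) + ?J k = (\<integral>\<^sup>+x. ennreal ((norm (heat (s (Suc k)) h x))\<^sup>2 + 2 * t * heat_grad_sq (s (Suc k)) h x) \<partial>lborel)"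
      using t by (subst nn_integral_add[symmetric]) (auto simp: t_def)
    also have "\<dots> \<le> (\<integral>\<^sup>+x. heat_nn t (\<lambda>y. ennreal ((norm (heat (s k) h y))\<^sup>2)) x \<partial>lborel)"
    proof (rule nn_integral_mono)
      fix x
      show "ennreal ((norm (heat (s (Suc k)) h x))\<^sup>2 + 2 * t * heat_grad_sq (s (Suc k)) h x)
        \<le> heat_nn t (\<lambda>y. ennreal ((norm (heat (s k) h y))\<^sup>2)) x"
        using ennreal_leI[OF heat_grad_sq_Bessel[OF a t, of x, unfolded e1 e3]]
          ennreal_heat[OF heat_admissible_square[OF a] t, of x] by (simp add: add.commute)
    qed
    also have "\<dots> = ?I k" by (rule nn_integral_heat_nn[OF _ t]) measurable
    finally have "?I (Suc k) + ?J k \<le> ?I k" .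
    then have "?I (Suc k) + (\<Sum>j<Suc k. ?J j) \<le> ?I k + (\<Sum>j<k. ?J j)"
      by (simp add: add.assoc[symmetric] add_right_mono add.commute[of "sum _ _"])
    then show ?case using Suc by (rule order_trans)
  qed simp
  have "?I 0 \<le> (\<integral>\<^sup>+x. heat_nn (s 0) (\<lambda>y. ennreal ((norm (h y))\<^sup>2)) x \<partial>lborel)"
    by (intro nn_integral_mono norm_heat_sq_le h2 s0)
  also have "\<dots> = (\<integral>\<^sup>+y. ennreal (norm (h y) powr 2) \<partial>lborel)"
    using s0 by (subst nn_integral_heat_nn) (auto simp: powr_numeral)
  finally have I0: "?I 0 \<le> (\<integral>\<^sup>+y. ennreal (norm (h y) powr 2) \<partial>lborel)" .
  have "(\<integral>\<^sup>+\<tau>\<in>{2 * \<sigma><..}. (\<integral>\<^sup>+x. 1 * ennreal (heat_grad_sq \<tau> h x) \<partial>lborel) \<partial>lborel)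
     \<le> ennreal (6 * 3 powr (real CARD('n) / 2)) * (\<integral>\<^sup>+y. ennreal (norm (h y) powr 2) \<partial>lborel)"
  proof (rule heat_grad_sq_weighted_integral[OF h2 Z _ \<sigma> _ _ s_def])
    fix k
    show "(\<Sum>j<k. \<integral>\<^sup>+x. ennreal (heat (s (Suc j)) (\<lambda>_. 1) x * (2 * (s (Suc j) - s j) * heat_grad_sq (s (Suc j)) h x)) \<partial>lborel)
      \<le> (\<integral>\<^sup>+y. ennreal (norm (h y) powr 2) \<partial>lborel)"
      using tele[of k] I0 by (simp add: one[OF s0]) (meson add_increasing order_trans zero_le order_refl)
  qed (use \<sigma> in \<open>auto intro!: ennreal_leI\<close>)
  then show ?thesis by simp
qed

subsection \<open>Reduction of the \<open>L\<^bsub>1/H\<^esub>\<close>-valued estimate to a single initial datum\<close>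

lemma heat_grad_sq_scaleR: "heat_grad_sq t (\<lambda>y. c *\<^sub>R h y) x = c\<^sup>2 * heat_grad_sq t h x"
proof -
  have "heat_deriv t i (\<lambda>y. c *\<^sub>R h y) x = c *\<^sub>R heat_deriv t i h x" for i
    unfolding heat_deriv_def by (simp only: scaleR_left_commute[of _ c] integral_scaleR_right)
  then show ?thesis by (simp add: heat_grad_sq_def power_mult_distrib sum_distrib_left)
qed

lemma heat_grad_sq_AE_0:
  fixes h :: "real^'n \<Rightarrow> 'v::{banach, second_countable_topology}"
  assumes [measurable]: "h \<in> borel_measurable borel" and h: "AE y in lborel. h y = 0"
  shows "heat_grad_sq t h x = 0"
proof -
  have "heat_deriv t i h x = (\<integral>y. 0 \<partial>(lborel :: (real^'n) measure))" for i
    unfolding heat_deriv_def by (rule Bochner_Integration.integral_cong_AE) (use h in auto)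
  then show ?thesis by (simp add: heat_grad_sq_def)
qed

text \<open>Jensen's inequality for the probability density \<open>\<parallel>f(\<cdot>,\<theta>)\<parallel>\<^sub>p\<^bsup>1/H\<^esup> / \<kappa>\<close> in \<open>\<theta>\<close>, after rescaling every
  \<open>f(\<cdot>,\<theta>)\<close> to have \<open>L\<^sub>p\<close>-norm \<open>\<kappa>\<^bsup>H\<^esup>\<close>. It puts a Hilbert space norm in the place of the one of
  \<open>L\<^bsub>1/H\<^esub>\<close> without changing the right-hand side.\<close>

lemma weighted_integral_Lq_valued:
  fixes f :: "real^'n \<Rightarrow> real \<Rightarrow> 'v::{real_inner, banach, second_countable_topology}" and w :: "real \<Rightarrow> real^'n \<Rightarrow> ennreal"
  assumes f: "(\<lambda>(y, \<theta>). f y \<theta>) \<in> borel_measurable (borel \<Otimes>\<^sub>M borel)"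
    and w [measurable]: "case_prod w \<in> borel_measurable (borel \<Otimes>\<^sub>M borel)"
    and p: "2 \<le> p" and H: "1 / 2 < H"
    and \<kappa>: "\<kappa> = (\<integral>\<^sup>+\<theta>. (\<integral>\<^sup>+y. ennreal (norm (f y \<theta>) powr p) \<partial>lborel) epowr (1 / (p * H)) \<partial>lborel)" "\<kappa> < \<infinity>"
    and B: "\<And>h :: real^'n \<Rightarrow> 'v. h \<in> borel_measurable borel \<Longrightarrow> (\<integral>\<^sup>+y. ennreal (norm (h y) powr p) \<partial>lborel) < \<infinity> \<Longrightarrow>
      (\<integral>\<^sup>+\<tau>\<in>T. (\<integral>\<^sup>+x. w \<tau> x * ennreal (heat_grad_sq \<tau> h x) \<partial>lborel) \<partial>lborel) \<le> A * (\<integral>\<^sup>+y. ennreal (norm (h y) powr p) \<partial>lborel) + Q"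
    and T [measurable]: "T \<in> sets borel"
  shows "(\<integral>\<^sup>+\<tau>\<in>T. (\<integral>\<^sup>+x. w \<tau> x * (\<integral>\<^sup>+\<theta>. ennreal (heat_grad_sq \<tau> (\<lambda>y. f y \<theta>) x) epowr (1 / (2 * H)) \<partial>lborel) epowr (2 * H) \<partial>lborel) \<partial>lborel)
    \<le> A * \<kappa> epowr (p * H) + Q"
proof -
  have [measurable (raw)]: "(\<lambda>z. f (a z) (b z)) \<in> borel_measurable M"
    if "a \<in> borel_measurable M" "b \<in> borel_measurable M" for a b and M :: "'z measure"
    using measurable_compose[OF measurable_Pair[OF that] f] by simp
  define N where "N \<theta> = (\<integral>\<^sup>+y. ennreal (norm (f y \<theta>) powr p) \<partial>lborel)" for \<theta>
  have [measurable]: "N \<in> borel_measurable borel" unfolding N_def by measurable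
  have \<kappa>N: "\<kappa> = (\<integral>\<^sup>+\<theta>. N \<theta> epowr (1 / (p * H)) \<partial>lborel)" by (simp add: \<kappa>(1) N_def)
  have pH: "0 < p * H" using p H by simp
  have Nfin: "AE \<theta> in lborel. N \<theta> \<noteq> \<infinity>"
  proof -
    have "AE \<theta> in lborel. N \<theta> epowr (1 / (p * H)) \<noteq> \<infinity>"
      by (rule nn_integral_noteq_infinite) (use \<kappa>(2) in \<open>auto simp: \<kappa>N\<close>)
    then show ?thesis by simp
  qed
  define G where "G \<theta> \<tau> x = ennreal (heat_grad_sq \<tau> (\<lambda>y. f y \<theta>) x)" for \<theta> \<tau> x
  have [measurable (raw)]: "(\<lambda>z. G (a z) (b z) (c z)) \<in> borel_measurable M"
    if [measurable]: "a \<in> borel_measurable M" "b \<in> borel_measurable M" "c \<in> borel_measurable M" for a b c and M :: "'z measure"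
    unfolding G_def by measurable
  have N0: "G \<theta> \<tau> x = 0" if "N \<theta> = 0" for \<theta> \<tau> x
  proof -
    have "AE y in lborel. ennreal (norm (f y \<theta>) powr p) = 0"
      using that unfolding N_def by (subst (asm) nn_integral_0_iff_AE) auto
    then have "AE y in lborel. f y \<theta> = 0" by eventually_elim (simp add: powr_eq_0_iff)
    then show ?thesis unfolding G_def by (subst heat_grad_sq_AE_0) auto
  qed
  show ?thesis
  proof (cases "\<kappa> = 0")
    case True
    then have "AE \<theta> in lborel. N \<theta> = 0"
      unfolding \<kappa>N by (subst (asm) nn_integral_0_iff_AE) auto
    then have "(\<integral>\<^sup>+\<theta>. G \<theta> \<tau> x epowr (1 / (2 * H)) \<partial>lborel) = 0" for \<tau> x
      by (subst nn_integral_0_iff_AE) (auto elim!: eventually_mono simp: N0)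
    then show ?thesis by (simp add: G_def[symmetric])
  next
    case False
    obtain \<kappa>' where \<kappa>': "\<kappa> = ennreal \<kappa>'" "0 < \<kappa>'"
      using \<kappa>(2) False by (cases \<kappa>) (auto simp: less_le)
    define k where "k \<theta> = ennreal (1 / \<kappa>') * N \<theta> epowr (1 / (p * H))" for \<theta>
    have [measurable]: "k \<in> borel_measurable borel" unfolding k_def by measurable
    have k1: "(\<integral>\<^sup>+\<theta>. k \<theta> \<partial>lborel) = 1"
      unfolding k_def using \<kappa>' by (simp add: nn_integral_cmult \<kappa>N[symmetric] ennreal_mult[symmetric])
    \<comment> \<open>Scaling by \<open>c \<theta>\<close> gives \<open>f(.,\<theta>)\<close> the
      norm \<open>\<kappa>' powr H\<close>. The conventions for \<open>enn2real\<close> and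
      \<open>powr\<close> make \<open>c \<theta>\<close> zero where \<open>N \<theta>\<close> is 0
      or infinite: in the first case \<open>G\<close> vanishes, the second is a null set.\<close>
    define c where "c \<theta> = \<kappa>' powr H * enn2real (N \<theta>) powr (- 1 / p)" for \<theta>
    have [measurable]: "c \<in> borel_measurable borel" unfolding c_def by measurable
    have c0: "0 \<le> c \<theta>" for \<theta> by (simp add: c_def)
    have eq: "AE \<theta> in lborel. \<forall>\<tau> x. G \<theta> \<tau> x epowr (1 / (2 * H)) = k \<theta> * (ennreal ((c \<theta>)\<^sup>2) * G \<theta> \<tau> x) epowr (1 / (2 * H))"
      using Nfin
    proof eventually_elim
      fix \<theta> assume "N \<theta> \<noteq> \<infinity>"
      then obtain n where n: "N \<theta> = ennreal n" "0 \<le> n" by (cases "N \<theta>") auto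
      show "\<forall>\<tau> x. G \<theta> \<tau> x epowr (1 / (2 * H)) = k \<theta> * (ennreal ((c \<theta>)\<^sup>2) * G \<theta> \<tau> x) epowr (1 / (2 * H))"
      proof (cases "n = 0")
        case True
        then show ?thesis using N0[of \<theta>] n by simp
      next
        case False
        then have n0: "0 < n" using n by simp
        have cn: "c \<theta> = \<kappa>' powr H * n powr (- 1 / p)" using n by (simp add: c_def)
        have "((c \<theta>)\<^sup>2) powr (1 / (2 * H)) = (c \<theta> powr 2) powr (1 / (2 * H))"
          using c0[of \<theta>] by (simp add: powr_numeral)
        also have "\<dots> = c \<theta> powr (1 / H)" using H by (simp only: powr_powr) simp
        also have "\<dots> = \<kappa>' * n powr (- 1 / (p * H))"
          unfolding cn using \<kappa>' n0 H p by (simp add: powr_mult powr_powr)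
        finally have e: "((c \<theta>)\<^sup>2) powr (1 / (2 * H)) = \<kappa>' * n powr (- 1 / (p * H))" .
        have "k \<theta> * ennreal ((c \<theta>)\<^sup>2) epowr (1 / (2 * H)) = ennreal (1 / \<kappa>' * n powr (1 / (p * H)) * (\<kappa>' * n powr (- 1 / (p * H))))"
          unfolding k_def n(1) using n \<kappa>' by (simp add: epowr_ennreal e ennreal_mult[symmetric])
        moreover have "1 / \<kappa>' * n powr (1 / (p * H)) * (\<kappa>' * n powr (- 1 / (p * H))) = n powr (1 / (p * H) + (- 1 / (p * H)))"
          unfolding powr_add using \<kappa>' by simp
        ultimately have "k \<theta> * ennreal ((c \<theta>)\<^sup>2) epowr (1 / (2 * H)) = 1" using n0 by simp
        then show ?thesis by (simp add: epowr_mult mult.assoc[symmetric])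
      qed
    qed
    have Jen: "(\<integral>\<^sup>+\<theta>. G \<theta> \<tau> x epowr (1 / (2 * H)) \<partial>lborel) epowr (2 * H) \<le> (\<integral>\<^sup>+\<theta>. k \<theta> * (ennreal ((c \<theta>)\<^sup>2) * G \<theta> \<tau> x) \<partial>lborel)" for \<tau> x
    proof -
      have "(\<integral>\<^sup>+\<theta>. G \<theta> \<tau> x epowr (1 / (2 * H)) \<partial>lborel) = (\<integral>\<^sup>+\<theta>. k \<theta> * (ennreal ((c \<theta>)\<^sup>2) * G \<theta> \<tau> x) epowr (1 / (2 * H)) \<partial>lborel)"
        by (rule nn_integral_cong_AE) (use eq in \<open>auto elim!: eventually_mono\<close>)
      also have "\<dots> epowr (2 * H) \<le> (\<integral>\<^sup>+\<theta>. k \<theta> * ((ennreal ((c \<theta>)\<^sup>2) * G \<theta> \<tau> x) epowr (1 / (2 * H))) epowr (2 * H) \<partial>lborel)"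
        using H by (intro epowr_Jensen k1) auto
      also have "\<dots> = (\<integral>\<^sup>+\<theta>. k \<theta> * (ennreal ((c \<theta>)\<^sup>2) * G \<theta> \<tau> x) \<partial>lborel)"
        using H by (simp add: epowr_inverse)
      finally show ?thesis .
    qed
    \<comment> \<open>All rescaled data satisfy the same norm bound, so the estimate for one datum
      has the same right-hand side for every \<theta>; integrating against the density
      \<open>k\<close> of mass 1 keeps it.\<close>
    have Bc: "(\<integral>\<^sup>+\<tau>\<in>T. (\<integral>\<^sup>+x. w \<tau> x * (ennreal ((c \<theta>)\<^sup>2) * G \<theta> \<tau> x) \<partial>lborel) \<partial>lborel) \<le> A * \<kappa> epowr (p * H) + Q" for \<theta>
    proof -
      let ?h = "\<lambda>y. c \<theta> *\<^sub>R f y \<theta>"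
      have "(\<integral>\<^sup>+y. ennreal (norm (?h y) powr p) \<partial>lborel) = (\<integral>\<^sup>+y. ennreal (c \<theta> powr p) * ennreal (norm (f y \<theta>) powr p) \<partial>lborel)"
        using c0 by (intro nn_integral_cong) (simp add: powr_mult ennreal_mult)
      also have "\<dots> = ennreal (c \<theta> powr p) * N \<theta>"
        unfolding N_def by (rule nn_integral_cmult) measurable
      also have "\<dots> \<le> \<kappa> epowr (p * H)"
      proof (cases "N \<theta>")
        case top
        then have "c \<theta> = 0" by (simp add: c_def)
        then show ?thesis using p by simp
      next
        case (real n)
        show ?thesis
        proof (cases "n = 0")
          case False
          then have "0 < n" using real by simp
          then have "c \<theta> powr p * n = \<kappa>' powr (p * H) * (n powr (- 1) * n powr 1)"
            using real p \<kappa>' by (simp add: c_def powr_mult powr_powr mult.commute)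
          also have "n powr (- 1) * n powr 1 = 1" using \<open>0 < n\<close> by (simp only: powr_add[symmetric]) simp
          finally show ?thesis using real \<kappa>' by (simp add: epowr_ennreal ennreal_mult[symmetric])
        qed (use real in simp)
      qed
      finally have le: "(\<integral>\<^sup>+y. ennreal (norm (?h y) powr p) \<partial>lborel) \<le> \<kappa> epowr (p * H)" .
      have "\<kappa> epowr (p * H) < \<infinity>" using \<kappa>(2) by (simp add: less_top[symmetric])
      then have "(\<integral>\<^sup>+\<tau>\<in>T. (\<integral>\<^sup>+x. w \<tau> x * ennreal (heat_grad_sq \<tau> ?h x) \<partial>lborel) \<partial>lborel) \<le> A * (\<integral>\<^sup>+y. ennreal (norm (?h y) powr p) \<partial>lborel) + Q"
        using le by (intro B) (auto intro: le_less_trans)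
      also have "\<dots> \<le> A * \<kappa> epowr (p * H) + Q" by (intro add_right_mono mult_left_mono le) auto
      finally show ?thesis unfolding G_def heat_grad_sq_scaleR by (simp add: ennreal_mult)
    qed
    have "(\<integral>\<^sup>+\<tau>\<in>T. (\<integral>\<^sup>+x. w \<tau> x * (\<integral>\<^sup>+\<theta>. G \<theta> \<tau> x epowr (1 / (2 * H)) \<partial>lborel) epowr (2 * H) \<partial>lborel) \<partial>lborel)
      \<le> (\<integral>\<^sup>+\<tau>\<in>T. (\<integral>\<^sup>+x. w \<tau> x * (\<integral>\<^sup>+\<theta>. k \<theta> * (ennreal ((c \<theta>)\<^sup>2) * G \<theta> \<tau> x) \<partial>lborel) \<partial>lborel) \<partial>lborel)"
      by (intro nn_integral_mono mult_right_mono mult_left_mono Jen) auto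
    also have "\<dots> = (\<integral>\<^sup>+\<tau>. \<integral>\<^sup>+x. \<integral>\<^sup>+\<theta>. k \<theta> * (indicator T \<tau> * (w \<tau> x * (ennreal ((c \<theta>)\<^sup>2) * G \<theta> \<tau> x))) \<partial>lborel \<partial>lborel \<partial>lborel)"
      by (simp add: nn_integral_cmult[symmetric] nn_integral_multc[symmetric] mult_ac)
    also have "\<dots> = (\<integral>\<^sup>+\<tau>. \<integral>\<^sup>+\<theta>. \<integral>\<^sup>+x. k \<theta> * (indicator T \<tau> * (w \<tau> x * (ennreal ((c \<theta>)\<^sup>2) * G \<theta> \<tau> x))) \<partial>lborel \<partial>lborel \<partial>lborel)"
      by (intro nn_integral_cong lborel_pair.Fubini') measurable
    also have "\<dots> = (\<integral>\<^sup>+\<theta>. \<integral>\<^sup>+\<tau>. \<integral>\<^sup>+x. k \<theta> * (indicator T \<tau> * (w \<tau> x * (ennreal ((c \<theta>)\<^sup>2) * G \<theta> \<tau> x))) \<partial>lborel \<partial>lborel \<partial>lborel)"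
      by (rule lborel_pair.Fubini') measurable
    also have "\<dots> = (\<integral>\<^sup>+\<theta>. k \<theta> * (\<integral>\<^sup>+\<tau>\<in>T. (\<integral>\<^sup>+x. w \<tau> x * (ennreal ((c \<theta>)\<^sup>2) * G \<theta> \<tau> x) \<partial>lborel) \<partial>lborel) \<partial>lborel)"
      by (simp add: nn_integral_cmult mult.commute[of _ "indicator T _"])
    also have "\<dots> \<le> (\<integral>\<^sup>+\<theta>. k \<theta> * (A * \<kappa> epowr (p * H) + Q) \<partial>lborel)"
      by (intro nn_integral_mono mult_left_mono Bc) auto
    also have "\<dots> = A * \<kappa> epowr (p * H) + Q" by (simp add: nn_integral_multc k1)
    finally show ?thesis unfolding G_def .
  qed
qed

section \<open>The square function of a time-dependent datum\<close>

definition square_function :: "real \<Rightarrow> (real \<Rightarrow> real^'n \<Rightarrow> real \<Rightarrow> 'v::{banach, second_countable_topology}) \<Rightarrow> real \<Rightarrow> real^'n \<Rightarrow> ennreal" where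
  "square_function H f t x = (\<integral>\<^sup>+s\<in>{..<t}.
     (\<integral>\<^sup>+\<theta>. ennreal (heat_grad_sq (t - s) (\<lambda>y. f s y \<theta>) x) epowr (1 / (2 * H)) \<partial>lborel) epowr (2 * H) \<partial>lborel)"

definition mixed_norm :: "real \<Rightarrow> real \<Rightarrow> (real \<Rightarrow> real^'n \<Rightarrow> real \<Rightarrow> 'v::real_normed_vector) \<Rightarrow> ennreal" where
  "mixed_norm p H f = (\<integral>\<^sup>+s. (\<integral>\<^sup>+\<theta>. (\<integral>\<^sup>+y. ennreal (norm (f s y \<theta>) powr p) \<partial>lborel) epowr (1 / (p * H)) \<partial>lborel) epowr (p * H) \<partial>lborel)"

lemma measurable_curry3:
  assumes "(\<lambda>(s, y, \<theta>). f s y \<theta>) \<in> borel_measurable (borel \<Otimes>\<^sub>M borel \<Otimes>\<^sub>M borel)"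
    and "a \<in> borel_measurable M" "b \<in> borel_measurable M" "c \<in> borel_measurable M"
  shows "(\<lambda>z. f (a z) (b z) (c z)) \<in> borel_measurable M"
  using measurable_compose[OF measurable_Pair[OF assms(2) measurable_Pair[OF assms(3,4)]] assms(1)] by simp

lemma borel_measurable_square_function:
  fixes f :: "real \<Rightarrow> real^'n \<Rightarrow> real \<Rightarrow> 'v::{banach, second_countable_topology}"
  assumes f: "(\<lambda>(s, y, \<theta>). f s y \<theta>) \<in> borel_measurable (borel \<Otimes>\<^sub>M borel \<Otimes>\<^sub>M borel)"
    and [measurable]: "a \<in> borel_measurable M" "b \<in> borel_measurable M"
  shows "(\<lambda>z. square_function H f (a z) (b z)) \<in> borel_measurable M"
proof -
  note [measurable (raw)] = measurable_curry3[OF f]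
  have e: "(\<lambda>z. square_function H f (a z) (b z)) = (\<lambda>z. (\<integral>\<^sup>+s. (\<integral>\<^sup>+\<theta>. ennreal (heat_grad_sq (a z - s) (\<lambda>y. f s y \<theta>) (b z)) epowr (1 / (2 * H)) \<partial>lborel) epowr (2 * H) * (if s < a z then 1 else 0) \<partial>lborel))"
    unfolding square_function_def by (intro ext nn_integral_cong) (auto simp: indicator_def)
  show ?thesis unfolding e by measurable
qed

text \<open>For fixed \<open>s\<close> the substitution \<open>t = s + \<tau>\<close> exhibits a
  single datum \<open>f s\<close> under the heat flow, with the weight shifted by \<open>s\<close>.
  The estimate for one datum is available for \<open>\<tau> > 2 * \<sigma>\<close> only; its
  additive term \<open>Q\<close> may vary with \<open>s\<close> and \<sigma>, but its integral is
  bounded uniformly in \<sigma>.\<close>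

lemma square_function_weighted:
  fixes f :: "real \<Rightarrow> real^'n \<Rightarrow> real \<Rightarrow> 'v::{real_inner, banach, second_countable_topology}" and w :: "real \<Rightarrow> real^'n \<Rightarrow> ennreal"
  assumes f: "(\<lambda>(s, y, \<theta>). f s y \<theta>) \<in> borel_measurable (borel \<Otimes>\<^sub>M borel \<Otimes>\<^sub>M borel)"
    and w [measurable]: "case_prod w \<in> borel_measurable (borel \<Otimes>\<^sub>M borel)"
    and p: "2 \<le> p" and H: "1 / 2 < H" and fin: "mixed_norm p H f < \<infinity>"
    and B: "\<And>\<sigma> s (h :: real^'n \<Rightarrow> 'v). 0 < \<sigma> \<Longrightarrow> h \<in> borel_measurable borel \<Longrightarrow> (\<integral>\<^sup>+y. ennreal (norm (h y) powr p) \<partial>lborel) < \<infinity> \<Longrightarrow>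
      (\<integral>\<^sup>+\<tau>\<in>{2 * \<sigma><..}. (\<integral>\<^sup>+x. w (s + \<tau>) x * ennreal (heat_grad_sq \<tau> h x) \<partial>lborel) \<partial>lborel) \<le> A * (\<integral>\<^sup>+y. ennreal (norm (h y) powr p) \<partial>lborel) + Q \<sigma> s"
    and Q [measurable]: "\<And>\<sigma>. Q \<sigma> \<in> borel_measurable borel" and QR: "\<And>\<sigma>. 0 < \<sigma> \<Longrightarrow> (\<integral>\<^sup>+s. Q \<sigma> s \<partial>lborel) \<le> R"
  shows "(\<integral>\<^sup>+x. \<integral>\<^sup>+t. w t x * square_function H f t x \<partial>lborel \<partial>lborel) \<le> A * mixed_norm p H f + R"
proof -
  note [measurable (raw)] = measurable_curry3[OF f]
  define \<kappa> where "\<kappa> s = (\<integral>\<^sup>+\<theta>. (\<integral>\<^sup>+y. ennreal (norm (f s y \<theta>) powr p) \<partial>lborel) epowr (1 / (p * H)) \<partial>lborel)" for s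
  have [measurable]: "\<kappa> \<in> borel_measurable borel" unfolding \<kappa>_def by measurable
  have mixed: "mixed_norm p H f = (\<integral>\<^sup>+s. \<kappa> s epowr (p * H) \<partial>lborel)" by (simp add: mixed_norm_def \<kappa>_def)
  have \<kappa>fin: "AE s in lborel. \<kappa> s < \<infinity>"
  proof -
    have "AE s in lborel. \<kappa> s epowr (p * H) \<noteq> \<infinity>"
      by (rule nn_integral_noteq_infinite) (use fin in \<open>auto simp: mixed\<close>)
    then show ?thesis by (simp add: less_top[symmetric])
  qed
  define I where "I s \<tau> x = (\<integral>\<^sup>+\<theta>. ennreal (heat_grad_sq \<tau> (\<lambda>y. f s y \<theta>) x) epowr (1 / (2 * H)) \<partial>lborel) epowr (2 * H)" for s \<tau> x
  have [measurable (raw)]: "(\<lambda>z. I (a z) (b z) (c z)) \<in> borel_measurable M"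
    if [measurable]: "a \<in> borel_measurable M" "b \<in> borel_measurable M" "c \<in> borel_measurable M" for a b c and M :: "'z measure"
    unfolding I_def by measurable
  define J where "J s \<tau> = (\<integral>\<^sup>+x. w (s + \<tau>) x * I s \<tau> x \<partial>lborel)" for s \<tau>
  have [measurable (raw)]: "(\<lambda>z. J (a z) (b z)) \<in> borel_measurable M"
    if [measurable]: "a \<in> borel_measurable M" "b \<in> borel_measurable M" for a b and M :: "'z measure"
    unfolding J_def by measurable
  have "(\<integral>\<^sup>+x. \<integral>\<^sup>+t. w t x * square_function H f t x \<partial>lborel \<partial>lborel) =
     (\<integral>\<^sup>+x. \<integral>\<^sup>+t. \<integral>\<^sup>+s. w t x * (I s (t - s) x * (if s < t then 1 else 0)) \<partial>lborel \<partial>lborel \<partial>lborel)"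
    unfolding square_function_def I_def[symmetric]
    by (intro nn_integral_cong) (subst nn_integral_cmult[symmetric], auto intro!: nn_integral_cong simp: indicator_def)
  also have "\<dots> = (\<integral>\<^sup>+x. \<integral>\<^sup>+s. \<integral>\<^sup>+t. w t x * (I s (t - s) x * (if s < t then 1 else 0)) \<partial>lborel \<partial>lborel \<partial>lborel)"
    by (intro nn_integral_cong lborel_pair.Fubini') measurable
  also have "\<dots> = (\<integral>\<^sup>+x. \<integral>\<^sup>+s. \<integral>\<^sup>+\<tau>. w (s + \<tau>) x * (I s \<tau> x * indicator {0<..} \<tau>) \<partial>lborel \<partial>lborel \<partial>lborel)"
  proof (rule nn_integral_cong, rule nn_integral_cong)
    fix x s
    show "(\<integral>\<^sup>+t. w t x * (I s (t - s) x * (if s < t then 1 else 0)) \<partial>lborel) = (\<integral>\<^sup>+\<tau>. w (s + \<tau>) x * (I s \<tau> x * indicator {0<..} \<tau>) \<partial>lborel)"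
      by (subst nn_integral_shift[symmetric, of _ s]) (auto simp: indicator_def add.commute intro!: nn_integral_cong)
  qed
  also have "\<dots> = (\<integral>\<^sup>+s. \<integral>\<^sup>+x. \<integral>\<^sup>+\<tau>. w (s + \<tau>) x * (I s \<tau> x * indicator {0<..} \<tau>) \<partial>lborel \<partial>lborel \<partial>lborel)"
    by (rule lborel_pair.Fubini') measurable
  also have "\<dots> = (\<integral>\<^sup>+s. \<integral>\<^sup>+\<tau>. \<integral>\<^sup>+x. w (s + \<tau>) x * (I s \<tau> x * indicator {0<..} \<tau>) \<partial>lborel \<partial>lborel \<partial>lborel)"
    by (intro nn_integral_cong lborel_pair.Fubini') measurable
  also have "\<dots> = (\<integral>\<^sup>+s. (\<integral>\<^sup>+\<tau>\<in>{0<..}. J s \<tau> \<partial>lborel) \<partial>lborel)"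
    unfolding J_def by (simp add: nn_integral_multc[symmetric] mult.assoc)
  finally have eq: "(\<integral>\<^sup>+x. \<integral>\<^sup>+t. w t x * square_function H f t x \<partial>lborel \<partial>lborel) = (\<integral>\<^sup>+s. (\<integral>\<^sup>+\<tau>\<in>{0<..}. J s \<tau> \<partial>lborel) \<partial>lborel)" .
  \<comment> \<open>The cut-off \<open>e m\<close> is \<open>2 * \<sigma>\<close> with
    \<open>\<sigma> = 1 / (m + 1)\<close>; monotone convergence in \<open>m\<close> removes
    it.\<close>
  define e where "e m = 2 * (1 / real (Suc m))" for m
  have e_mono: "e (Suc m) \<le> e m" for m by (simp add: e_def field_simps)
  have sup: "J s \<tau> * indicator {0<..} \<tau> = (SUP m. J s \<tau> * indicator {e m<..} \<tau>)" for s \<tau>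
  proof (rule antisym)
    show "J s \<tau> * indicator {0<..} \<tau> \<le> (SUP m. J s \<tau> * indicator {e m<..} \<tau>)"
    proof (cases "0 < \<tau>")
      case True
      then obtain m where "inverse (real (Suc m)) < \<tau> / 2" using reals_Archimedean[of "\<tau> / 2"] by auto
      then have "e m < \<tau>" by (simp add: e_def inverse_eq_divide)
      then show ?thesis using True by (intro SUP_upper2[of m]) auto
    qed simp
    have "0 < e m" for m by (simp add: e_def)
    then show "(SUP m. J s \<tau> * indicator {e m<..} \<tau>) \<le> J s \<tau> * indicator {0<..} \<tau>"
      by (intro SUP_least mult_left_mono) (auto simp: indicator_def intro: less_trans)
  qed
  have "(\<integral>\<^sup>+s. (\<integral>\<^sup>+\<tau>\<in>{0<..}. J s \<tau> \<partial>lborel) \<partial>lborel) = (\<integral>\<^sup>+s. (SUP m. \<integral>\<^sup>+\<tau>\<in>{e m<..}. J s \<tau> \<partial>lborel) \<partial>lborel)"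
    unfolding sup
  proof (intro nn_integral_cong nn_integral_monotone_convergence_SUP incseq_SucI le_funI mult_left_mono)
    fix m \<tau>
    show "indicator {e m<..} \<tau> \<le> (indicator {e (Suc m)<..} \<tau> :: ennreal)"
      using e_mono[of m] by (auto simp: indicator_def)
  qed auto
  also have "\<dots> = (SUP m. \<integral>\<^sup>+s. (\<integral>\<^sup>+\<tau>\<in>{e m<..}. J s \<tau> \<partial>lborel) \<partial>lborel)"
  proof (rule nn_integral_monotone_convergence_SUP)
    show "incseq (\<lambda>m s. \<integral>\<^sup>+\<tau>\<in>{e m<..}. J s \<tau> \<partial>lborel)"
    proof (intro incseq_SucI le_funI nn_integral_mono mult_left_mono)
      fix m \<tau>
      show "indicator {e m<..} \<tau> \<le> (indicator {e (Suc m)<..} \<tau> :: ennreal)"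
        using e_mono[of m] by (auto simp: indicator_def)
    qed auto
  qed measurable
  also have "\<dots> \<le> A * mixed_norm p H f + R"
  proof (rule SUP_least)
    fix m
    define \<sigma> where "\<sigma> = 1 / real (Suc m)"
    have \<sigma>: "0 < \<sigma>" "e m = 2 * \<sigma>" by (simp_all add: \<sigma>_def e_def)
    have "(\<integral>\<^sup>+s. (\<integral>\<^sup>+\<tau>\<in>{e m<..}. J s \<tau> \<partial>lborel) \<partial>lborel) \<le> (\<integral>\<^sup>+s. A * \<kappa> s epowr (p * H) + Q \<sigma> s \<partial>lborel)"
    proof (rule nn_integral_mono_AE)
      show "AE s in lborel. (\<integral>\<^sup>+\<tau>\<in>{e m<..}. J s \<tau> \<partial>lborel) \<le> A * \<kappa> s epowr (p * H) + Q \<sigma> s"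
        using \<kappa>fin
      proof eventually_elim
        fix s assume \<kappa>s: "\<kappa> s < \<infinity>"
        have "(\<lambda>(y, \<theta>). f s y \<theta>) \<in> borel_measurable (borel \<Otimes>\<^sub>M borel)" by measurable
        moreover have "(\<lambda>(\<tau>, x). w (s + \<tau>) x) \<in> borel_measurable (borel \<Otimes>\<^sub>M borel)" by measurable
        ultimately show "(\<integral>\<^sup>+\<tau>\<in>{e m<..}. J s \<tau> \<partial>lborel) \<le> A * \<kappa> s epowr (p * H) + Q \<sigma> s"
          unfolding J_def I_def \<sigma>(2)
          by (rule weighted_integral_Lq_valued[OF _ _ p H \<kappa>_def \<kappa>s B[OF \<sigma>(1)]]) auto
      qed
    qed
    also have "\<dots> = A * mixed_norm p H f + (\<integral>\<^sup>+s. Q \<sigma> s \<partial>lborel)"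
      by (simp add: nn_integral_add nn_integral_cmult mixed)
    also have "\<dots> \<le> A * mixed_norm p H f + R" by (intro add_left_mono QR \<sigma>)
    finally show "(\<integral>\<^sup>+s. (\<integral>\<^sup>+\<tau>\<in>{e m<..}. J s \<tau> \<partial>lborel) \<partial>lborel) \<le> A * mixed_norm p H f + R" .
  qed
  finally show ?thesis unfolding eq .
qed

lemma SUP_min_of_nat: "(SUP m. min x (of_nat m)) = (x :: ennreal)"
proof (rule antisym)
  show "x \<le> (SUP m. min x (of_nat m))"
  proof (cases x)
    case (real r)
    obtain m where "r \<le> real m" using real_arch_simple by blast
    then have "x \<le> of_nat m" using real by (simp add: ennreal_of_nat_eq_real_of_nat)
    then show ?thesis by (intro SUP_upper2[of m]) auto
  next
    case top
    then show ?thesis by (simp add: ennreal_SUP_of_nat_eq_top min_absorb2)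
  qed
qed (auto intro: SUP_least)

lemma square_function_L2:
  fixes f :: "real \<Rightarrow> real^'n \<Rightarrow> real \<Rightarrow> 'v::{real_inner, banach, second_countable_topology}"
  assumes f: "(\<lambda>(s, y, \<theta>). f s y \<theta>) \<in> borel_measurable (borel \<Otimes>\<^sub>M borel \<Otimes>\<^sub>M borel)"
    and H: "1 / 2 < H" and fin: "mixed_norm 2 H f < \<infinity>"
  shows "(\<integral>\<^sup>+x. \<integral>\<^sup>+t. square_function H f t x epowr (2 / 2) \<partial>lborel \<partial>lborel) \<le> ennreal (6 * 3 powr (real CARD('n) / 2)) * mixed_norm 2 H f"
proof -
  have "(\<integral>\<^sup>+x. \<integral>\<^sup>+t. 1 * square_function H f t x \<partial>lborel \<partial>lborel) \<le> ennreal (6 * 3 powr (real CARD('n) / 2)) * mixed_norm 2 H f + 0"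
    by (rule square_function_weighted[OF f _ _ H fin, where Q="\<lambda>_ _. 0"]) (use heat_grad_sq_L2[where 'n='n and 'v='v] in \<open>auto simp: powr_numeral\<close>)
  then show ?thesis by simp
qed

text \<open>The factor \<open>6 * 3 powr (d / 2)\<close> comes from the geometric sequence of times,
  the factors \<open>bell_const1\<close> and \<open>bell_const2\<close> from the growth of the
  Bellman function, and the last factor of \<open>gradient_const2\<close> from the maximal
  inequality at the exponent \<open>p / (p - 2)\<close>.\<close>

definition gradient_const1 :: "nat \<Rightarrow> real \<Rightarrow> real" where
  "gradient_const1 d p = 6 * 3 powr (real d / 2) * bell_const1 (p / 2)"
definition gradient_const2 :: "nat \<Rightarrow> real \<Rightarrow> real" where
  "gradient_const2 d p = 6 * 3 powr (real d / 2) * bell_const2 (p / 2) *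
     (2 * (2 * (p / (p - 2)) / (p / (p - 2) - 1)) powr (p / (p - 2)))"

text \<open>The majorant frozen in \<tau> is the time maximal function of the weight at
  \<open>s\<close>, with smallest scale \<open>2 * \<sigma>\<close>. It acts for each
  \<open>x\<close> separately, so Fubini reduces its norm bound to the inequality on the
  line.\<close>

lemma square_function_weighted_Lp:
  fixes f :: "real \<Rightarrow> real^'n \<Rightarrow> real \<Rightarrow> 'v::{real_inner, banach, second_countable_topology}" and w :: "real \<Rightarrow> real^'n \<Rightarrow> ennreal"
  assumes f: "(\<lambda>(s, y, \<theta>). f s y \<theta>) \<in> borel_measurable (borel \<Otimes>\<^sub>M borel \<Otimes>\<^sub>M borel)"
    and w [measurable]: "case_prod w \<in> borel_measurable (borel \<Otimes>\<^sub>M borel)"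
    and p: "2 < p" and H: "1 / 2 < H" and fin: "mixed_norm p H f < \<infinity>"
    and wL: "\<And>t x. w t x \<le> ennreal L" and wfin: "\<And>x. (\<integral>\<^sup>+t. w t x \<partial>lborel) < \<infinity>"
  shows "(\<integral>\<^sup>+x. \<integral>\<^sup>+t. w t x * square_function H f t x \<partial>lborel \<partial>lborel) \<le>
    ennreal (gradient_const1 CARD('n) p) * mixed_norm p H f + ennreal (gradient_const2 CARD('n) p) * (\<integral>\<^sup>+x. \<integral>\<^sup>+t. w t x epowr (p / (p - 2)) \<partial>lborel \<partial>lborel)"
proof -
  define q where "q = p / (p - 2)"
  have q: "1 < q" using p by (simp add: q_def)
  define c where "c = 6 * 3 powr (real CARD('n) / 2)"
  have c: "0 \<le> c" by (simp add: c_def)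
  have b: "0 \<le> bell_const1 (p / 2)" "0 \<le> bell_const2 (p / 2)" using p by (auto simp: bell_const1_def bell_const2_def)
  define Z where "Z \<sigma> s x = time_max (2 * \<sigma>) (\<lambda>t. w t x) s" for \<sigma> s x
  have [measurable (raw)]: "(\<lambda>z. Z \<sigma> (a z) (b z)) \<in> borel_measurable M"
    if [measurable]: "a \<in> borel_measurable M" "b \<in> borel_measurable M" for \<sigma> a b and M :: "'z measure"
    unfolding Z_def by measurable
  have ZL: "Z \<sigma> s x \<le> ennreal L" if "0 < \<sigma>" for \<sigma> s x
    unfolding Z_def using that by (intro time_max_le wL) auto
  have Zr: "ennreal (enn2real (Z \<sigma> s x)) = Z \<sigma> s x" if "0 < \<sigma>" for \<sigma> s x
    using ZL[OF that, of s x] by (intro ennreal_enn2real) (auto simp: less_top[symmetric] top_unique)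
  have Zadm: "heat_admissible (\<lambda>x. enn2real (Z \<sigma> s x))" if "0 < \<sigma>" for \<sigma> s
  proof (rule heat_admissible_bounded)
    show "\<bar>enn2real (Z \<sigma> s x)\<bar> \<le> max 0 L" for x
      using ZL[OF that, of s x] by (auto intro!: enn2real_leI simp: ennreal_max_0)
  qed measurable
  have "(\<integral>\<^sup>+x. \<integral>\<^sup>+t. w t x * square_function H f t x \<partial>lborel \<partial>lborel) \<le>
     ennreal (c * bell_const1 (p / 2)) * mixed_norm p H f +
     ennreal (c * bell_const2 (p / 2)) * (ennreal (2 * (2 * q / (q - 1)) powr q) * (\<integral>\<^sup>+x. \<integral>\<^sup>+t. w t x epowr q \<partial>lborel \<partial>lborel))"
  proof (rule square_function_weighted[OF f w _ H fin, where Q="\<lambda>\<sigma> s. ennreal (c * bell_const2 (p / 2)) * (\<integral>\<^sup>+x. Z \<sigma> s x epowr q \<partial>lborel)"])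
    show "2 \<le> p" using p by simp
    show "(\<lambda>s. ennreal (c * bell_const2 (p / 2)) * (\<integral>\<^sup>+x. Z \<sigma> s x epowr q \<partial>lborel)) \<in> borel_measurable borel" for \<sigma>
      by measurable
    fix \<sigma> :: real assume \<sigma>: "0 < \<sigma>"
    have "(\<integral>\<^sup>+s. ennreal (c * bell_const2 (p / 2)) * (\<integral>\<^sup>+x. Z \<sigma> s x epowr q \<partial>lborel) \<partial>lborel) =
      ennreal (c * bell_const2 (p / 2)) * (\<integral>\<^sup>+s. \<integral>\<^sup>+x. Z \<sigma> s x epowr q \<partial>lborel \<partial>lborel)"
      by (rule nn_integral_cmult) measurable
    also have "(\<integral>\<^sup>+s. \<integral>\<^sup>+x. Z \<sigma> s x epowr q \<partial>lborel \<partial>lborel) = (\<integral>\<^sup>+x. \<integral>\<^sup>+s. Z \<sigma> s x epowr q \<partial>lborel \<partial>lborel)"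
      by (rule lborel_pair.Fubini') measurable
    also have "\<dots> \<le> (\<integral>\<^sup>+x. ennreal (2 * (2 * q / (q - 1)) powr q) * (\<integral>\<^sup>+t. w t x epowr q \<partial>lborel) \<partial>lborel)"
      unfolding Z_def using \<sigma> by (intro nn_integral_mono time_max_strong_type[OF _ wL wfin q]) auto
    also have "\<dots> = ennreal (2 * (2 * q / (q - 1)) powr q) * (\<integral>\<^sup>+x. \<integral>\<^sup>+t. w t x epowr q \<partial>lborel \<partial>lborel)"
      by (rule nn_integral_cmult) measurable
    finally show "(\<integral>\<^sup>+s. ennreal (c * bell_const2 (p / 2)) * (\<integral>\<^sup>+x. Z \<sigma> s x epowr q \<partial>lborel) \<partial>lborel) \<le>
      ennreal (c * bell_const2 (p / 2)) * (ennreal (2 * (2 * q / (q - 1)) powr q) * (\<integral>\<^sup>+x. \<integral>\<^sup>+t. w t x epowr q \<partial>lborel \<partial>lborel))"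
      by (simp add: mult_left_mono)
    fix s and h :: "real^'n \<Rightarrow> 'v"
    assume [measurable]: "h \<in> borel_measurable borel" and h: "(\<integral>\<^sup>+y. ennreal (norm (h y) powr p) \<partial>lborel) < \<infinity>"
    have "(\<integral>\<^sup>+\<tau>\<in>{2 * \<sigma><..}. (\<integral>\<^sup>+x. w (s + \<tau>) x * ennreal (heat_grad_sq \<tau> h x) \<partial>lborel) \<partial>lborel)
      \<le> ennreal c * (ennreal (bell_const1 (p / 2)) * (\<integral>\<^sup>+y. ennreal (norm (h y) powr p) \<partial>lborel) +
        ennreal (bell_const2 (p / 2)) * (\<integral>\<^sup>+y. ennreal (enn2real (Z \<sigma> s y) powr (p / (p - 2))) \<partial>lborel))"
      unfolding c_def
    proof (rule heat_grad_sq_weighted_Lp[OF p _ h Zadm[OF \<sigma>] _ \<sigma>])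
      fix x R assume R: "2 * \<sigma> \<le> R"
      have "(\<integral>\<^sup>+\<tau>\<in>{0<..R}. w (s + \<tau>) x \<partial>lborel) \<le> ennreal (2 * R) * Z \<sigma> s x"
        unfolding Z_def using \<sigma> R by (intro nn_integral_le_time_max) auto
      also have "\<dots> = ennreal (2 * R * enn2real (Z \<sigma> s x))"
        using \<sigma> R by (simp add: Zr ennreal_mult)
      finally show "(\<integral>\<^sup>+\<tau>\<in>{0<..R}. w (s + \<tau>) x \<partial>lborel) \<le> ennreal (2 * R * enn2real (Z \<sigma> s x))" .
    qed auto
    also have "(\<integral>\<^sup>+y. ennreal (enn2real (Z \<sigma> s y) powr (p / (p - 2))) \<partial>lborel) = (\<integral>\<^sup>+x. Z \<sigma> s x epowr q \<partial>lborel)"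
      using Zr[OF \<sigma>] by (intro nn_integral_cong) (metis enn2real_nonneg epowr_ennreal q_def)
    also have "ennreal c * (ennreal (bell_const1 (p / 2)) * (\<integral>\<^sup>+y. ennreal (norm (h y) powr p) \<partial>lborel) +
        ennreal (bell_const2 (p / 2)) * (\<integral>\<^sup>+x. Z \<sigma> s x epowr q \<partial>lborel)) =
      ennreal (c * bell_const1 (p / 2)) * (\<integral>\<^sup>+y. ennreal (norm (h y) powr p) \<partial>lborel) + ennreal (c * bell_const2 (p / 2)) * (\<integral>\<^sup>+x. Z \<sigma> s x epowr q \<partial>lborel)"
      using b c by (simp add: distrib_left ennreal_mult mult.assoc)
    finally show "(\<integral>\<^sup>+\<tau>\<in>{2 * \<sigma><..}. (\<integral>\<^sup>+x. w (s + \<tau>) x * ennreal (heat_grad_sq \<tau> h x) \<partial>lborel) \<partial>lborel) \<le>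
      ennreal (c * bell_const1 (p / 2)) * (\<integral>\<^sup>+y. ennreal (norm (h y) powr p) \<partial>lborel) + ennreal (c * bell_const2 (p / 2)) * (\<integral>\<^sup>+x. Z \<sigma> s x epowr q \<partial>lborel)" .
  qed
  then show ?thesis
    using b c by (simp add: gradient_const1_def gradient_const2_def c_def[symmetric] q_def[symmetric] ennreal_mult mult.assoc)
qed

text \<open>Duality: the weight is a small multiple of \<open>F\<^bsup>p/2-1\<^esup>\<close>, truncated so that all integrals are finite.\<close>

lemma square_function_Lp:
  fixes f :: "real \<Rightarrow> real^'n \<Rightarrow> real \<Rightarrow> 'v::{real_inner, banach, second_countable_topology}"
  assumes f: "(\<lambda>(s, y, \<theta>). f s y \<theta>) \<in> borel_measurable (borel \<Otimes>\<^sub>M borel \<Otimes>\<^sub>M borel)"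
    and p: "2 < p" and H: "1 / 2 < H" and fin: "mixed_norm p H f < \<infinity>"
    and \<epsilon>: "0 < \<epsilon>" "gradient_const2 CARD('n) p * \<epsilon> powr (p / (p - 2)) \<le> \<epsilon> / 2"
  shows "(\<integral>\<^sup>+x. \<integral>\<^sup>+t. square_function H f t x epowr (p / 2) \<partial>lborel \<partial>lborel) \<le>
     ennreal (2 / \<epsilon> * gradient_const1 CARD('n) p) * mixed_norm p H f"
proof -
  note [measurable (raw)] = borel_measurable_square_function[OF f]
  let ?F = "square_function H f"
  define r where "r = p / 2"
  have r: "1 < r" using p by (simp add: r_def)
  define q where "q = p / (p - 2)"
  have rq: "(r - 1) * q = r" using p by (simp add: r_def q_def field_simps)
  \<comment> \<open>A space-time cut-off. Together with the truncation of the square function at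
    height \<open>m\<close> it makes \<open>I m\<close> finite.\<close>
  define K :: "nat \<Rightarrow> real \<Rightarrow> real^'n \<Rightarrow> ennreal" where "K m t x = (if \<bar>t\<bar> \<le> real m \<and> norm x \<le> real m then 1 else 0)" for m t x
  have [measurable (raw)]: "(\<lambda>z. K m (a z) (b z)) \<in> borel_measurable M"
    if [measurable]: "a \<in> borel_measurable M" "b \<in> borel_measurable M" for m a b and M :: "'z measure"
    unfolding K_def by measurable
  have K1: "K m t x epowr e = K m t x" "K m t x * K m t x = K m t x" for m t x e by (auto simp: K_def)
  have Kint: "(\<integral>\<^sup>+t. K m t x \<partial>lborel) \<le> ennreal (2 * real m) * indicator (cball (0 :: real^'n) (real m)) x" for m x
  proof -
    have "(\<integral>\<^sup>+t. K m t x \<partial>lborel) = (\<integral>\<^sup>+t. indicator (cball (0 :: real^'n) (real m)) x * indicator {- real m..real m} t \<partial>lborel)"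
      by (intro nn_integral_cong) (auto simp: K_def indicator_def)
    then show ?thesis by (simp add: nn_integral_cmult mult.commute)
  qed
  define M where "M m t x = min (?F t x) (of_nat m)" for m t x
  have [measurable (raw)]: "(\<lambda>z. M m (a z) (b z)) \<in> borel_measurable N"
    if [measurable]: "a \<in> borel_measurable N" "b \<in> borel_measurable N" for m a b and N :: "'z measure"
    unfolding M_def by measurable
  have Mm: "M m t x \<le> ennreal (real m)" for m t x by (simp add: M_def ennreal_of_nat_eq_real_of_nat)
  define I where "I m = (\<integral>\<^sup>+x. \<integral>\<^sup>+t. M m t x epowr r * K m t x \<partial>lborel \<partial>lborel)" for m
  have bound: "I m \<le> ennreal (2 / \<epsilon> * gradient_const1 CARD('n) p) * mixed_norm p H f" for m
  proof -
    \<comment> \<open>Since \<open>(r - 1) * q = r\<close>, the power \<open>q\<close> of this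
      weight is again a multiple of the integrand of \<open>I m\<close>. The factor \<epsilon>
      appears linearly on the left and to the power \<open>q > 1\<close> on the right.\<close>
    define w where "w t x = ennreal \<epsilon> * (M m t x epowr (r - 1) * K m t x)" for t x
    have Mr: "M m t x epowr a \<le> ennreal (real m powr a)" if "0 \<le> a" for a t x
      using epowr_mono[OF that Mm[of m t x]] by (simp add: epowr_ennreal)
    have wK: "w t x \<le> ennreal (\<epsilon> * real m powr (r - 1)) * K m t x" for t x
      unfolding w_def using \<epsilon> r Mr[of "r - 1" t x] by (auto simp: ennreal_mult mult.assoc intro!: mult_left_mono mult_right_mono)
    have wm: "case_prod w \<in> borel_measurable (borel \<Otimes>\<^sub>M borel)" unfolding w_def by measurable
    have A: "(\<integral>\<^sup>+x. \<integral>\<^sup>+t. w t x * ?F t x \<partial>lborel \<partial>lborel) \<le>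
      ennreal (gradient_const1 CARD('n) p) * mixed_norm p H f + ennreal (gradient_const2 CARD('n) p) * (\<integral>\<^sup>+x. \<integral>\<^sup>+t. w t x epowr (p / (p - 2)) \<partial>lborel \<partial>lborel)"
    proof (rule square_function_weighted_Lp[OF f wm p H fin])
      show "w t x \<le> ennreal (\<epsilon> * real m powr (r - 1))" for t x
        by (rule order_trans[OF wK]) (auto simp: K_def)
      fix x
      have "(\<integral>\<^sup>+t. w t x \<partial>lborel) \<le> (\<integral>\<^sup>+t. ennreal (\<epsilon> * real m powr (r - 1)) * K m t x \<partial>lborel)"
        by (intro nn_integral_mono wK)
      also have "\<dots> \<le> ennreal (\<epsilon> * real m powr (r - 1)) * (ennreal (2 * real m) * indicator (cball (0 :: real^'n) (real m)) x)"
        by (simp add: nn_integral_cmult mult_left_mono Kint)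
      also have "\<dots> < \<infinity>" by (auto simp: indicator_def ennreal_mult_less_top)
      finally show "(\<integral>\<^sup>+t. w t x \<partial>lborel) < \<infinity>" .
    qed
    have wq: "w t x epowr q = ennreal (\<epsilon> powr q) * (M m t x epowr r * K m t x)" for t x
      using \<epsilon> by (simp add: w_def epowr_mult epowr_epowr rq K1 epowr_ennreal)
    have "ennreal \<epsilon> * I m = (\<integral>\<^sup>+x. \<integral>\<^sup>+t. ennreal \<epsilon> * (M m t x epowr r * K m t x) \<partial>lborel \<partial>lborel)"
      unfolding I_def by (simp add: nn_integral_cmult)
    also have "\<dots> \<le> (\<integral>\<^sup>+x. \<integral>\<^sup>+t. w t x * ?F t x \<partial>lborel \<partial>lborel)"
    proof (intro nn_integral_mono)
      fix x t
      have "M m t x epowr r = M m t x epowr (r - 1) * M m t x"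
        using epowr_add[of "M m t x" "r - 1" 1] by simp
      also have "\<dots> \<le> M m t x epowr (r - 1) * ?F t x" by (intro mult_left_mono) (auto simp: M_def)
      finally have "K m t x * M m t x epowr r \<le> K m t x * (M m t x epowr (r - 1) * ?F t x)"
        by (rule mult_left_mono) simp
      then show "ennreal \<epsilon> * (M m t x epowr r * K m t x) \<le> w t x * ?F t x"
        unfolding w_def mult.assoc by (intro mult_left_mono) (auto simp: mult_ac)
    qed
    also note A
    also have "(\<integral>\<^sup>+x. \<integral>\<^sup>+t. w t x epowr (p / (p - 2)) \<partial>lborel \<partial>lborel) = ennreal (\<epsilon> powr q) * I m"
      unfolding q_def[symmetric] wq I_def by (simp add: nn_integral_cmult)
    finally have main: "ennreal \<epsilon> * I m \<le> ennreal (gradient_const1 CARD('n) p) * mixed_norm p H f + ennreal (gradient_const2 CARD('n) p) * (ennreal (\<epsilon> powr q) * I m)" .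
    have "I m \<le> (\<integral>\<^sup>+x. \<integral>\<^sup>+t. ennreal (real m powr r) * K m t x \<partial>lborel \<partial>lborel)"
      unfolding I_def using r Mr by (intro nn_integral_mono mult_right_mono) auto
    also have "\<dots> \<le> (\<integral>\<^sup>+x. ennreal (real m powr r) * (ennreal (2 * real m) * indicator (cball (0 :: real^'n) (real m)) x) \<partial>lborel)"
      by (intro nn_integral_mono) (simp add: nn_integral_cmult mult_left_mono Kint)
    also have "\<dots> = ennreal (real m powr r) * (ennreal (2 * real m) * emeasure lborel (cball (0 :: real^'n) (real m)))"
      unfolding mult.assoc[symmetric] by (rule nn_integral_cmult_indicator) simp
    also have "\<dots> < \<infinity>" using emeasure_lborel_cball_finite[of "0 :: real^'n" "real m"] by (simp add: ennreal_mult_less_top)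
    finally obtain i where i: "I m = ennreal i" "0 \<le> i" by (cases "I m") auto
    obtain n where n: "mixed_norm p H f = ennreal n" "0 \<le> n" using fin by (cases "mixed_norm p H f") auto
    have g: "0 \<le> gradient_const1 CARD('n) p" "0 \<le> gradient_const2 CARD('n) p"
      using p by (auto simp: gradient_const1_def gradient_const2_def bell_const1_def bell_const2_def)
    \<comment> \<open>All terms are finite now, and the choice of \<epsilon> makes the last one at
      most \<open>\<epsilon> / 2 * i\<close>, which is absorbed on the left. The resulting bound
      does not involve \<open>m\<close>.\<close>
    have "\<epsilon> * i \<le> gradient_const1 CARD('n) p * n + gradient_const2 CARD('n) p * (\<epsilon> powr q * i)"
      using main i n g \<epsilon> by (simp add: ennreal_mult[symmetric] ennreal_plus[symmetric] del: ennreal_plus)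
    also have "gradient_const2 CARD('n) p * (\<epsilon> powr q * i) \<le> \<epsilon> / 2 * i"
      using mult_right_mono[OF \<epsilon>(2) i(2)] by (simp add: q_def mult.assoc)
    finally have "\<epsilon> * i \<le> gradient_const1 CARD('n) p * n + \<epsilon> / 2 * i" by simp
    then have "i \<le> 2 / \<epsilon> * gradient_const1 CARD('n) p * n" using \<epsilon> by (simp add: field_simps)
    then show ?thesis using i n g \<epsilon> by (simp add: ennreal_mult[symmetric] ennreal_leI)
  qed
  have sup: "?F t x epowr r = (SUP m. M m t x epowr r * K m t x)" for t x
  proof -
    have "(SUP m. M m t x * K m t x) = ?F t x"
    proof (rule antisym)
      show "(SUP m. M m t x * K m t x) \<le> ?F t x"
        by (intro SUP_least) (auto simp: K_def M_def)
      obtain k where k: "max \<bar>t\<bar> (norm x) \<le> real k" using real_arch_simple by blast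
      have "?F t x = (SUP m. M m t x)" unfolding M_def by (rule SUP_min_of_nat[symmetric])
      also have "\<dots> \<le> (SUP m. M m t x * K m t x)"
      proof (rule SUP_mono)
        fix m
        have "K (max m k) t x = 1" using k by (auto simp: K_def)
        moreover have "M m t x \<le> M (max m k) t x" unfolding M_def by (intro min.mono) auto
        ultimately show "\<exists>m'\<in>UNIV. M m t x \<le> M m' t x * K m' t x" by (intro bexI[of _ "max m k"]) auto
      qed
      finally show "?F t x \<le> (SUP m. M m t x * K m t x)" .
    qed
    then have "?F t x epowr r = (SUP m. M m t x * K m t x) epowr r" by simp
    also have "\<dots> = (SUP m. M m t x epowr r * K m t x)" using r by (simp add: SUP_epowr epowr_mult K1)
    finally show ?thesis .
  qed
  have inc: "M m t x epowr r * K m t x \<le> M (Suc m) t x epowr r * K (Suc m) t x" for m t x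
    using r by (intro mult_mono epowr_mono) (auto simp: M_def K_def min_le_iff_disj ennreal_of_nat_eq_real_of_nat intro: order_trans)
  have "(\<integral>\<^sup>+x. \<integral>\<^sup>+t. ?F t x epowr r \<partial>lborel \<partial>lborel) = (\<integral>\<^sup>+x. (SUP m. \<integral>\<^sup>+t. M m t x epowr r * K m t x \<partial>lborel) \<partial>lborel)"
    unfolding sup by (intro nn_integral_cong nn_integral_monotone_convergence_SUP incseq_SucI le_funI inc) measurable
  also have "\<dots> = (SUP m. I m)"
    unfolding I_def by (intro nn_integral_monotone_convergence_SUP incseq_SucI le_funI nn_integral_mono inc) measurable
  also have "\<dots> \<le> ennreal (2 / \<epsilon> * gradient_const1 CARD('n) p) * mixed_norm p H f"
    by (intro SUP_least bound)
  finally show ?thesis by (simp add: r_def)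
qed

lemma square_function_estimate:
  assumes p: "2 \<le> p"
  obtains N where "0 < N"
    "\<And>H (f :: real \<Rightarrow> real^'n \<Rightarrow> real \<Rightarrow> 'v::{real_inner, banach, second_countable_topology}).
      1 / 2 < H \<Longrightarrow> (\<lambda>(s, y, \<theta>). f s y \<theta>) \<in> borel_measurable (borel \<Otimes>\<^sub>M borel \<Otimes>\<^sub>M borel) \<Longrightarrow> mixed_norm p H f < \<infinity> \<Longrightarrow>
      (\<integral>\<^sup>+x. \<integral>\<^sup>+t. square_function H f t x epowr (p / 2) \<partial>lborel \<partial>lborel) \<le> ennreal N * mixed_norm p H f"
proof (cases "p = 2")
  case True
  show ?thesis
  proof (rule that)
    show "0 < 6 * 3 powr (real CARD('n) / 2)" by simp
  qed (use square_function_L2 True in auto)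
next
  case False
  then have p: "2 < p" using p by simp
  define q where "q = p / (p - 2)"
  have q: "1 < q" using p by (simp add: q_def)
  let ?c1 = "gradient_const1 CARD('n) p" and ?c2 = "gradient_const2 CARD('n) p"
  have g1: "0 < ?c1" using p by (auto simp: gradient_const1_def bell_const1_def)
  have g2: "0 \<le> ?c2" using p by (auto simp: gradient_const2_def bell_const2_def)
  \<comment> \<open>Chosen so that \<open>\<epsilon> powr (q - 1) = 1 / (2 * ?c2 + 1)\<close>,
    whence \<open>?c2 * \<epsilon> powr q \<le> \<epsilon> / 2\<close>; the summand 1 keeps the
    denominator positive.\<close>
  define \<epsilon> where "\<epsilon> = (1 / (2 * ?c2 + 1)) powr (1 / (q - 1))"
  have \<epsilon>: "0 < \<epsilon>" using g2 by (simp add: \<epsilon>_def)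
  have "\<epsilon> powr (q - 1) = 1 / (2 * ?c2 + 1)" using q g2 by (simp add: \<epsilon>_def powr_powr)
  moreover have "\<epsilon> powr q = \<epsilon> powr (q - 1) * \<epsilon>" using powr_add[of \<epsilon> "q - 1" 1] \<epsilon> by simp
  ultimately have "?c2 * \<epsilon> powr q = ?c2 / (2 * ?c2 + 1) * \<epsilon>" by simp
  also have "\<dots> \<le> 1 / 2 * \<epsilon>" using g2 \<epsilon> by (intro mult_right_mono) (auto simp: divide_simps)
  finally have \<epsilon>q: "?c2 * \<epsilon> powr (p / (p - 2)) \<le> \<epsilon> / 2" by (simp add: q_def)
  show ?thesis
    by (rule that[of "2 / \<epsilon> * ?c1"]) (use g1 \<epsilon> square_function_Lp[OF _ p _ _ \<epsilon> \<epsilon>q] in auto)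
qed

subsection \<open>The strong integral\<close>

text \<open>A strongly measurable function is only an almost everywhere limit of simple functions,
  so the norm of \<open>g - s\<close> need not be measurable. The lower limit is a measurable
  version, on which integrals are additive.\<close>

lemma strongly_measurable_norm_diff:
  fixes g :: "'a \<Rightarrow> 'b::real_normed_vector"
  assumes g: "strongly_measurable M g" and s: "simple_function M s"
  obtains u where "u \<in> borel_measurable M" "AE x in M. ennreal (norm (g x - s x)) = u x"
proof -
  obtain \<sigma> where \<sigma>: "\<And>i::nat. simple_function M (\<sigma> i)" "AE x in M. (\<lambda>i. \<sigma> i x) \<longlonglongrightarrow> g x"
    using g unfolding strongly_measurable_def by blast
  have [measurable]: "(\<lambda>x. ennreal (norm (\<sigma> i x - s x))) \<in> borel_measurable M" for i
    by (intro borel_measurable_simple_function simple_function_compose2[where h="\<lambda>a b. ennreal (norm (a - b))"] \<sigma> s)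
  show ?thesis
  proof
    show "(\<lambda>x. liminf (\<lambda>i. ennreal (norm (\<sigma> i x - s x)))) \<in> borel_measurable M" by measurable
    show "AE x in M. ennreal (norm (g x - s x)) = liminf (\<lambda>i. ennreal (norm (\<sigma> i x - s x)))"
      using \<sigma>(2)
    proof eventually_elim
      fix x assume "(\<lambda>i. \<sigma> i x) \<longlonglongrightarrow> g x"
      then have "(\<lambda>i. ennreal (norm (\<sigma> i x - s x))) \<longlonglongrightarrow> ennreal (norm (g x - s x))"
        by (intro tendsto_intros)
      then show "ennreal (norm (g x - s x)) = liminf (\<lambda>i. ennreal (norm (\<sigma> i x - s x)))"
        by (intro lim_imp_Liminf[symmetric]) auto
    qed
  qed
qed

text \<open>Gives the description operator in \<open>strong_integral\<close> its meaning. The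
  triangle inequality is integrated for the measurable versions \<open>u\<close> and
  \<open>u'\<close>, since additivity is not at hand for the norms themselves.\<close>

lemma has_strong_integral_unique:
  fixes g :: "'a \<Rightarrow> 'b::real_normed_vector"
  assumes "has_strong_integral M g v" "has_strong_integral M g v'"
  shows "v = v'"
proof -
  note sb = Bochner_Integration.simple_bochner_integrable.cases
  have g: "strongly_measurable M g" using assms(1) by (simp add: has_strong_integral_def)
  obtain s where s: "\<And>i::nat. Bochner_Integration.simple_bochner_integrable M (s i)"
    "(\<lambda>i. \<integral>\<^sup>+x. ennreal (norm (g x - s i x)) \<partial>M) \<longlonglongrightarrow> 0"
    "(\<lambda>i. Bochner_Integration.simple_bochner_integral M (s i)) \<longlonglongrightarrow> v"
    using assms(1) unfolding has_strong_integral_def by blast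
  obtain s' where s': "\<And>i::nat. Bochner_Integration.simple_bochner_integrable M (s' i)"
    "(\<lambda>i. \<integral>\<^sup>+x. ennreal (norm (g x - s' i x)) \<partial>M) \<longlonglongrightarrow> 0"
    "(\<lambda>i. Bochner_Integration.simple_bochner_integral M (s' i)) \<longlonglongrightarrow> v'"
    using assms(2) unfolding has_strong_integral_def by blast
  let ?I = "Bochner_Integration.simple_bochner_integral M"
  have b: "ennreal (norm (?I (s i) - ?I (s' i))) \<le> (\<integral>\<^sup>+x. ennreal (norm (g x - s i x)) \<partial>M) + (\<integral>\<^sup>+x. ennreal (norm (g x - s' i x)) \<partial>M)" for i
  proof -
    have sf: "simple_function M (s i)" "simple_function M (s' i)" using s(1) s'(1) by (auto elim: sb)
    obtain u where u: "u \<in> borel_measurable M" "AE x in M. ennreal (norm (g x - s i x)) = u x"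
      by (rule strongly_measurable_norm_diff[OF g sf(1)])
    obtain u' where u': "u' \<in> borel_measurable M" "AE x in M. ennreal (norm (g x - s' i x)) = u' x"
      by (rule strongly_measurable_norm_diff[OF g sf(2)])
    have "norm (?I (s i) - ?I (s' i)) = norm (?I (\<lambda>x. s i x - s' i x))"
      using s(1) s'(1) by (subst Bochner_Integration.simple_bochner_integral_diff) auto
    also have "\<dots> \<le> ?I (\<lambda>x. norm (s i x - s' i x))"
      using Bochner_Integration.simple_bochner_integrable_compose2[of "(-)" M "s i" "s' i"] s(1) s'(1)
      by (auto intro!: Bochner_Integration.simple_bochner_integral_norm_bound)
    finally have "ennreal (norm (?I (s i) - ?I (s' i))) \<le> ennreal (?I (\<lambda>x. norm (s i x - s' i x)))"
      by (rule ennreal_leI)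
    also have "\<dots> = (\<integral>\<^sup>+x. ennreal (norm (s i x - s' i x)) \<partial>M)"
      using Bochner_Integration.simple_bochner_integrable_compose2[of "\<lambda>x y. norm (x - y)" M "s i" "s' i"] s(1) s'(1)
      by (auto intro!: Bochner_Integration.simple_bochner_integral_eq_nn_integral)
    also have "\<dots> \<le> (\<integral>\<^sup>+x. u x + u' x \<partial>M)"
    proof (rule nn_integral_mono_AE)
      show "AE x in M. ennreal (norm (s i x - s' i x)) \<le> u x + u' x"
        using u(2) u'(2)
      proof eventually_elim
        fix x assume e: "ennreal (norm (g x - s i x)) = u x" "ennreal (norm (g x - s' i x)) = u' x"
        have "norm (s i x - s' i x) \<le> norm (g x - s i x) + norm (g x - s' i x)"
          by (metis dist_norm dist_triangle3 norm_minus_commute)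
        then show "ennreal (norm (s i x - s' i x)) \<le> u x + u' x"
          unfolding e[symmetric] by (simp add: ennreal_plus[symmetric] ennreal_leI del: ennreal_plus)
      qed
    qed
    also have "\<dots> = (\<integral>\<^sup>+x. u x \<partial>M) + (\<integral>\<^sup>+x. u' x \<partial>M)" by (rule nn_integral_add) fact+
    also have "\<dots> = (\<integral>\<^sup>+x. ennreal (norm (g x - s i x)) \<partial>M) + (\<integral>\<^sup>+x. ennreal (norm (g x - s' i x)) \<partial>M)"
      using u(2) u'(2) by (simp cong: nn_integral_cong_AE)
    finally show ?thesis .
  qed
  have "(\<lambda>i. ennreal (norm (?I (s i) - ?I (s' i)))) \<longlonglongrightarrow> ennreal (norm (v - v'))"
    by (intro tendsto_intros s s')
  moreover have "(\<lambda>i. ennreal (norm (?I (s i) - ?I (s' i)))) \<longlonglongrightarrow> 0"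
  proof (rule tendsto_sandwich[OF always_eventually always_eventually])
    show "(\<lambda>_. 0 :: ennreal) \<longlonglongrightarrow> 0" by simp
    show "(\<lambda>i. (\<integral>\<^sup>+x. ennreal (norm (g x - s i x)) \<partial>M) + (\<integral>\<^sup>+x. ennreal (norm (g x - s' i x)) \<partial>M)) \<longlonglongrightarrow> 0"
      using tendsto_add[OF s(2) s'(2)] by simp
  qed (auto intro!: b)
  ultimately have "ennreal (norm (v - v')) = 0" by (rule LIMSEQ_unique)
  then show ?thesis by simp
qed

lemma strong_integral_eq:
  assumes "has_strong_integral M g v" shows "strong_integral M g = v"
proof -
  have "(THE v. has_strong_integral M g v) = v"
  proof (rule the_equality)
    show "has_strong_integral M g v" by fact
    show "w = v" if "has_strong_integral M g w" for w using has_strong_integral_unique[OF that assms] .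
  qed
  then show ?thesis using assms by (auto simp: strong_integral_def)
qed

lemma strongly_measurable_cong_AE:
  assumes "strongly_measurable M g" "AE x in M. g x = g' x"
  shows "strongly_measurable M g'"
proof -
  obtain s where s: "\<And>i::nat. simple_function M (s i)" "AE x in M. (\<lambda>i. s i x) \<longlonglongrightarrow> g x"
    using assms(1) unfolding strongly_measurable_def by blast
  have "AE x in M. (\<lambda>i. s i x) \<longlonglongrightarrow> g' x" using s(2) assms(2) by eventually_elim simp
  with s(1) show ?thesis unfolding strongly_measurable_def by blast
qed

lemma has_strong_integral_cong_AE:
  assumes "has_strong_integral M g v" "AE x in M. g x = g' x"
  shows "has_strong_integral M g' v"
proof -
  have "(\<integral>\<^sup>+x. ennreal (norm (g x - s x)) \<partial>M) = (\<integral>\<^sup>+x. ennreal (norm (g' x - s x)) \<partial>M)" for s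
    by (rule nn_integral_cong_AE) (use assms(2) in \<open>auto elim: eventually_mono\<close>)
  then show ?thesis
    using assms strongly_measurable_cong_AE[OF _ assms(2)] unfolding has_strong_integral_def by auto
qed

lemma strongly_measurable_compose:
  assumes "strongly_measurable M g" and T: "\<And>x. isCont T x"
  shows "strongly_measurable M (\<lambda>x. T (g x))"
proof -
  obtain s where s: "\<And>i::nat. simple_function M (s i)" "AE x in M. (\<lambda>i. s i x) \<longlonglongrightarrow> g x"
    using assms(1) unfolding strongly_measurable_def by blast
  have "AE x in M. (\<lambda>i. T (s i x)) \<longlonglongrightarrow> T (g x)"
    using s(2) by eventually_elim (rule isCont_tendsto_compose[OF T])
  then show ?thesis unfolding strongly_measurable_def
    using simple_function_compose1[OF s(1), of T] by (intro exI[of _ "\<lambda>i x. T (s i x)"]) auto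
qed

lemma has_strong_integral_bounded_linear:
  fixes g :: "'a \<Rightarrow> 'b::real_normed_vector" and T :: "'b \<Rightarrow> 'c::real_normed_vector"
  assumes T: "bounded_linear T" and g: "has_strong_integral M g v"
  shows "has_strong_integral M (\<lambda>x. T (g x)) (T v)"
proof -
  interpret T: bounded_linear T by fact
  obtain K where K: "0 < K" "\<And>x. norm (T x) \<le> norm x * K" using T.pos_bounded by blast
  have gm: "strongly_measurable M g" using g by (simp add: has_strong_integral_def)
  obtain s where s: "\<And>i::nat. Bochner_Integration.simple_bochner_integrable M (s i)"
    "(\<lambda>i. \<integral>\<^sup>+x. ennreal (norm (g x - s i x)) \<partial>M) \<longlonglongrightarrow> 0"
    "(\<lambda>i. Bochner_Integration.simple_bochner_integral M (s i)) \<longlonglongrightarrow> v"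
    using g unfolding has_strong_integral_def by blast
  have b: "(\<integral>\<^sup>+x. ennreal (norm (T (g x) - T (s i x))) \<partial>M) \<le> ennreal K * (\<integral>\<^sup>+x. ennreal (norm (g x - s i x)) \<partial>M)" for i
  proof -
    have sf: "simple_function M (s i)" using s(1) by (auto elim: Bochner_Integration.simple_bochner_integrable.cases)
    obtain u where u: "u \<in> borel_measurable M" "AE x in M. ennreal (norm (g x - s i x)) = u x"
      by (rule strongly_measurable_norm_diff[OF gm sf])
    have "(\<integral>\<^sup>+x. ennreal (norm (T (g x) - T (s i x))) \<partial>M) \<le> (\<integral>\<^sup>+x. ennreal K * u x \<partial>M)"
    proof (rule nn_integral_mono_AE)
      show "AE x in M. ennreal (norm (T (g x) - T (s i x))) \<le> ennreal K * u x"
        using u(2)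
      proof eventually_elim
        fix x assume e: "ennreal (norm (g x - s i x)) = u x"
        have "norm (T (g x) - T (s i x)) \<le> K * norm (g x - s i x)"
          using K(2)[of "g x - s i x"] by (simp add: T.diff mult.commute)
        then show "ennreal (norm (T (g x) - T (s i x))) \<le> ennreal K * u x"
          unfolding e[symmetric] using K(1) by (simp add: ennreal_mult[symmetric] ennreal_leI)
      qed
    qed
    also have "\<dots> = ennreal K * (\<integral>\<^sup>+x. u x \<partial>M)" by (rule nn_integral_cmult) fact
    also have "(\<integral>\<^sup>+x. u x \<partial>M) = (\<integral>\<^sup>+x. ennreal (norm (g x - s i x)) \<partial>M)"
      using u(2) by (intro nn_integral_cong_AE) (auto elim: eventually_mono)
    finally show ?thesis .
  qed
  show ?thesis
    unfolding has_strong_integral_def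
  proof (intro conjI exI[of _ "\<lambda>i x. T (s i x)"] allI)
    show "strongly_measurable M (\<lambda>x. T (g x))"
      by (rule strongly_measurable_compose[OF gm linear_continuous_at[OF T]])
    show "Bochner_Integration.simple_bochner_integrable M (\<lambda>x. T (s i x))" for i
      using Bochner_Integration.simple_bochner_integrable_compose2[of "\<lambda>x y. T x" M "s i" "s i"] s(1) by (simp add: T.zero)
    show "(\<lambda>i. \<integral>\<^sup>+x. ennreal (norm (T (g x) - T (s i x))) \<partial>M) \<longlonglongrightarrow> 0"
    proof (rule tendsto_sandwich[OF always_eventually always_eventually])
      show "(\<lambda>_. 0 :: ennreal) \<longlonglongrightarrow> 0" by simp
      show "(\<lambda>i. ennreal K * (\<integral>\<^sup>+x. ennreal (norm (g x - s i x)) \<partial>M)) \<longlonglongrightarrow> 0"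
        using ennreal_tendsto_cmult[OF _ s(2), of "ennreal K"] by simp
    qed (auto intro!: b)
    have "Bochner_Integration.simple_bochner_integral M (\<lambda>x. T (s i x)) = T (Bochner_Integration.simple_bochner_integral M (s i))" for i
      using s(1) by (intro Bochner_Integration.simple_bochner_integral_linear T.linear)
    then show "(\<lambda>i. Bochner_Integration.simple_bochner_integral M (\<lambda>x. T (s i x))) \<longlonglongrightarrow> T v"
      using T.tendsto[OF s(3)] by simp
  qed
qed

lemma has_bochner_integral_imp_strong:
  fixes g :: "'a \<Rightarrow> 'b::{banach, second_countable_topology}"
  assumes g: "has_bochner_integral M g v"
  shows "has_strong_integral M g v"
proof -
  have [measurable]: "g \<in> borel_measurable M" by (rule borel_measurable_has_bochner_integral[OF g])
  obtain F where "\<And>i. simple_function M (F i)" "\<And>x. x \<in> space M \<Longrightarrow> (\<lambda>i. F i x) \<longlonglongrightarrow> g x"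
    using borel_measurable_implies_sequence_metric[of g M 0] by auto
  then have "strongly_measurable M g" unfolding strongly_measurable_def by (intro exI[of _ F]) auto
  moreover from g have "\<exists>s. (\<forall>i::nat. Bochner_Integration.simple_bochner_integrable M (s i)) \<and>
      (\<lambda>i. \<integral>\<^sup>+x. ennreal (norm (g x - s i x)) \<partial>M) \<longlonglongrightarrow> 0 \<and> (\<lambda>i. Bochner_Integration.simple_bochner_integral M (s i)) \<longlonglongrightarrow> v"
    by cases blast
  ultimately show ?thesis unfolding has_strong_integral_def by blast
qed

lemma strongly_measurable_imp_borel:
  fixes g :: "'a \<Rightarrow> 'b::{banach, second_countable_topology}"
  assumes "strongly_measurable M g"
  obtains g' where "g' \<in> borel_measurable M" "AE x in M. g x = g' x"
proof -
  obtain s where s: "\<And>i::nat. simple_function M (s i)" "AE x in M. (\<lambda>i. s i x) \<longlonglongrightarrow> g x"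
    using assms unfolding strongly_measurable_def by blast
  show ?thesis
  proof
    show "(\<lambda>x. lim (\<lambda>i. s i x)) \<in> borel_measurable M"
      by (rule borel_measurable_lim_metric) (rule borel_measurable_simple_function[OF s(1)])
    show "AE x in M. g x = lim (\<lambda>i. s i x)" using s(2) by eventually_elim (simp add: limI)
  qed
qed

subsection \<open>Differentiation of the heat semigroup\<close>

lemma exp_taylor2_bound: "\<bar>exp a - 1 - a\<bar> \<le> a\<^sup>2 * exp \<bar>a\<bar>" for a :: real
proof -
  obtain t where t: "\<bar>t\<bar> \<le> \<bar>a\<bar>" "exp a = (\<Sum>m<2. a ^ m / fact m) + exp t / fact 2 * a ^ 2"
    using Maclaurin_exp_le[of a 2] by blast
  have "exp a - 1 - a = exp t / 2 * a\<^sup>2" using t(2) by (simp add: numeral_2_eq_2)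
  moreover have "0 \<le> exp t / 2 * a\<^sup>2" by simp
  ultimately have "\<bar>exp a - 1 - a\<bar> = exp t / 2 * a\<^sup>2" by (simp only: abs_of_nonneg)
  also have "\<dots> \<le> exp \<bar>a\<bar> * a\<^sup>2"
  proof (rule mult_right_mono)
    have "exp t \<le> exp \<bar>a\<bar>" using t(1) by simp
    then show "exp t / 2 \<le> exp \<bar>a\<bar>" using exp_gt_zero[of t] by linarith
  qed simp
  finally show ?thesis by (simp add: mult.commute)
qed

text \<open>A quadratic remainder that is a multiple of the kernel at time \<open>2 * t\<close> can
  be integrated against every admissible function, so differentiation under the integral becomes an
  estimate instead of a limit theorem.\<close>

lemma heat_kernel_taylor:
  assumes t: "0 < t"
  obtains C where "0 \<le> C" "\<And>(z::real^'n) i r. \<bar>r\<bar> \<le> 1 \<Longrightarrow>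
    \<bar>heat_kernel t (z + r *\<^sub>R axis i 1) - heat_kernel t z - r * heat_kernel_deriv t i z\<bar> \<le> r\<^sup>2 * C * heat_kernel (2 * t) z"
proof
  define C where "C = (2 * exp (5 / (2 * t)) + 1 / (4 * t)) * 2 powr (real CARD('n) / 2)"
  show "0 \<le> C" using t by (simp add: C_def)
  fix z :: "real^'n" and i and r :: real assume r: "\<bar>r\<bar> \<le> 1"
  define \<rho> where "\<rho> = norm z"
  define a where "a = - (2 * r * z $ i + r\<^sup>2) / (4 * t)"
  \<comment> \<open>The increment of the exponent is \<open>a\<close>, and
    \<open>|a| \<le> |r| * y\<close> because \<open>|r| \<le> 1\<close>; thus \<open>y\<close>
    isolates the growth in \<open>norm z\<close>.\<close>
  define y where "y = (2 * \<rho> + 1) / (4 * t)"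
  have y0: "0 \<le> y" using t by (simp add: y_def \<rho>_def)
  have "(norm (z + r *\<^sub>R axis i 1))\<^sup>2 = (norm z)\<^sup>2 + 2 * r * z $ i + r\<^sup>2"
    unfolding power2_norm_eq_inner
    by (simp add: inner_add_left inner_add_right inner_axis inner_axis' inner_axis_axis power2_eq_square algebra_simps)
  then have n: "- (norm (z + r *\<^sub>R axis i 1))\<^sup>2 / (4 * t) = - (norm z)\<^sup>2 / (4 * t) + a"
    using t by (simp add: a_def field_simps)
  then have e1: "heat_kernel t (z + r *\<^sub>R axis i 1) = heat_kernel t z * exp a"
    unfolding heat_kernel_def n by (simp only: exp_add mult.assoc)
  have d: "r * heat_kernel_deriv t i z = heat_kernel t z * (a + r\<^sup>2 / (4 * t))"
    using t by (simp add: heat_kernel_deriv_def a_def field_simps)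
  have "heat_kernel t (z + r *\<^sub>R axis i 1) - heat_kernel t z - r * heat_kernel_deriv t i z =
      heat_kernel t z * ((exp a - 1 - a) - r\<^sup>2 / (4 * t))"
    unfolding e1 d by (simp add: algebra_simps)
  then have "\<bar>heat_kernel t (z + r *\<^sub>R axis i 1) - heat_kernel t z - r * heat_kernel_deriv t i z\<bar> =
      heat_kernel t z * \<bar>(exp a - 1 - a) - r\<^sup>2 / (4 * t)\<bar>" by (simp add: abs_mult)
  also have "\<dots> \<le> heat_kernel t z * (r\<^sup>2 * (2 * exp (2 * y) + 1 / (4 * t)))"
  proof (rule mult_left_mono)
    have "\<bar>2 * r * z $ i + r\<^sup>2\<bar> \<le> 2 * \<bar>r\<bar> * \<bar>z $ i\<bar> + \<bar>r\<bar> * \<bar>r\<bar>"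
      by (rule order_trans[OF abs_triangle_ineq]) (simp add: abs_mult power2_eq_square)
    also have "\<dots> \<le> 2 * \<bar>r\<bar> * \<rho> + \<bar>r\<bar> * 1"
      using r component_le_norm_cart[of z i] by (intro add_mono mult_left_mono) (auto simp: \<rho>_def)
    finally have "\<bar>2 * r * z $ i + r\<^sup>2\<bar> \<le> \<bar>r\<bar> * (2 * \<rho> + 1)" by (simp add: algebra_simps)
    then have ay: "\<bar>a\<bar> \<le> \<bar>r\<bar> * y"
      using t by (simp add: a_def y_def divide_right_mono)
    then have ay1: "\<bar>a\<bar> \<le> y" using r y0 mult_right_mono[OF r y0] by linarith
    have "a\<^sup>2 \<le> r\<^sup>2 * y\<^sup>2" using power_mono[OF ay, of 2] by (simp add: power_mult_distrib)
    also have "y\<^sup>2 \<le> 2 * exp y" using exp_lower_Taylor_quadratic[OF y0] y0 by simp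
    finally have a2: "a\<^sup>2 \<le> r\<^sup>2 * (2 * exp y)" by (simp add: mult_left_mono)
    have "\<bar>exp a - 1 - a\<bar> \<le> a\<^sup>2 * exp \<bar>a\<bar>" by (rule exp_taylor2_bound)
    also have "\<dots> \<le> (r\<^sup>2 * (2 * exp y)) * exp y" using ay1 by (intro mult_mono a2) auto
    also have "\<dots> = r\<^sup>2 * (2 * exp (2 * y))" by (simp add: exp_add[symmetric] mult.assoc)
    finally have "\<bar>exp a - 1 - a\<bar> \<le> r\<^sup>2 * (2 * exp (2 * y))" .
    moreover have "\<bar>r\<^sup>2 / (4 * t)\<bar> = r\<^sup>2 * (1 / (4 * t))" using t by simp
    ultimately have "\<bar>(exp a - 1 - a) - r\<^sup>2 / (4 * t)\<bar> \<le> r\<^sup>2 * (2 * exp (2 * y)) + r\<^sup>2 * (1 / (4 * t))"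
      using abs_triangle_ineq4[of "exp a - 1 - a" "r\<^sup>2 / (4 * t)"] by linarith
    then show "\<bar>(exp a - 1 - a) - r\<^sup>2 / (4 * t)\<bar> \<le> r\<^sup>2 * (2 * exp (2 * y) + 1 / (4 * t))"
      by (simp only: distrib_left)
  qed simp
  also have "\<dots> \<le> r\<^sup>2 * C * heat_kernel (2 * t) z"
  proof -
    define P where "P = (4 * pi * (2 * t)) powr (- real CARD('n) / 2)"
    have hp: "heat_kernel t z = 2 powr (real CARD('n) / 2) * P * exp (- \<rho>\<^sup>2 / (4 * t))"
    proof -
      have "(4 * pi * (2 * t)) = 2 * (4 * pi * t)" by simp
      then have "P = 2 powr (- (real CARD('n) / 2)) * (4 * pi * t) powr (- (real CARD('n) / 2))"
        using t by (simp only: P_def minus_divide_left[symmetric]) (subst powr_mult, auto)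
      then have "(4 * pi * t) powr (- (real CARD('n) / 2)) = 2 powr (real CARD('n) / 2) * P"
        by (simp add: powr_minus)
      then show ?thesis by (simp add: heat_kernel_def \<rho>_def)
    qed
    have h2: "heat_kernel (2 * t) z = P * exp (- \<rho>\<^sup>2 / (8 * t))"
      by (simp add: heat_kernel_def P_def \<rho>_def)
    have sp: "exp (- \<rho>\<^sup>2 / (4 * t)) = exp (- \<rho>\<^sup>2 / (8 * t)) * exp (- \<rho>\<^sup>2 / (8 * t))"
      using t by (simp add: exp_add[symmetric] field_simps)
    have "exp (- \<rho>\<^sup>2 / (8 * t)) * (2 * exp (2 * y) + 1 / (4 * t)) = 2 * exp (2 * y - \<rho>\<^sup>2 / (8 * t)) + exp (- \<rho>\<^sup>2 / (8 * t)) * (1 / (4 * t))"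
      by (simp add: distrib_left exp_diff exp_minus field_simps)
    also have "\<dots> \<le> 2 * exp (5 / (2 * t)) + 1 * (1 / (4 * t))"
    proof (intro add_mono mult_left_mono mult_right_mono)
      \<comment> \<open>Completing the square: the growth \<open>exp (2 * y)\<close> is beaten by
        half of the Gaussian exponent, and the maximum \<open>5 / (2 * t)\<close> is attained at
        \<open>\<rho> = 4\<close>.\<close>
      have "0 \<le> (\<rho> - 4)\<^sup>2 / (8 * t)" using t by simp
      also have "(\<rho> - 4)\<^sup>2 / (8 * t) = 5 / (2 * t) - (2 * y - \<rho>\<^sup>2 / (8 * t))"
        using t by (simp add: y_def power2_diff field_simps)
      finally show "exp (2 * y - \<rho>\<^sup>2 / (8 * t)) \<le> exp (5 / (2 * t))" by simp
      show "exp (- \<rho>\<^sup>2 / (8 * t)) \<le> 1" using t by simp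
    qed (use t in auto)
    finally have m: "exp (- \<rho>\<^sup>2 / (8 * t)) * (2 * exp (2 * y) + 1 / (4 * t)) \<le> 2 * exp (5 / (2 * t)) + 1 / (4 * t)" by simp
    have P0: "0 \<le> 2 powr (real CARD('n) / 2) * P * exp (- \<rho>\<^sup>2 / (8 * t)) * r\<^sup>2" by (simp add: P_def)
    have "heat_kernel t z * (r\<^sup>2 * (2 * exp (2 * y) + 1 / (4 * t))) =
       (2 powr (real CARD('n) / 2) * P * exp (- \<rho>\<^sup>2 / (8 * t)) * r\<^sup>2) * (exp (- \<rho>\<^sup>2 / (8 * t)) * (2 * exp (2 * y) + 1 / (4 * t)))"
      unfolding hp sp by (simp only: mult_ac)
    also have "\<dots> \<le> (2 powr (real CARD('n) / 2) * P * exp (- \<rho>\<^sup>2 / (8 * t)) * r\<^sup>2) * (2 * exp (5 / (2 * t)) + 1 / (4 * t))"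
      by (rule mult_left_mono[OF m P0])
    also have "\<dots> = r\<^sup>2 * C * heat_kernel (2 * t) z" unfolding h2 C_def by (simp only: mult_ac)
    finally show ?thesis .
  qed
  finally show "\<bar>heat_kernel t (z + r *\<^sub>R axis i 1) - heat_kernel t z - r * heat_kernel_deriv t i z\<bar> \<le> r\<^sup>2 * C * heat_kernel (2 * t) z" .
qed

text \<open>Integrating the Taylor bound against \<open>norm (h y)\<close> leaves a remainder of
  order \<open>r^2\<close>, with a Gaussian average at time \<open>2 * t\<close> as its
  constant.\<close>

lemma heat_has_vector_derivative:
  fixes h :: "real^'n \<Rightarrow> 'v::{banach, second_countable_topology}"
  assumes h: "heat_admissible h" and t: "0 < t"
  shows "((\<lambda>r. heat t h (x + r *\<^sub>R axis i 1)) has_vector_derivative heat_deriv t i h x) (at 0)"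
proof -
  note [measurable] = heat_admissibleD(1)[OF h]
  obtain C where C: "0 \<le> C" "\<And>(z::real^'n) i r. \<bar>r\<bar> \<le> 1 \<Longrightarrow>
    \<bar>heat_kernel t (z + r *\<^sub>R axis i 1) - heat_kernel t z - r * heat_kernel_deriv t i z\<bar> \<le> r\<^sup>2 * C * heat_kernel (2 * t) z"
    using heat_kernel_taylor[OF t, where 'n='n] by metis
  define B where "B = enn2real (heat_nn (2 * t) (\<lambda>y. ennreal (norm (h y))) x)"
  have B: "ennreal B = heat_nn (2 * t) (\<lambda>y. ennreal (norm (h y))) x"
    unfolding B_def using heat_admissibleD(2)[OF h, of "2 * t" x] t by (intro ennreal_enn2real) auto
  have B0: "0 \<le> B" by (simp add: B_def)
  let ?R = "\<lambda>r. heat t h (x + r *\<^sub>R axis i 1) - heat t h x - r *\<^sub>R heat_deriv t i h x"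
  have bound: "norm (?R r) \<le> r\<^sup>2 * (C * B)" if r: "\<bar>r\<bar> \<le> 1" for r
  proof -
    let ?k = "\<lambda>y. heat_kernel t (x + r *\<^sub>R axis i 1 - y) - heat_kernel t (x - y) - r * heat_kernel_deriv t i (x - y)"
    have i: "integrable lborel (\<lambda>y. ?k y *\<^sub>R h y)" "(\<integral>y. ?k y *\<^sub>R h y \<partial>lborel) = ?R r"
      using integrable_heat[OF h t] integrable_heat_deriv[OF h t]
      by (simp_all add: scaleR_diff_left heat_def heat_deriv_def scaleR_scaleR[symmetric] del: scaleR_scaleR)
    have "ennreal (norm (?R r)) \<le> (\<integral>\<^sup>+y. ennreal (norm (?k y *\<^sub>R h y)) \<partial>lborel)"
      using integral_norm_bound_ennreal[OF i(1)] by (simp add: i(2))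
    also have "\<dots> \<le> (\<integral>\<^sup>+y. ennreal (r\<^sup>2 * C) * (ennreal (heat_kernel (2 * t) (x - y)) * ennreal (norm (h y))) \<partial>lborel)"
    proof (rule nn_integral_mono)
      fix y
      have "x + r *\<^sub>R axis i 1 - y = (x - y) + r *\<^sub>R axis i 1" by simp
      then have "\<bar>?k y\<bar> \<le> r\<^sup>2 * C * heat_kernel (2 * t) (x - y)" using C(2)[OF r, of "x - y" i] by (simp only:)
      then have "norm (?k y *\<^sub>R h y) \<le> r\<^sup>2 * C * heat_kernel (2 * t) (x - y) * norm (h y)"
        by (simp add: mult_right_mono)
      then show "ennreal (norm (?k y *\<^sub>R h y)) \<le> ennreal (r\<^sup>2 * C) * (ennreal (heat_kernel (2 * t) (x - y)) * ennreal (norm (h y)))"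
        using C(1) by (simp add: ennreal_mult[symmetric] ennreal_leI mult.assoc)
    qed
    also have "\<dots> = ennreal (r\<^sup>2 * C) * ennreal B"
      unfolding B heat_nn_def by (rule nn_integral_cmult) measurable
    also have "\<dots> = ennreal (r\<^sup>2 * (C * B))"
      using C(1) B0 by (simp add: ennreal_mult[symmetric] mult.assoc)
    finally show ?thesis using C(1) B0 by (subst (asm) ennreal_le_iff) auto
  qed
  have lim: "((\<lambda>r. norm (?R r) / norm r) \<longlongrightarrow> 0) (at 0)"
  proof (rule tendsto_sandwich[where f="\<lambda>_. 0"])
    show "((\<lambda>r. \<bar>r\<bar> * (C * B)) \<longlongrightarrow> 0) (at 0)"
      by (rule tendsto_eq_intros | simp)+
    have "\<forall>\<^sub>F r in at (0::real). \<bar>r\<bar> < 1 \<and> r \<noteq> 0"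
      unfolding eventually_at by (intro exI[of _ 1]) (auto simp: dist_norm)
    then show "\<forall>\<^sub>F r in at 0. norm (?R r) / norm r \<le> \<bar>r\<bar> * (C * B)"
    proof eventually_elim
      fix r :: real assume r: "\<bar>r\<bar> < 1 \<and> r \<noteq> 0"
      then have "norm (?R r) \<le> r\<^sup>2 * (C * B)" by (intro bound) auto
      also have "\<dots> = \<bar>r\<bar> * (C * B) * norm r" by (simp add: power2_eq_square abs_mult_self_eq mult_ac)
      finally show "norm (?R r) / norm r \<le> \<bar>r\<bar> * (C * B)" using r by (simp add: divide_le_eq)
    qed
  qed (auto intro!: always_eventually)
  have "((\<lambda>r. ?R r /\<^sub>R norm r) \<longlongrightarrow> 0) (at 0)"
    by (rule tendsto_norm_zero_cancel) (use lim in \<open>simp add: divide_inverse mult.commute\<close>)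
  then show ?thesis
    unfolding has_vector_derivative_def has_derivative_at_within
    by (auto simp: bounded_linear_scaleR_left)
qed

lemma has_strong_integral_heat:
  fixes h :: "real^'n \<Rightarrow> 'v::{banach, second_countable_topology}"
  assumes h: "heat_admissible h" and t: "0 < t"
  shows "has_strong_integral lborel (\<lambda>y. heat_kernel t y *\<^sub>R h (x - y)) (heat t h x)"
proof -
  have "has_bochner_integral lborel (\<lambda>y. heat_kernel t (x - y) *\<^sub>R h y) (heat t h x)"
    using integrable_heat[OF h t, of x] by (simp add: heat_def has_bochner_integral_iff)
  from has_bochner_integral_lborel_reflect[OF this, of x] show ?thesis
    by (intro has_bochner_integral_imp_strong) simp
qed

text \<open>A contraction \<open>\<Psi>\<close> carries the formula for the gradient over to spaces that need not be separable.\<close>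

lemma gradient_heat_semigroup:
  fixes h :: "real^'n \<Rightarrow> 'v::{real_inner, banach, second_countable_topology}" and \<Psi> :: "'v \<Rightarrow> 'w::real_normed_vector"
  assumes h: "heat_admissible h" and t: "0 < t" and \<Psi>: "bounded_linear \<Psi>" and g: "AE y in lborel. g y = \<Psi> (h y)"
  shows "gradient (heat_semigroup t g) x = (\<chi> i. \<Psi> (heat_deriv t i h x))"
proof -
  interpret \<Psi>: bounded_linear \<Psi> by fact
  have e: "heat_semigroup t g x = \<Psi> (heat t h x)" for x
    unfolding heat_semigroup_def
  proof (rule strong_integral_eq, rule has_strong_integral_cong_AE)
    show "has_strong_integral lborel (\<lambda>y. \<Psi> (heat_kernel t y *\<^sub>R h (x - y))) (\<Psi> (heat t h x))"
      by (rule has_strong_integral_bounded_linear[OF \<Psi> has_strong_integral_heat[OF h t]])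
    show "AE y in lborel. \<Psi> (heat_kernel t y *\<^sub>R h (x - y)) = heat_kernel t y *\<^sub>R g (x - y)"
      using AE_lborel_reflect[OF g, of x] by eventually_elim (simp add: \<Psi>.scaleR)
  qed
  have "vector_derivative (\<lambda>r. \<Psi> (heat t h (x + r *\<^sub>R axis i 1))) (at 0) = \<Psi> (heat_deriv t i h x)" for i
    by (intro vector_derivative_at \<Psi>.has_vector_derivative heat_has_vector_derivative h t)
  then show ?thesis by (simp add: gradient_def e)
qed

subsection \<open>The space \<open>\<ell>\<^sub>2\<close> is separable\<close>

text \<open>The finitely supported rational sequences, a countable dense set. The resulting
  \<open>second_countable_topology\<close> instance makes Bochner integration applicable to
  functions with values in \<open>ell2\<close>.\<close>

definition ell2_rat :: "rat list \<Rightarrow> ell2" where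
  "ell2_rat l = Abs_ell2 (\<lambda>n. if n < length l then of_rat (l ! n) else 0)"

lemma Rep_ell2_rat: "Rep_ell2 (ell2_rat l) = (\<lambda>n. if n < length l then of_rat (l ! n) else 0)"
  unfolding ell2_rat_def
  by (rule Abs_ell2_inverse) (auto intro!: summable_finite[of "{..<length l}"] split: if_splits)

lemma ell2_rat_dense:
  assumes e: "0 < e" shows "\<exists>l. norm (x - ell2_rat l) < e"
proof -
  define c where "c = Rep_ell2 x"
  have sc: "summable (\<lambda>n. (c n)\<^sup>2)" unfolding c_def by (rule summable_ell2)
  obtain N where N: "norm (\<Sum>i. (c (i + N))\<^sup>2) < e\<^sup>2 / 2"
    using suminf_exist_split[OF _ sc, of "e\<^sup>2 / 2"] e by auto
  \<comment> \<open>The tail takes less than half of \<open>e^2\<close>. With this tolerance the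
    \<open>N\<close> leading coordinates contribute at most \<open>(e / 2)^2\<close>, by
    \<open>N \<le> (N + 1)^2\<close>.\<close>
  define \<delta> where "\<delta> = e / (2 * (real N + 1))"
  have \<delta>: "0 < \<delta>" using e by (simp add: \<delta>_def)
  have "\<exists>q::rat. c n - \<delta> < of_rat q \<and> of_rat q < c n + \<delta>" for n
    using \<delta> by (intro of_rat_dense) simp
  then obtain q :: "nat \<Rightarrow> rat" where q: "\<And>n. c n - \<delta> < of_rat (q n)" "\<And>n. of_rat (q n) < c n + \<delta>" by metis
  define l where "l = map q [0..<N]"
  have R: "Rep_ell2 (x - ell2_rat l) n = (if n < N then c n - of_rat (q n) else c n)" for n
    by (simp add: minus_ell2.rep_eq Rep_ell2_rat l_def c_def)
  have "(norm (x - ell2_rat l))\<^sup>2 = (\<Sum>n. (Rep_ell2 (x - ell2_rat l) (n + N))\<^sup>2) + (\<Sum>n<N. (Rep_ell2 (x - ell2_rat l) n)\<^sup>2)"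
    unfolding norm_ell2_sq by (rule suminf_split_initial_segment[OF summable_ell2])
  also have "\<dots> = (\<Sum>n. (c (n + N))\<^sup>2) + (\<Sum>n<N. (c n - of_rat (q n))\<^sup>2)"
    by (simp add: R)
  also have "(\<Sum>n<N. (c n - of_rat (q n))\<^sup>2) \<le> (\<Sum>n<N. \<delta>\<^sup>2)"
  proof (rule sum_mono)
    fix n
    have "\<bar>c n - of_rat (q n)\<bar> \<le> \<delta>" using q[of n] by linarith
    then show "(c n - of_rat (q n))\<^sup>2 \<le> \<delta>\<^sup>2" using abs_le_square_iff[of "c n - of_rat (q n)" \<delta>] \<delta> by simp
  qed
  also have "(\<Sum>n<N. \<delta>\<^sup>2) \<le> (real N + 1)\<^sup>2 * \<delta>\<^sup>2"
  proof -
    have "real N \<le> (real N + 1)\<^sup>2" by (simp add: power2_eq_square algebra_simps)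
    then show ?thesis by (simp add: mult_right_mono)
  qed
  also have "\<dots> = ((real N + 1) * \<delta>)\<^sup>2" by (simp only: power_mult_distrib)
  also have "(real N + 1) * \<delta> = e / 2" by (simp add: \<delta>_def field_simps)
  finally have "(norm (x - ell2_rat l))\<^sup>2 \<le> (\<Sum>n. (c (n + N))\<^sup>2) + (e / 2)\<^sup>2" by simp
  also have "\<dots> < e\<^sup>2"
  proof -
    have "(\<Sum>n. (c (n + N))\<^sup>2) < e\<^sup>2 / 2" using N by (simp add: abs_less_iff)
    moreover have "(e / 2)\<^sup>2 = e\<^sup>2 / 4" by (simp add: power_divide)
    moreover have "0 < e\<^sup>2" using e by simp
    ultimately show ?thesis by linarith
  qed
  finally have "norm (x - ell2_rat l) < e" using e by (simp add: power_less_imp_less_base)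
  then show ?thesis by blast
qed

instance ell2 :: second_countable_topology
proof
  let ?B = "range (\<lambda>(l, n). ball (ell2_rat l) (1 / real (Suc n)))"
  have "topological_basis ?B"
  proof (rule topological_basisI)
    fix O' and x :: ell2 assume "open O'" "x \<in> O'"
    then obtain e where e: "0 < e" "ball x e \<subseteq> O'" using open_contains_ball by blast
    obtain n where n: "1 / real (Suc n) < e / 2" using e(1) reals_Archimedean[of "e / 2"] by (auto simp: inverse_eq_divide)
    obtain l where l: "norm (x - ell2_rat l) < 1 / real (Suc n)" using ell2_rat_dense[of "1 / real (Suc n)" x] by auto
    have "ball (ell2_rat l) (1 / real (Suc n)) \<subseteq> ball x e"
    proof
      fix y assume "y \<in> ball (ell2_rat l) (1 / real (Suc n))"
      then have "dist (ell2_rat l) y < 1 / real (Suc n)" by simp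
      moreover have "dist x y \<le> dist x (ell2_rat l) + dist (ell2_rat l) y" by (rule dist_triangle)
      ultimately show "y \<in> ball x e" using l n by (simp add: dist_norm)
    qed
    then show "\<exists>B'\<in>?B. x \<in> B' \<and> B' \<subseteq> O'"
      using l e(2) by (intro bexI[of _ "ball (ell2_rat l) (1 / real (Suc n))"]) (auto simp: dist_norm norm_minus_commute)
  qed auto
  moreover have "countable ?B" by simp
  ultimately show "\<exists>B :: ell2 set set. countable B \<and> open = generate_topology B"
    by (intro exI[of _ ?B]) (auto intro: topological_basis_imp_subbasis)
qed

instance ell2 :: banach ..

subsection \<open>Borel representatives\<close>

lemma strongly_measurable_restrict_borel:
  fixes g :: "'a::euclidean_space \<Rightarrow> 'b::{banach, second_countable_topology}"
  assumes S: "S \<in> sets borel" and g: "strongly_measurable (restrict_space lborel S) g"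
  obtains g' where "g' \<in> borel_measurable borel" "AE z in lborel. z \<in> S \<longrightarrow> g z = g' z" "\<And>z. z \<notin> S \<Longrightarrow> g' z = 0"
proof -
  obtain g1 where g1: "g1 \<in> borel_measurable (restrict_space lborel S)" "AE z in restrict_space lborel S. g z = g1 z"
    using strongly_measurable_imp_borel[OF g] by metis
  show ?thesis
  proof
    show "(\<lambda>z. if z \<in> S then g1 z else 0) \<in> borel_measurable borel"
      using g1(1) S by (subst (asm) measurable_restrict_space_iff[of S lborel 0]) auto
    show "AE z in lborel. z \<in> S \<longrightarrow> g z = (if z \<in> S then g1 z else 0)"
      using g1(2) S by (subst (asm) AE_restrict_space_iff) (auto elim: eventually_mono)
  qed auto
qed

text \<open>The semigroup acts in \<open>y\<close> for fixed \<open>s\<close> and \<theta>, hence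
  this order of quantifiers. The exceptional set is first enlarged to a Borel null set, because
  exchanging \<open>AE\<close> in \<open>y\<close> and in \<theta> requires measurability.\<close>

lemma AE_lborel_swap:
  fixes P :: "(real \<times> (real^'n)) \<times> real \<Rightarrow> bool"
  assumes "AE z in lborel. P z"
  shows "AE s in lborel. AE \<theta> in lborel. AE y in lborel. P ((s, y), \<theta>)"
proof -
  obtain N where N: "{z \<in> space lborel. \<not> P z} \<subseteq> N" "emeasure lborel N = 0" "N \<in> sets lborel"
    using AE_E[OF assms] by blast
  have [measurable]: "N \<in> sets ((borel \<Otimes>\<^sub>M borel) \<Otimes>\<^sub>M borel)"
    using N(3) unfolding borel_prod by simp
  have "AE z in lborel. z \<notin> N" using N by (auto intro!: AE_not_in null_setsI)
  then have "AE z in lborel \<Otimes>\<^sub>M lborel. z \<notin> N" by (subst lborel_prod)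
  then have "AE u in lborel. AE \<theta> in lborel. (u, \<theta>) \<notin> N" by (rule lborel_pair.AE_pair)
  then have "AE u in lborel \<Otimes>\<^sub>M lborel. AE \<theta> in lborel. (u, \<theta>) \<notin> N" by (subst lborel_prod)
  then have "AE s in lborel. AE y in lborel. AE \<theta> in lborel. ((s, y), \<theta>) \<notin> N" by (rule lborel_pair.AE_pair)
  then have "AE s in lborel. AE \<theta> in lborel. AE y in lborel. ((s, y), \<theta>) \<notin> N"
  proof eventually_elim
    fix s assume "AE y in lborel. AE \<theta> in lborel. ((s, y), \<theta>) \<notin> N"
    then show "AE \<theta> in lborel. AE y in lborel. ((s, y), \<theta>) \<notin> N"
    proof (subst (asm) lborel_pair.AE_commute)
      show "{x \<in> space (lborel \<Otimes>\<^sub>M lborel). ((s, fst x), snd x) \<notin> N} \<in> sets (lborel \<Otimes>\<^sub>M lborel)"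
        by measurable
    qed
  qed
  then show ?thesis
    by (rule eventually_mono) (use N(1) in \<open>auto elim!: eventually_mono\<close>)
qed

text \<open>The equality with \<open>f\<close> is recorded twice: with nested quantifiers for
  gradients and mixed norms, and jointly for use of Fubini over \<open>(s, y)\<close>. Vanishing
  outside the intervals lets the integrals extend over the whole line.\<close>

lemma borel_representative:
  fixes f :: "real \<times> (real^'n) \<Rightarrow> real \<Rightarrow> 'v::{banach, second_countable_topology}"
  assumes I: "I \<in> sets borel" and A: "A \<in> sets borel"
    and f: "strongly_measurable (restrict_space lborel ((I \<times> UNIV) \<times> A)) (\<lambda>(z, \<theta>). f z \<theta>)"
  obtains f0 :: "real \<Rightarrow> real^'n \<Rightarrow> real \<Rightarrow> 'v"
  where "(\<lambda>(s, y, \<theta>). f0 s y \<theta>) \<in> borel_measurable (borel \<Otimes>\<^sub>M borel \<Otimes>\<^sub>M borel)"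
    "AE s in lborel. AE \<theta> in lborel. s \<in> I \<longrightarrow> \<theta> \<in> A \<longrightarrow> (AE y in lborel. f (s, y) \<theta> = f0 s y \<theta>)"
    "AE z in lborel. z \<in> (I \<times> UNIV) \<times> A \<longrightarrow> (case z of ((s, y), \<theta>) \<Rightarrow> f (s, y) \<theta> = f0 s y \<theta>)"
    "\<And>s y \<theta>. s \<notin> I \<or> \<theta> \<notin> A \<Longrightarrow> f0 s y \<theta> = 0"
proof -
  have S: "(I \<times> UNIV) \<times> A \<in> sets (borel :: ((real \<times> (real^'n)) \<times> real) measure)"
    unfolding borel_prod[symmetric] using I A by (intro pair_measureI) auto
  obtain g' where g': "g' \<in> borel_measurable borel" "AE z in lborel. z \<in> (I \<times> UNIV) \<times> A \<longrightarrow> (case z of (z, \<theta>) \<Rightarrow> f z \<theta>) = g' z"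
    "\<And>z. z \<notin> (I \<times> UNIV) \<times> A \<Longrightarrow> g' z = 0"
    by (rule strongly_measurable_restrict_borel[OF S f]) (rule that)
  show ?thesis
  proof (rule that[of "\<lambda>s y \<theta>. g' ((s, y), \<theta>)"])
    have "g' \<in> borel_measurable ((borel \<Otimes>\<^sub>M borel) \<Otimes>\<^sub>M borel)" using g'(1) by (simp add: borel_prod)
    moreover have "(\<lambda>z. ((fst z, fst (snd z)), snd (snd z))) \<in> borel \<Otimes>\<^sub>M borel \<Otimes>\<^sub>M borel \<rightarrow>\<^sub>M (borel \<Otimes>\<^sub>M borel) \<Otimes>\<^sub>M borel"
      by measurable
    ultimately have "(\<lambda>z. g' ((fst z, fst (snd z)), snd (snd z))) \<in> borel_measurable (borel \<Otimes>\<^sub>M borel \<Otimes>\<^sub>M borel)"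
      by (rule measurable_compose[rotated])
    then show "(\<lambda>(s, y, \<theta>). g' ((s, y), \<theta>)) \<in> borel_measurable (borel \<Otimes>\<^sub>M borel \<Otimes>\<^sub>M borel)"
      by (simp only: split_beta')
    show "AE s in lborel. AE \<theta> in lborel. s \<in> I \<longrightarrow> \<theta> \<in> A \<longrightarrow> (AE y in lborel. f (s, y) \<theta> = g' ((s, y), \<theta>))"
      using AE_lborel_swap[OF g'(2)] by (rule eventually_mono) (auto elim!: eventually_mono)
    show "AE z in lborel. z \<in> (I \<times> UNIV) \<times> A \<longrightarrow> (case z of ((s, y), \<theta>) \<Rightarrow> f (s, y) \<theta> = g' ((s, y), \<theta>))"
      using g'(2) by (rule eventually_mono) auto
    show "g' ((s, y), \<theta>) = 0" if "s \<notin> I \<or> \<theta> \<notin> A" for s y \<theta> using that by (intro g'(3)) auto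
  qed
qed

text \<open>Transfers the estimate between functions with values in different spaces. Only
  monotonicity of the nonnegative integral enters, so a comparison of gradients for almost all
  \<open>s\<close> and \<theta> suffices.\<close>

lemma gradient_square_integral_mono:
  fixes f :: "real \<times> (real^'n) \<Rightarrow> real \<Rightarrow> 'v::real_normed_vector" and f' :: "real \<times> (real^'n) \<Rightarrow> real \<Rightarrow> 'w::real_normed_vector"
  assumes p: "0 \<le> p" and H: "0 < H"
    and le: "AE s in lborel. AE \<theta> in lborel. s \<in> einterval a b \<longrightarrow> \<theta> \<in> einterval \<alpha> \<beta> \<longrightarrow>
      (\<forall>\<tau>>0. \<forall>x. norm (gradient (heat_semigroup \<tau> (\<lambda>y. f (s, y) \<theta>)) x) \<le> norm (gradient (heat_semigroup \<tau> (\<lambda>y. f' (s, y) \<theta>)) x))"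
  shows "gradient_square_integral p H a b \<alpha> \<beta> f \<le> gradient_square_integral p H a b \<alpha> \<beta> f'"
  unfolding gradient_square_integral_def
proof (intro nn_integral_mono)
  fix x t
  let ?g = "\<lambda>s \<theta>. ennreal (norm (gradient (heat_semigroup (t - s) (\<lambda>y. f (s, y) \<theta>)) x) powr (1 / H))"
  let ?g' = "\<lambda>s \<theta>. ennreal (norm (gradient (heat_semigroup (t - s) (\<lambda>y. f' (s, y) \<theta>)) x) powr (1 / H))"
  have "(\<integral>\<^sup>+s\<in>einterval a (ereal t). (\<integral>\<^sup>+\<theta>\<in>einterval \<alpha> \<beta>. ?g s \<theta> \<partial>lborel) epowr (2 * H) \<partial>lborel)
    \<le> (\<integral>\<^sup>+s\<in>einterval a (ereal t). (\<integral>\<^sup>+\<theta>\<in>einterval \<alpha> \<beta>. ?g' s \<theta> \<partial>lborel) epowr (2 * H) \<partial>lborel)"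
    if t: "t \<in> einterval a b"
  proof (rule nn_integral_mono_AE)
    show "AE s in lborel. (\<integral>\<^sup>+\<theta>\<in>einterval \<alpha> \<beta>. ?g s \<theta> \<partial>lborel) epowr (2 * H) * indicator (einterval a (ereal t)) s
      \<le> (\<integral>\<^sup>+\<theta>\<in>einterval \<alpha> \<beta>. ?g' s \<theta> \<partial>lborel) epowr (2 * H) * indicator (einterval a (ereal t)) s"
      using le
    proof eventually_elim
      fix s assume AE: "AE \<theta> in lborel. s \<in> einterval a b \<longrightarrow> \<theta> \<in> einterval \<alpha> \<beta> \<longrightarrow>
        (\<forall>\<tau>>0. \<forall>x. norm (gradient (heat_semigroup \<tau> (\<lambda>y. f (s, y) \<theta>)) x) \<le> norm (gradient (heat_semigroup \<tau> (\<lambda>y. f' (s, y) \<theta>)) x))"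
      show "(\<integral>\<^sup>+\<theta>\<in>einterval \<alpha> \<beta>. ?g s \<theta> \<partial>lborel) epowr (2 * H) * indicator (einterval a (ereal t)) s
        \<le> (\<integral>\<^sup>+\<theta>\<in>einterval \<alpha> \<beta>. ?g' s \<theta> \<partial>lborel) epowr (2 * H) * indicator (einterval a (ereal t)) s"
      proof (cases "s \<in> einterval a (ereal t)")
        case True
        then have s: "s \<in> einterval a b" "0 < t - s" using t less_trans[of "ereal s" "ereal t" b] by (auto simp: einterval_def)
        have "(\<integral>\<^sup>+\<theta>\<in>einterval \<alpha> \<beta>. ?g s \<theta> \<partial>lborel) \<le> (\<integral>\<^sup>+\<theta>\<in>einterval \<alpha> \<beta>. ?g' s \<theta> \<partial>lborel)"
        proof (rule nn_integral_mono_AE)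
          show "AE \<theta> in lborel. ?g s \<theta> * indicator (einterval \<alpha> \<beta>) \<theta> \<le> ?g' s \<theta> * indicator (einterval \<alpha> \<beta>) \<theta>"
            using AE by eventually_elim (use s H in \<open>auto simp: indicator_def intro!: ennreal_leI powr_mono2\<close>)
        qed
        then show ?thesis using H by (intro mult_right_mono epowr_mono) auto
      qed simp
    qed
  qed
  then show "(\<integral>\<^sup>+s\<in>einterval a (ereal t). (\<integral>\<^sup>+\<theta>\<in>einterval \<alpha> \<beta>. ?g s \<theta> \<partial>lborel) epowr (2 * H) \<partial>lborel) epowr (p / 2) * indicator (einterval a b) t
    \<le> (\<integral>\<^sup>+s\<in>einterval a (ereal t). (\<integral>\<^sup>+\<theta>\<in>einterval \<alpha> \<beta>. ?g' s \<theta> \<partial>lborel) epowr (2 * H) \<partial>lborel) epowr (p / 2) * indicator (einterval a b) t"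
    using p by (auto simp: indicator_def intro!: epowr_mono)
qed

lemma gradient_square_integral_le_square_function:
  fixes f0 :: "real \<Rightarrow> real^'n \<Rightarrow> real \<Rightarrow> 'v::{real_inner, banach, second_countable_topology}"
  assumes p: "0 \<le> p" and H: "0 < H"
    and eq: "AE s in lborel. AE \<theta> in lborel. s \<in> einterval a b \<longrightarrow> \<theta> \<in> einterval \<alpha> \<beta> \<longrightarrow>
      heat_admissible (\<lambda>y. f0 s y \<theta>) \<and> (AE y in lborel. f (s, y) \<theta> = f0 s y \<theta>)"
  shows "gradient_square_integral p H a b \<alpha> \<beta> f \<le> (\<integral>\<^sup>+x. \<integral>\<^sup>+t. square_function H f0 t x epowr (p / 2) \<partial>lborel \<partial>lborel)"
  unfolding gradient_square_integral_def
proof (intro nn_integral_mono)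
  fix x t
  let ?g = "\<lambda>s \<theta>. ennreal (norm (gradient (heat_semigroup (t - s) (\<lambda>y. f (s, y) \<theta>)) x) powr (1 / H))"
  let ?G = "\<lambda>s \<theta>. ennreal (heat_grad_sq (t - s) (\<lambda>y. f0 s y \<theta>) x) epowr (1 / (2 * H))"
  have "(\<integral>\<^sup>+s\<in>einterval a (ereal t). (\<integral>\<^sup>+\<theta>\<in>einterval \<alpha> \<beta>. ?g s \<theta> \<partial>lborel) epowr (2 * H) \<partial>lborel) \<le> square_function H f0 t x"
    if t: "t \<in> einterval a b"
    unfolding square_function_def
  proof (rule nn_integral_mono_AE)
    show "AE s in lborel. (\<integral>\<^sup>+\<theta>\<in>einterval \<alpha> \<beta>. ?g s \<theta> \<partial>lborel) epowr (2 * H) * indicator (einterval a (ereal t)) s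
      \<le> (\<integral>\<^sup>+\<theta>. ?G s \<theta> \<partial>lborel) epowr (2 * H) * indicator {..<t} s"
      using eq
    proof eventually_elim
      fix s assume AE: "AE \<theta> in lborel. s \<in> einterval a b \<longrightarrow> \<theta> \<in> einterval \<alpha> \<beta> \<longrightarrow>
        heat_admissible (\<lambda>y. f0 s y \<theta>) \<and> (AE y in lborel. f (s, y) \<theta> = f0 s y \<theta>)"
      show "(\<integral>\<^sup>+\<theta>\<in>einterval \<alpha> \<beta>. ?g s \<theta> \<partial>lborel) epowr (2 * H) * indicator (einterval a (ereal t)) s
        \<le> (\<integral>\<^sup>+\<theta>. ?G s \<theta> \<partial>lborel) epowr (2 * H) * indicator {..<t} s"
      proof (cases "s \<in> einterval a (ereal t)")
        case True
        then have s: "s \<in> einterval a b" "s < t" using t less_trans[of "ereal s" "ereal t" b] by (auto simp: einterval_def)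
        have "(\<integral>\<^sup>+\<theta>\<in>einterval \<alpha> \<beta>. ?g s \<theta> \<partial>lborel) \<le> (\<integral>\<^sup>+\<theta>. ?G s \<theta> \<partial>lborel)"
        proof (rule nn_integral_mono_AE)
          show "AE \<theta> in lborel. ?g s \<theta> * indicator (einterval \<alpha> \<beta>) \<theta> \<le> ?G s \<theta>"
            using AE
          proof eventually_elim
            fix \<theta> assume a: "s \<in> einterval a b \<longrightarrow> \<theta> \<in> einterval \<alpha> \<beta> \<longrightarrow>
              heat_admissible (\<lambda>y. f0 s y \<theta>) \<and> (AE y in lborel. f (s, y) \<theta> = f0 s y \<theta>)"
            show "?g s \<theta> * indicator (einterval \<alpha> \<beta>) \<theta> \<le> ?G s \<theta>"
            proof (cases "\<theta> \<in> einterval \<alpha> \<beta>")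
              case True
              let ?n = "norm (gradient (heat_semigroup (t - s) (\<lambda>y. f (s, y) \<theta>)) x)"
              have "gradient (heat_semigroup (t - s) (\<lambda>y. f (s, y) \<theta>)) x = (\<chi> i. heat_deriv (t - s) i (\<lambda>y. f0 s y \<theta>) x)"
                using gradient_heat_semigroup[of "\<lambda>y. f0 s y \<theta>" "t - s" "\<lambda>v. v"] a s True bounded_linear_ident by auto
              then have n: "?n\<^sup>2 = heat_grad_sq (t - s) (\<lambda>y. f0 s y \<theta>) x"
                by (simp add: norm_vec_def L2_set_def heat_grad_sq_def sum_nonneg)
              \<comment> \<open>\<open>square_function\<close> is built from the squared gradient,
                so the power \<open>1 / H\<close> of the norm becomes the power
                \<open>1 / (2 * H)\<close>.\<close>
              have "?n powr (1 / H) = (?n powr 2) powr (1 / (2 * H))" by (simp only: powr_powr) simp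
              also have "\<dots> = (?n\<^sup>2) powr (1 / (2 * H))" by (simp add: powr_numeral)
              finally show ?thesis using n by (simp add: epowr_ennreal indicator_def)
            qed simp
          qed
        qed
        then show ?thesis using H s by (simp add: epowr_mono True)
      qed simp
    qed
  qed
  then show "(\<integral>\<^sup>+s\<in>einterval a (ereal t). (\<integral>\<^sup>+\<theta>\<in>einterval \<alpha> \<beta>. ?g s \<theta> \<partial>lborel) epowr (2 * H) \<partial>lborel) epowr (p / 2) * indicator (einterval a b) t
    \<le> square_function H f0 t x epowr (p / 2)"
    using p by (auto simp: indicator_def intro!: epowr_mono)
qed

lemma mixed_norm_integral_eq:
  fixes f0 :: "real \<Rightarrow> real^'n \<Rightarrow> real \<Rightarrow> 'v::real_normed_vector"
  assumes eq: "AE s in lborel. AE \<theta> in lborel. s \<in> einterval a b \<longrightarrow> \<theta> \<in> einterval \<alpha> \<beta> \<longrightarrow> (AE y in lborel. f (s, y) \<theta> = f0 s y \<theta>)"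
    and z: "\<And>s y \<theta>. s \<notin> einterval a b \<or> \<theta> \<notin> einterval \<alpha> \<beta> \<Longrightarrow> f0 s y \<theta> = 0"
  shows "mixed_norm_integral p H a b \<alpha> \<beta> f = mixed_norm p H f0"
  unfolding mixed_norm_integral_def mixed_norm_def
proof (rule nn_integral_cong_AE)
  let ?N = "\<lambda>s \<theta>. (\<integral>\<^sup>+y. ennreal (norm (f0 s y \<theta>) powr p) \<partial>lborel) epowr (1 / (p * H))"
  let ?M = "\<lambda>s \<theta>. (\<integral>\<^sup>+y. ennreal (norm (f (s, y) \<theta>) powr p) \<partial>lborel) epowr (1 / (p * H))"
  show "AE s in lborel. (\<integral>\<^sup>+\<theta>\<in>einterval \<alpha> \<beta>. ?M s \<theta> \<partial>lborel) epowr (p * H) * indicator (einterval a b) s = (\<integral>\<^sup>+\<theta>. ?N s \<theta> \<partial>lborel) epowr (p * H)"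
    using eq
  proof eventually_elim
    fix s assume AE: "AE \<theta> in lborel. s \<in> einterval a b \<longrightarrow> \<theta> \<in> einterval \<alpha> \<beta> \<longrightarrow> (AE y in lborel. f (s, y) \<theta> = f0 s y \<theta>)"
    show "(\<integral>\<^sup>+\<theta>\<in>einterval \<alpha> \<beta>. ?M s \<theta> \<partial>lborel) epowr (p * H) * indicator (einterval a b) s = (\<integral>\<^sup>+\<theta>. ?N s \<theta> \<partial>lborel) epowr (p * H)"
    proof (cases "s \<in> einterval a b")
      case True
      have "(\<integral>\<^sup>+\<theta>\<in>einterval \<alpha> \<beta>. ?M s \<theta> \<partial>lborel) = (\<integral>\<^sup>+\<theta>. ?N s \<theta> \<partial>lborel)"
      proof (rule nn_integral_cong_AE)
        show "AE \<theta> in lborel. ?M s \<theta> * indicator (einterval \<alpha> \<beta>) \<theta> = ?N s \<theta>"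
          using AE
        proof eventually_elim
          fix \<theta> assume a: "s \<in> einterval a b \<longrightarrow> \<theta> \<in> einterval \<alpha> \<beta> \<longrightarrow> (AE y in lborel. f (s, y) \<theta> = f0 s y \<theta>)"
          show "?M s \<theta> * indicator (einterval \<alpha> \<beta>) \<theta> = ?N s \<theta>"
          proof (cases "\<theta> \<in> einterval \<alpha> \<beta>")
            case \<theta>: True
            have "AE y in lborel. f (s, y) \<theta> = f0 s y \<theta>" using a True \<theta> by blast
            then have "(\<integral>\<^sup>+y. ennreal (norm (f (s, y) \<theta>) powr p) \<partial>lborel) = (\<integral>\<^sup>+y. ennreal (norm (f0 s y \<theta>) powr p) \<partial>lborel)"
              by (intro nn_integral_cong_AE) (auto elim: eventually_mono)
            then show ?thesis using \<theta> by simp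
          qed (simp add: z)
        qed
      qed
      then show ?thesis using True by simp
    qed (simp add: z)
  qed
qed

lemma AE_heat_admissible_mixed_norm:
  fixes f0 :: "real \<Rightarrow> real^'n \<Rightarrow> real \<Rightarrow> 'v::{banach, second_countable_topology}"
  assumes f0: "(\<lambda>(s, y, \<theta>). f0 s y \<theta>) \<in> borel_measurable (borel \<Otimes>\<^sub>M borel \<Otimes>\<^sub>M borel)"
    and p: "1 \<le> p" and fin: "mixed_norm p H f0 < \<infinity>"
  shows "AE s in lborel. AE \<theta> in lborel. heat_admissible (\<lambda>y. f0 s y \<theta>)"
proof -
  note [measurable (raw)] = measurable_curry3[OF f0]
  let ?N = "\<lambda>s \<theta>. (\<integral>\<^sup>+y. ennreal (norm (f0 s y \<theta>) powr p) \<partial>lborel)"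
  have "AE s in lborel. (\<integral>\<^sup>+\<theta>. ?N s \<theta> epowr (1 / (p * H)) \<partial>lborel) epowr (p * H) \<noteq> \<infinity>"
    by (rule nn_integral_noteq_infinite) (use fin in \<open>auto simp: mixed_norm_def\<close>)
  then show ?thesis
  proof eventually_elim
    fix s assume "(\<integral>\<^sup>+\<theta>. ?N s \<theta> epowr (1 / (p * H)) \<partial>lborel) epowr (p * H) \<noteq> \<infinity>"
    then have "AE \<theta> in lborel. ?N s \<theta> epowr (1 / (p * H)) \<noteq> \<infinity>"
      by (intro nn_integral_noteq_infinite) auto
    then show "AE \<theta> in lborel. heat_admissible (\<lambda>y. f0 s y \<theta>)"
    proof eventually_elim
      fix \<theta> assume "?N s \<theta> epowr (1 / (p * H)) \<noteq> \<infinity>"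
      then show "heat_admissible (\<lambda>y. f0 s y \<theta>)"
        using p by (intro heat_admissible_Lp[of _ p]) (auto simp: less_top[symmetric])
    qed
  qed
qed

lemma einterval_borel: "einterval a b \<in> sets borel"
  by (rule borel_open) (rule open_einterval)

text \<open>Without a witness the choice operator in \<open>gradient_const\<close> would say
  nothing. The number \<open>N\<close> is fixed before \<open>H\<close>, the intervals and
  \<open>f\<close>.\<close>

lemma gradient_estimate_ell2_exists:
  assumes p: "2 \<le> p"
  shows "\<exists>N. gradient_estimate_ell2 TYPE('n::finite) p N"
proof -
  obtain N where N: "0 < N" "\<And>H (f :: real \<Rightarrow> real^'n \<Rightarrow> real \<Rightarrow> ell2).
      1 / 2 < H \<Longrightarrow> (\<lambda>(s, y, \<theta>). f s y \<theta>) \<in> borel_measurable (borel \<Otimes>\<^sub>M borel \<Otimes>\<^sub>M borel) \<Longrightarrow> mixed_norm p H f < \<infinity> \<Longrightarrow>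
      (\<integral>\<^sup>+x. \<integral>\<^sup>+t. square_function H f t x epowr (p / 2) \<partial>lborel \<partial>lborel) \<le> ennreal N * mixed_norm p H f"
    using square_function_estimate[OF p, where 'n='n and 'v=ell2] by metis
  have "gradient_square_integral p H a b \<alpha> \<beta> f \<le> ennreal N * mixed_norm_integral p H a b \<alpha> \<beta> f"
    if H: "1 / 2 < H" "H < 1" and f: "C0_infty_Lq (1 / H) a b (einterval \<alpha> \<beta>) f"
    for H a b \<alpha> \<beta> and f :: "real \<times> (real ^ 'n) \<Rightarrow> real \<Rightarrow> ell2"
  proof -
    have sm: "strongly_measurable (restrict_space lborel ((einterval a b \<times> UNIV) \<times> einterval \<alpha> \<beta>)) (\<lambda>(z, \<theta>). f z \<theta>)"
      using f by (simp add: C0_infty_Lq_def)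
    obtain f0 where f0: "(\<lambda>(s, y, \<theta>). f0 s y \<theta>) \<in> borel_measurable (borel \<Otimes>\<^sub>M borel \<Otimes>\<^sub>M borel)"
      "AE s in lborel. AE \<theta> in lborel. s \<in> einterval a b \<longrightarrow> \<theta> \<in> einterval \<alpha> \<beta> \<longrightarrow> (AE y in lborel. f (s, y) \<theta> = f0 s y \<theta>)"
      "AE z in lborel. z \<in> (einterval a b \<times> UNIV) \<times> einterval \<alpha> \<beta> \<longrightarrow> (case z of ((s, y), \<theta>) \<Rightarrow> f (s, y) \<theta> = f0 s y \<theta>)"
      "\<And>s y \<theta>. s \<notin> einterval a b \<or> \<theta> \<notin> einterval \<alpha> \<beta> \<Longrightarrow> f0 s y \<theta> = 0"
      by (rule borel_representative[OF einterval_borel einterval_borel sm]) (rule that)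
    have mix: "mixed_norm_integral p H a b \<alpha> \<beta> f = mixed_norm p H f0"
      by (rule mixed_norm_integral_eq) (rule f0(2), rule f0(4))
    show ?thesis
    proof (cases "mixed_norm p H f0 < \<infinity>")
      case True
      have "AE s in lborel. AE \<theta> in lborel. s \<in> einterval a b \<longrightarrow> \<theta> \<in> einterval \<alpha> \<beta> \<longrightarrow>
        heat_admissible (\<lambda>y. f0 s y \<theta>) \<and> (AE y in lborel. f (s, y) \<theta> = f0 s y \<theta>)"
        using AE_heat_admissible_mixed_norm[OF f0(1) _ True] f0(2) p
        by (auto elim!: eventually_elim2)
      then have "gradient_square_integral p H a b \<alpha> \<beta> f \<le> (\<integral>\<^sup>+x. \<integral>\<^sup>+t. square_function H f0 t x epowr (p / 2) \<partial>lborel \<partial>lborel)"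
        using p H by (intro gradient_square_integral_le_square_function) auto
      also have "\<dots> \<le> ennreal N * mixed_norm p H f0" by (rule N(2)[OF H(1) f0(1) True])
      finally show ?thesis by (simp add: mix)
    next
      \<comment> \<open>As \<open>N\<close> is positive, the right-hand side is infinite.\<close>
      case False
      then have "mixed_norm p H f0 = top" by (simp add: less_top[symmetric])
      then show ?thesis using N(1) by (simp add: mix ennreal_mult_top)
    qed
  qed
  then show ?thesis unfolding gradient_estimate_ell2_def by blast
qed

subsection \<open>Coordinates in a separable subspace of a Hilbert space\<close>

text \<open>Gram-Schmidt with \<open>sgn 0 = 0\<close>: the nonzero vectors \<open>gram d n\<close> form an orthonormal basis of the
  closed span of \<open>d\<close>.\<close>

fun gram :: "(nat \<Rightarrow> 'v::real_inner) \<Rightarrow> nat \<Rightarrow> 'v" where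
  "gram d n = sgn (d n - (\<Sum>k<n. (d n \<bullet> gram d k) *\<^sub>R gram d k))"

declare gram.simps [simp del]

text \<open>A vector \<open>gram d n\<close> has norm 1 or is 0. This form of the normalisation
  covers both cases and so spares later distinctions.\<close>

lemma gram_inner_self: "v \<bullet> gram d n * (gram d n \<bullet> gram d n) = v \<bullet> gram d n"
proof (cases "gram d n = 0")
  case False
  then have "norm (gram d n) = 1" by (subst gram.simps, subst (asm) gram.simps) (simp add: norm_sgn sgn_zero_iff)
  then show ?thesis by (simp add: power2_norm_eq_inner[symmetric])
qed simp

lemma gram_orthogonal_less: "k < n \<Longrightarrow> gram d n \<bullet> gram d k = 0"
proof (induction n arbitrary: k rule: less_induct)
  case (less n)
  have o: "gram d j \<bullet> gram d k = 0" if "j < n" "j \<noteq> k" for j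
    using less.IH[OF that(1), of k] less.IH[OF less.prems, of j] that by (cases "k < j") (auto simp: inner_commute)
  have "(\<Sum>j<n. (d n \<bullet> gram d j) * (gram d j \<bullet> gram d k)) = (\<Sum>j<n. if j = k then d n \<bullet> gram d k else 0)"
    by (intro sum.cong) (auto simp: o gram_inner_self)
  also have "\<dots> = d n \<bullet> gram d k" using less.prems by simp
  finally have "(d n - (\<Sum>j<n. (d n \<bullet> gram d j) *\<^sub>R gram d j)) \<bullet> gram d k = 0"
    by (simp add: inner_diff_left inner_sum_left)
  then show ?case by (subst gram.simps) (simp add: sgn_div_norm)
qed

lemma gram_orthogonal: "j \<noteq> k \<Longrightarrow> gram d j \<bullet> gram d k = 0"
  using gram_orthogonal_less[of j k d] gram_orthogonal_less[of k j d] by (metis inner_commute nat_neq_iff)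

lemma norm_gram_le: "norm (gram d n) \<le> 1"
  by (subst gram.simps) (simp add: norm_sgn)

text \<open>The residue \<open>w\<close> is \<open>norm w\<close> times its normalisation, also when
  it is 0, so the term \<open>k = n\<close> restores exactly what the earlier projections
  leave.\<close>

lemma gram_expansion: "d n = (\<Sum>k\<le>n. (d n \<bullet> gram d k) *\<^sub>R gram d k)"
proof -
  define w where "w = d n - (\<Sum>k<n. (d n \<bullet> gram d k) *\<^sub>R gram d k)"
  have g: "gram d n = sgn w" by (subst gram.simps) (simp add: w_def)
  have "(\<Sum>k<n. (d n \<bullet> gram d k) *\<^sub>R gram d k) \<bullet> gram d n = 0"
    by (simp add: inner_sum_left gram_orthogonal)
  then have "d n \<bullet> gram d n = w \<bullet> gram d n" by (simp add: w_def inner_diff_left)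
  also have "\<dots> = norm w" unfolding g by (cases "w = 0") (auto simp: sgn_div_norm power2_norm_eq_inner[symmetric] power2_eq_square)
  finally have "(d n \<bullet> gram d n) *\<^sub>R gram d n = w" unfolding g by (cases "w = 0") (auto simp: sgn_div_norm)
  then show ?thesis by (simp add: lessThan_Suc_atMost[symmetric] w_def)
qed

text \<open>Pythagoras; it is only an inequality because coefficients at zero vectors are
  lost.\<close>

lemma norm_sum_gram:
  assumes "finite F" shows "(norm (\<Sum>n\<in>F. c n *\<^sub>R gram d n))\<^sup>2 \<le> (\<Sum>n\<in>F. (c n)\<^sup>2)"
proof -
  have "(norm (\<Sum>n\<in>F. c n *\<^sub>R gram d n))\<^sup>2 = (\<Sum>n\<in>F. \<Sum>m\<in>F. c n * (c m * (gram d n \<bullet> gram d m)))"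
    by (simp add: power2_norm_eq_inner inner_sum_left inner_sum_right sum_distrib_left inner_commute mult_ac)
  also have "\<dots> = (\<Sum>n\<in>F. \<Sum>m\<in>F. if m = n then c n * (c n * (gram d n \<bullet> gram d n)) else 0)"
    by (intro sum.cong) (auto simp: gram_orthogonal)
  also have "\<dots> = (\<Sum>n\<in>F. (c n)\<^sup>2 * (norm (gram d n))\<^sup>2)"
    unfolding power2_norm_eq_inner using assms by (simp add: power2_eq_square mult.assoc)
  also have "\<dots> \<le> (\<Sum>n\<in>F. (c n)\<^sup>2 * 1)"
    using norm_gram_le[of d] by (intro sum_mono mult_left_mono) (auto simp: power_le_one)
  finally show ?thesis by simp
qed

lemma gram_Bessel: "(\<Sum>n<k. (v \<bullet> gram d n)\<^sup>2) \<le> (norm v)\<^sup>2"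
proof -
  let ?p = "\<Sum>n<k. (v \<bullet> gram d n) *\<^sub>R gram d n"
  have "v \<bullet> ?p = (\<Sum>n<k. (v \<bullet> gram d n)\<^sup>2)" by (simp add: inner_sum_right power2_eq_square)
  moreover have "?p \<bullet> ?p \<le> (\<Sum>n<k. (v \<bullet> gram d n)\<^sup>2)"
    using norm_sum_gram[of "{..<k}" "\<lambda>n. v \<bullet> gram d n" d] by (simp add: power2_norm_eq_inner)
  moreover have "0 \<le> (v - ?p) \<bullet> (v - ?p)" by simp
  ultimately show ?thesis
    by (simp add: inner_diff_left inner_diff_right inner_commute power2_norm_eq_inner)
qed

lemma summable_gram: "summable (\<lambda>n. (v \<bullet> gram d n)\<^sup>2)"
  by (rule summableI_nonneg_bounded[of _ "(norm v)\<^sup>2"]) (auto intro: gram_Bessel)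

definition gram_coord :: "(nat \<Rightarrow> 'v::real_inner) \<Rightarrow> 'v \<Rightarrow> ell2" where
  "gram_coord d v = Abs_ell2 (\<lambda>n. v \<bullet> gram d n)"

lemma Rep_gram_coord: "Rep_ell2 (gram_coord d v) n = v \<bullet> gram d n"
  unfolding gram_coord_def by (subst Abs_ell2_inverse) (auto simp: summable_gram)

lemma norm_gram_coord_le: "norm (gram_coord d v) \<le> norm v"
proof -
  have "(norm (gram_coord d v))\<^sup>2 \<le> (norm v)\<^sup>2"
    unfolding norm_ell2_sq Rep_gram_coord by (rule suminf_le_const[OF summable_gram gram_Bessel])
  then show ?thesis by (simp add: power2_le_iff_abs_le)
qed

lemma bounded_linear_gram_coord: "bounded_linear (gram_coord d)"
proof (rule bounded_linear_intro[of _ 1])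
  show "gram_coord d (x + y) = gram_coord d x + gram_coord d y" for x y
    by (rule Rep_ell2_inject[THEN iffD1]) (simp add: fun_eq_iff Rep_gram_coord plus_ell2.rep_eq inner_add_left)
  show "gram_coord d (r *\<^sub>R x) = r *\<^sub>R gram_coord d x" for r x
    by (rule Rep_ell2_inject[THEN iffD1]) (simp add: fun_eq_iff Rep_gram_coord scaleR_ell2.rep_eq)
qed (simp add: norm_gram_coord_le)

text \<open>The adjoint of \<open>gram_coord\<close>. Applied after it, this gives the orthogonal
  projection to the closed span of \<open>d\<close>.\<close>

definition gram_vec :: "(nat \<Rightarrow> 'v::real_inner) \<Rightarrow> ell2 \<Rightarrow> 'v" where
  "gram_vec d x = (\<Sum>n. Rep_ell2 x n *\<^sub>R gram d n)"

lemma summable_gram_vec: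
  fixes d :: "nat \<Rightarrow> 'v::{real_inner, complete_space}"
  shows "summable (\<lambda>n. Rep_ell2 x n *\<^sub>R gram d n)"
  unfolding summable_iff_convergent
proof (rule Cauchy_convergent, rule CauchyI)
  fix e :: real assume e: "0 < e"
  let ?S = "\<lambda>n. \<Sum>i<n. Rep_ell2 x i *\<^sub>R gram d i"
  have "Cauchy (\<lambda>n. \<Sum>i<n. (Rep_ell2 x i)\<^sup>2)"
    using summable_ell2[of x] by (simp add: summable_iff_convergent convergent_Cauchy)
  then obtain M where M: "\<And>m n. M \<le> m \<Longrightarrow> M \<le> n \<Longrightarrow> norm ((\<Sum>i<m. (Rep_ell2 x i)\<^sup>2) - (\<Sum>i<n. (Rep_ell2 x i)\<^sup>2)) < e\<^sup>2"
    using e CauchyD[of _ "e\<^sup>2"] by (metis zero_less_power)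
  have le: "norm (?S n - ?S m) < e" if "M \<le> m" "m \<le> n" for m n
  proof -
    have "?S n - ?S m = (\<Sum>i\<in>{m..<n}. Rep_ell2 x i *\<^sub>R gram d i)"
      using that by (simp add: sum_diff_nat_ivl[of 0 m n, simplified atLeast0LessThan])
    then have "(norm (?S n - ?S m))\<^sup>2 \<le> (\<Sum>i\<in>{m..<n}. (Rep_ell2 x i)\<^sup>2)"
      using norm_sum_gram[of "{m..<n}"] by simp
    also have "\<dots> = (\<Sum>i<n. (Rep_ell2 x i)\<^sup>2) - (\<Sum>i<m. (Rep_ell2 x i)\<^sup>2)"
      using that by (simp add: sum_diff_nat_ivl[of 0 m n, simplified atLeast0LessThan])
    also have "\<dots> < e\<^sup>2" using M[of n m] that by (simp add: abs_less_iff)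
    finally show ?thesis using e by (simp add: power_less_imp_less_base)
  qed
  show "\<exists>M. \<forall>m\<ge>M. \<forall>n\<ge>M. norm (?S m - ?S n) < e"
  proof (intro exI[of _ M] allI impI)
    fix m n assume "M \<le> m" "M \<le> n"
    then show "norm (?S m - ?S n) < e"
      using le[of m n] le[of n m] by (cases "m \<le> n") (auto simp: norm_minus_commute)
  qed
qed

lemma norm_gram_vec_le:
  fixes d :: "nat \<Rightarrow> 'v::{real_inner, complete_space}"
  shows "norm (gram_vec d x) \<le> norm x"
proof (rule LIMSEQ_le_const2)
  show "(\<lambda>k. norm (\<Sum>n<k. Rep_ell2 x n *\<^sub>R gram d n)) \<longlonglongrightarrow> norm (gram_vec d x)"
    unfolding gram_vec_def by (intro tendsto_norm summable_LIMSEQ summable_gram_vec)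
  have "norm (\<Sum>n<k. Rep_ell2 x n *\<^sub>R gram d n) \<le> norm x" for k
  proof -
    have "(norm (\<Sum>n<k. Rep_ell2 x n *\<^sub>R gram d n))\<^sup>2 \<le> (norm x)\<^sup>2"
      by (rule order_trans[OF norm_sum_gram sum_le_norm_ell2]) simp
    then show ?thesis by (rule power2_le_imp_le) simp
  qed
  then show "\<exists>N. \<forall>n\<ge>N. norm (\<Sum>n<n. Rep_ell2 x n *\<^sub>R gram d n) \<le> norm x" by blast
qed

lemma bounded_linear_gram_vec:
  fixes d :: "nat \<Rightarrow> 'v::{real_inner, complete_space}"
  shows "bounded_linear (gram_vec d)"
proof (rule bounded_linear_intro[of _ 1])
  show "gram_vec d (x + y) = gram_vec d x + gram_vec d y" for x y
    unfolding gram_vec_def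
    by (subst suminf_add[OF summable_gram_vec summable_gram_vec]) (simp add: plus_ell2.rep_eq scaleR_add_left)
  show "gram_vec d (r *\<^sub>R x) = r *\<^sub>R gram_vec d x" for r x
    unfolding gram_vec_def
    by (subst suminf_scaleR_right[OF summable_gram_vec]) (simp add: scaleR_ell2.rep_eq)
qed (simp add: norm_gram_vec_le)

lemma gram_vec_coord:
  fixes d :: "nat \<Rightarrow> 'v::{real_inner, complete_space}"
  shows "gram_vec d (gram_coord d (d n)) = d n"
proof -
  have "d n \<bullet> gram d k = 0" if "n < k" for k
    by (subst gram_expansion[of d n]) (use that in \<open>simp add: inner_sum_left gram_orthogonal\<close>)
  then have "gram_vec d (gram_coord d (d n)) = (\<Sum>k\<le>n. (d n \<bullet> gram d k) *\<^sub>R gram d k)"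
    unfolding gram_vec_def Rep_gram_coord by (intro suminf_finite) auto
  then show ?thesis by (simp add: gram_expansion[symmetric])
qed

text \<open>Let \<open>d\<close> enumerate all values of the approximating simple functions. The
  projection fixes these values, and by continuity it fixes their limits, which are almost all
  values of \<open>g\<close>.\<close>

lemma strongly_measurable_gram:
  fixes g :: "'a \<Rightarrow> 'v::{real_inner, complete_space}"
  assumes "strongly_measurable M g"
  obtains d :: "nat \<Rightarrow> 'v" where "AE x in M. gram_vec d (gram_coord d (g x)) = g x"
proof -
  obtain s where s: "\<And>i::nat. simple_function M (s i)" "AE x in M. (\<lambda>i. s i x) \<longlonglongrightarrow> g x"
    using assms unfolding strongly_measurable_def by blast
  \<comment> \<open>The element 0 makes \<open>D\<close> nonempty, so that
    \<open>from_nat_into\<close> enumerates it.\<close>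
  define D where "D = insert 0 (\<Union>i. s i ` space M)"
  have "countable (s i ` space M)" for i
    using s(1)[of i] by (auto simp: simple_function_def intro: countable_finite)
  then have "countable D" unfolding D_def by auto
  moreover have "D \<noteq> {}" by (simp add: D_def)
  ultimately have D: "range (from_nat_into D) = D" by simp
  define d where "d = from_nat_into D"
  have fixed: "gram_vec d (gram_coord d v) = v" if "v \<in> D" for v
  proof -
    have "v \<in> range d" using that D by (simp add: d_def)
    then obtain n where "v = d n" by blast
    then show ?thesis by (simp add: gram_vec_coord)
  qed
  have "AE x in M. gram_vec d (gram_coord d (g x)) = g x"
    using s(2) AE_space
  proof eventually_elim
    fix x assume l: "(\<lambda>i. s i x) \<longlonglongrightarrow> g x" and x: "x \<in> space M"
    have "(\<lambda>i. gram_vec d (gram_coord d (s i x))) \<longlonglongrightarrow> gram_vec d (gram_coord d (g x))"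
      by (intro bounded_linear.tendsto[OF bounded_linear_gram_vec] bounded_linear.tendsto[OF bounded_linear_gram_coord] l)
    moreover have "gram_vec d (gram_coord d (s i x)) = s i x" for i
      by (rule fixed) (use x in \<open>auto simp: D_def\<close>)
    ultimately have "(\<lambda>i. s i x) \<longlonglongrightarrow> gram_vec d (gram_coord d (g x))" by simp
    then show "gram_vec d (gram_coord d (g x)) = g x" using l by (rule LIMSEQ_unique)
  qed
  then show ?thesis by (rule that)
qed

subsection \<open>Contractions and test functions\<close>

lemma Lq_seminorm_contraction:
  assumes q: "0 < q" and T: "\<And>v. norm (T v) \<le> norm v"
  shows "Lq_seminorm q A (\<lambda>\<theta>. T (g \<theta>)) \<le> Lq_seminorm q A g"
  unfolding Lq_seminorm_def
  using q T by (intro epowr_mono nn_integral_mono mult_right_mono ennreal_leI powr_mono2) auto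

lemma Lq_continuous_on_contraction:
  assumes q: "0 < q" and T: "bounded_linear T" "\<And>v. norm (T v) \<le> norm v" and F: "Lq_continuous_on q A \<Omega> F"
  shows "Lq_continuous_on q A \<Omega> (\<lambda>z \<theta>. T (F z \<theta>))"
  unfolding Lq_continuous_on_def
proof (intro ballI conjI)
  interpret T: bounded_linear T by fact
  fix z assume z: "z \<in> \<Omega>"
  have i: "in_Lq q A (F z)" "((\<lambda>w. Lq_seminorm q A (\<lambda>\<theta>. F w \<theta> - F z \<theta>)) \<longlongrightarrow> 0) (at z within \<Omega>)"
    using F z by (auto simp: Lq_continuous_on_def)
  show "in_Lq q A (\<lambda>\<theta>. T (F z \<theta>))"
    using i(1) strongly_measurable_compose[OF _ linear_continuous_at[OF T(1)]] Lq_seminorm_contraction[OF q T(2)]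
    unfolding in_Lq_def by (blast intro: le_less_trans)
  show "((\<lambda>w. Lq_seminorm q A (\<lambda>\<theta>. T (F w \<theta>) - T (F z \<theta>))) \<longlongrightarrow> 0) (at z within \<Omega>)"
    unfolding T.diff[symmetric]
    by (rule tendsto_sandwich[OF always_eventually always_eventually tendsto_const i(2)])
      (auto intro: Lq_seminorm_contraction[OF q T(2)])
qed

text \<open>A linear contraction commutes with difference quotients and does not increase the
  seminorm, so it maps partial derivatives to partial derivatives.\<close>

lemma Lq_C_contraction:
  assumes q: "0 < q" and T: "bounded_linear T" "\<And>v. norm (T v) \<le> norm v"
  shows "Lq_C k q A \<Omega> F \<Longrightarrow> Lq_C k q A \<Omega> (\<lambda>z \<theta>. T (F z \<theta>))"
proof (induction k arbitrary: F)
  case 0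
  then show ?case using Lq_continuous_on_contraction[OF q T] by simp
next
  case (Suc k)
  interpret T: bounded_linear T by fact
  have "\<exists>G. Lq_has_partial_derivative_on q A \<Omega> e (\<lambda>z \<theta>. T (F z \<theta>)) G \<and> Lq_C k q A \<Omega> G" if e: "e \<in> Basis" for e
  proof -
    obtain G where G: "Lq_has_partial_derivative_on q A \<Omega> e F G" "Lq_C k q A \<Omega> G"
      using Suc.prems e by auto
    have "Lq_has_partial_derivative_on q A \<Omega> e (\<lambda>z \<theta>. T (F z \<theta>)) (\<lambda>z \<theta>. T (G z \<theta>))"
      unfolding Lq_has_partial_derivative_on_def
    proof
      fix z assume z: "z \<in> \<Omega>"
      have l: "((\<lambda>r. Lq_seminorm q A (\<lambda>\<theta>. (F (z + r *\<^sub>R e) \<theta> - F z \<theta>) /\<^sub>R r - G z \<theta>)) \<longlongrightarrow> 0) (at 0)"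
        using G(1) z by (simp add: Lq_has_partial_derivative_on_def)
      show "((\<lambda>r. Lq_seminorm q A (\<lambda>\<theta>. (T (F (z + r *\<^sub>R e) \<theta>) - T (F z \<theta>)) /\<^sub>R r - T (G z \<theta>))) \<longlongrightarrow> 0) (at 0)"
        unfolding T.diff[symmetric] T.scaleR[symmetric]
        by (rule tendsto_sandwich[OF always_eventually always_eventually tendsto_const l])
          (auto intro: Lq_seminorm_contraction[OF q T(2)])
    qed
    then show ?thesis using Suc.IH[OF G(2)] by blast
  qed
  then show ?case using Suc.prems Lq_continuous_on_contraction[OF q T] by auto
qed

lemma C0_infty_Lq_contraction:
  fixes f :: "real \<times> (real ^ 'n) \<Rightarrow> real \<Rightarrow> 'v::real_normed_vector" and T :: "'v \<Rightarrow> 'w::real_normed_vector"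
  assumes q: "0 < q" and T: "bounded_linear T" "\<And>v. norm (T v) \<le> norm v" and f: "C0_infty_Lq q a b A f"
  shows "C0_infty_Lq q a b A (\<lambda>z \<theta>. T (f z \<theta>))"
  unfolding C0_infty_Lq_def
proof (intro conjI allI)
  have "strongly_measurable (restrict_space lborel ((einterval a b \<times> UNIV) \<times> A)) (\<lambda>(z, \<theta>). f z \<theta>)"
    using f by (simp add: C0_infty_Lq_def)
  from strongly_measurable_compose[OF this linear_continuous_at[OF T(1)]]
  show "strongly_measurable (restrict_space lborel ((einterval a b \<times> UNIV) \<times> A)) (\<lambda>(z, \<theta>). T (f z \<theta>))"
    by (simp add: split_beta')
  show "Lq_C k q A (einterval a b \<times> UNIV) (\<lambda>z \<theta>. T (f z \<theta>))" for k
    using f by (intro Lq_C_contraction[OF q T]) (simp add: C0_infty_Lq_def)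
  obtain K where "compact K" "K \<subseteq> einterval a b \<times> UNIV" "\<forall>z\<in>einterval a b \<times> UNIV - K. Lq_seminorm q A (f z) = 0"
    using f[unfolded C0_infty_Lq_def, THEN conjunct2, THEN conjunct2] by blast
  then show "\<exists>K. compact K \<and> K \<subseteq> einterval a b \<times> UNIV \<and> (\<forall>z\<in>einterval a b \<times> UNIV - K. Lq_seminorm q A (\<lambda>\<theta>. T (f z \<theta>)) = 0)"
    using Lq_seminorm_contraction[OF q T(2), of A] by (intro exI[of _ K]) (metis le_zero_eq)
qed

lemma mixed_norm_integral_contraction:
  fixes f :: "real \<times> (real ^ 'n) \<Rightarrow> real \<Rightarrow> 'v::real_normed_vector" and T :: "'v \<Rightarrow> 'w::real_normed_vector"
  assumes p: "0 < p" and H: "0 < H" and T: "\<And>v. norm (T v) \<le> norm v"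
  shows "mixed_norm_integral p H a b \<alpha> \<beta> (\<lambda>z \<theta>. T (f z \<theta>)) \<le> mixed_norm_integral p H a b \<alpha> \<beta> f"
  unfolding mixed_norm_integral_def
  using p H T by (intro epowr_mono nn_integral_mono mult_right_mono ennreal_leI powr_mono2) auto

text \<open>A quasi-triangle inequality from \<open>norm g \<le> 2 * max\<close>. Borel
  representatives make the integral on the right additive.\<close>

lemma Lq_integral_triangle:
  fixes g h :: "real \<Rightarrow> 'v::{banach, second_countable_topology}"
  assumes q: "0 < q" and A: "A \<in> sets borel"
    and g: "strongly_measurable (restrict_space lborel A) g" and h: "strongly_measurable (restrict_space lborel A) h"
  shows "(\<integral>\<^sup>+\<theta>\<in>A. ennreal (norm (g \<theta>) powr q) \<partial>lborel) \<le>
    ennreal (2 powr q) * ((\<integral>\<^sup>+\<theta>\<in>A. ennreal (norm (g \<theta> - h \<theta>) powr q) \<partial>lborel) + (\<integral>\<^sup>+\<theta>\<in>A. ennreal (norm (h \<theta>) powr q) \<partial>lborel))"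
proof -
  obtain g' where g': "g' \<in> borel_measurable borel" "AE z in lborel. z \<in> A \<longrightarrow> g z = g' z"
    using strongly_measurable_restrict_borel[OF A g] by metis
  obtain h' where h': "h' \<in> borel_measurable borel" "AE z in lborel. z \<in> A \<longrightarrow> h z = h' z"
    using strongly_measurable_restrict_borel[OF A h] by metis
  note [measurable] = g'(1) h'(1) A
  have eq: "(\<integral>\<^sup>+\<theta>\<in>A. ennreal (norm (h \<theta>) powr q) \<partial>lborel) = (\<integral>\<^sup>+\<theta>\<in>A. ennreal (norm (h' \<theta>) powr q) \<partial>lborel)"
    by (rule nn_integral_cong_AE) (use h'(2) in \<open>auto elim!: eventually_mono simp: indicator_def\<close>)
  have eq2: "(\<integral>\<^sup>+\<theta>\<in>A. ennreal (norm (g \<theta> - h \<theta>) powr q) \<partial>lborel) = (\<integral>\<^sup>+\<theta>\<in>A. ennreal (norm (g' \<theta> - h' \<theta>) powr q) \<partial>lborel)"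
    by (rule nn_integral_cong_AE) (use g'(2) h'(2) in \<open>auto elim!: eventually_elim2 simp: indicator_def\<close>)
  have "(\<integral>\<^sup>+\<theta>\<in>A. ennreal (norm (g \<theta>) powr q) \<partial>lborel) = (\<integral>\<^sup>+\<theta>\<in>A. ennreal (norm (g' \<theta>) powr q) \<partial>lborel)"
    by (rule nn_integral_cong_AE) (use g'(2) in \<open>auto elim!: eventually_mono simp: indicator_def\<close>)
  also have "\<dots> \<le> (\<integral>\<^sup>+\<theta>. ennreal (2 powr q) * (ennreal (norm (g' \<theta> - h' \<theta>) powr q) * indicator A \<theta> + ennreal (norm (h' \<theta>) powr q) * indicator A \<theta>) \<partial>lborel)"
  proof (rule nn_integral_mono)
    fix \<theta>
    let ?u = "norm (g' \<theta> - h' \<theta>)" and ?v = "norm (h' \<theta>)"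
    have "norm (g' \<theta>) \<le> ?u + ?v" by (metis diff_add_cancel norm_triangle_ineq)
    also have "\<dots> \<le> 2 * max ?u ?v" by simp
    finally have "norm (g' \<theta>) powr q \<le> (2 * max ?u ?v) powr q" using q by (intro powr_mono2) auto
    also have "\<dots> = 2 powr q * (max ?u ?v) powr q" by (simp add: powr_mult)
    also have "\<dots> \<le> 2 powr q * (?u powr q + ?v powr q)"
      by (intro mult_left_mono) (auto simp: max_def)
    finally show "ennreal (norm (g' \<theta>) powr q) * indicator A \<theta> \<le>
      ennreal (2 powr q) * (ennreal (?u powr q) * indicator A \<theta> + ennreal (?v powr q) * indicator A \<theta>)"
      by (auto simp: indicator_def ennreal_mult[symmetric] ennreal_plus[symmetric] simp del: ennreal_plus intro!: ennreal_leI)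
  qed
  also have "\<dots> = ennreal (2 powr q) * ((\<integral>\<^sup>+\<theta>\<in>A. ennreal (norm (g' \<theta> - h' \<theta>) powr q) \<partial>lborel) + (\<integral>\<^sup>+\<theta>\<in>A. ennreal (norm (h' \<theta>) powr q) \<partial>lborel))"
    by (simp add: nn_integral_cmult nn_integral_add)
  finally show ?thesis unfolding eq eq2 .
qed

text \<open>Continuity in the seminorm gives local bounds, compactness of the support makes finitely
  many of them enough, and their sum is a common bound.\<close>

lemma C0_infty_Lq_bounded:
  fixes f :: "real \<times> (real ^ 'n) \<Rightarrow> real \<Rightarrow> 'v::{banach, second_countable_topology}"
  assumes q: "0 < q" and A: "A \<in> sets borel" and f: "C0_infty_Lq q a b A f"
  obtains K C where "compact K" "C < \<infinity>"
    "\<And>z. z \<in> einterval a b \<times> UNIV \<Longrightarrow> (\<integral>\<^sup>+\<theta>\<in>A. ennreal (norm (f z \<theta>) powr q) \<partial>lborel) \<le> C * indicator K z"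
proof -
  let ?\<Omega> = "einterval a b \<times> (UNIV :: (real^'n) set)"
  define S where "S z = (\<integral>\<^sup>+\<theta>\<in>A. ennreal (norm (f z \<theta>) powr q) \<partial>lborel)" for z
  have SL: "S z = Lq_seminorm q A (f z) epowr q" for z
    using q by (simp add: S_def Lq_seminorm_def epowr_inverse)
  from f[unfolded C0_infty_Lq_def, THEN conjunct2, THEN conjunct2]
  obtain K where "compact K \<and> K \<subseteq> ?\<Omega> \<and> (\<forall>z\<in>?\<Omega> - K. Lq_seminorm q A (f z) = 0)" ..
  then have K: "compact K" "K \<subseteq> ?\<Omega>" "\<And>z. z \<in> ?\<Omega> - K \<Longrightarrow> Lq_seminorm q A (f z) = 0" by auto
  have "Lq_C 0 q A ?\<Omega> f"
    by (rule f[unfolded C0_infty_Lq_def, THEN conjunct2, THEN conjunct1, rule_format])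
  then have cont: "\<And>z. z \<in> ?\<Omega> \<Longrightarrow> in_Lq q A (f z)"
     "\<And>z. z \<in> ?\<Omega> \<Longrightarrow> ((\<lambda>w. Lq_seminorm q A (\<lambda>\<theta>. f w \<theta> - f z \<theta>)) \<longlongrightarrow> 0) (at z within ?\<Omega>)"
    by (auto simp: Lq_continuous_on_def)
  have "\<exists>V. open (fst V) \<and> z \<in> fst V \<and> snd V < (\<infinity> :: ennreal) \<and> (\<forall>w\<in>fst V \<inter> ?\<Omega>. S w \<le> snd V)" if z: "z \<in> ?\<Omega>" for z
  proof -
    have "\<forall>\<^sub>F w in at z within ?\<Omega>. Lq_seminorm q A (\<lambda>\<theta>. f w \<theta> - f z \<theta>) < 1"
      by (rule order_tendstoD(2)[OF cont(2)[OF z]]) simp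
    then obtain U where U: "open U" "z \<in> U" "\<And>w. w \<in> U \<Longrightarrow> w \<noteq> z \<Longrightarrow> w \<in> ?\<Omega> \<Longrightarrow> Lq_seminorm q A (\<lambda>\<theta>. f w \<theta> - f z \<theta>) < 1"
      unfolding eventually_at_topological by blast
    \<comment> \<open>The limit within the domain leaves out the point \<open>z\<close> itself, so
      \<open>S z\<close> is added to the bound for the other points.\<close>
    define c where "c = S z + ennreal (2 powr q) * (1 + S z)"
    have Sz: "S z < \<infinity>" using cont(1)[OF z] unfolding SL in_Lq_def by (simp add: less_top[symmetric])
    have "S w \<le> c" if w: "w \<in> U \<inter> ?\<Omega>" for w
    proof (cases "w = z")
      case True
      then show ?thesis by (simp add: c_def)
    next
      case False
      have "Lq_seminorm q A (\<lambda>\<theta>. f w \<theta> - f z \<theta>) \<le> 1" using U(3)[of w] w False by auto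
      then have "Lq_seminorm q A (\<lambda>\<theta>. f w \<theta> - f z \<theta>) epowr q \<le> 1 epowr q" using q by (intro epowr_mono) auto
      then have d: "(\<integral>\<^sup>+\<theta>\<in>A. ennreal (norm (f w \<theta> - f z \<theta>) powr q) \<partial>lborel) \<le> 1"
        using q by (simp add: Lq_seminorm_def epowr_inverse)
      have "S w \<le> ennreal (2 powr q) * ((\<integral>\<^sup>+\<theta>\<in>A. ennreal (norm (f w \<theta> - f z \<theta>) powr q) \<partial>lborel) + S z)"
        unfolding S_def using cont(1) z w by (intro Lq_integral_triangle q A) (auto simp: in_Lq_def)
      also have "\<dots> \<le> ennreal (2 powr q) * (1 + S z)" by (intro mult_left_mono add_right_mono d) auto
      also have "\<dots> \<le> c" by (simp add: c_def)
      finally show ?thesis .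
    qed
    moreover have "c < \<infinity>" using Sz by (simp add: c_def ennreal_mult_less_top)
    ultimately show ?thesis using U(1,2) by (intro exI[of _ "(U, c)"]) auto
  qed
  then have "\<forall>z\<in>?\<Omega>. \<exists>V. open (fst V) \<and> z \<in> fst V \<and> snd V < (\<infinity> :: ennreal) \<and> (\<forall>w\<in>fst V \<inter> ?\<Omega>. S w \<le> snd V)"
    by blast
  from bchoice[OF this] obtain V where V: "\<forall>z\<in>?\<Omega>. open (fst (V z)) \<and> z \<in> fst (V z) \<and> snd (V z) < (\<infinity> :: ennreal) \<and> (\<forall>w\<in>fst (V z) \<inter> ?\<Omega>. S w \<le> snd (V z))"
    by blast
  define U where "U z = fst (V z)" for z
  define c where "c z = snd (V z)" for z
  have Uc: "open (U z) \<and> z \<in> U z \<and> c z < (\<infinity>::ennreal) \<and> (\<forall>w\<in>U z \<inter> ?\<Omega>. S w \<le> c z)" if "z \<in> ?\<Omega>" for z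
    using V that unfolding U_def c_def by blast
  obtain D where D: "D \<subseteq> K" "finite D" "K \<subseteq> (\<Union>z\<in>D. U z)"
  proof (rule compactE_image[OF K(1), of K U])
    show "open (U z)" if "z \<in> K" for z using Uc K(2) that by blast
    show "K \<subseteq> (\<Union>z\<in>K. U z)" using Uc K(2) by blast
  qed
  show ?thesis
  proof (rule that[OF K(1), of "\<Sum>z\<in>D. c z"])
    have "\<forall>z\<in>D. c z < \<infinity>" using Uc D(1) K(2) by blast
    with D(2) show "(\<Sum>z\<in>D. c z) < \<infinity>" by (induction rule: finite_induct) auto
    fix w assume w: "w \<in> ?\<Omega>"
    show "(\<integral>\<^sup>+\<theta>\<in>A. ennreal (norm (f w \<theta>) powr q) \<partial>lborel) \<le> (\<Sum>z\<in>D. c z) * indicator K w"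
    proof (cases "w \<in> K")
      case True
      then obtain z where z: "z \<in> D" "w \<in> U z" using D(3) by blast
      then have "S w \<le> c z" using Uc[of z] D(1) K(2) w by blast
      also have "c z \<le> (\<Sum>z\<in>D. c z)" using z D(2) by (intro member_le_sum) auto
      finally show ?thesis using True by (simp add: S_def)
    next
      case False
      then have "S w = 0" using K(3) w by (simp add: SL)
      then show ?thesis using False by (simp add: S_def)
    qed
  qed
qed

text \<open>A test function is bounded in \<open>L_q\<close> on a compact set of
  \<open>(s, y)\<close>, so its \<open>q\<close>-th power is integrable in all three variables and
  almost every slice in \<open>y\<close> lies in \<open>L_q\<close>. This gives admissibility
  irrespective of whether the mixed norm is finite.\<close>

lemma AE_heat_admissible_C0_infty:
  fixes f :: "real \<times> (real ^ 'n) \<Rightarrow> real \<Rightarrow> 'v::{banach, second_countable_topology}"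
  assumes q: "1 \<le> q" and A: "A \<in> sets borel" and f: "C0_infty_Lq q a b A f"
    and f0: "(\<lambda>(s, y, \<theta>). f0 s y \<theta>) \<in> borel_measurable (borel \<Otimes>\<^sub>M borel \<Otimes>\<^sub>M borel)"
    and eq: "AE z in lborel. z \<in> (einterval a b \<times> UNIV) \<times> A \<longrightarrow> (case z of ((s, y), \<theta>) \<Rightarrow> f (s, y) \<theta> = f0 s y \<theta>)"
    and z: "\<And>s y \<theta>. s \<notin> einterval a b \<or> \<theta> \<notin> A \<Longrightarrow> f0 s y \<theta> = 0"
  shows "AE s in lborel. AE \<theta> in lborel. heat_admissible (\<lambda>y. f0 s y \<theta>)"
proof -
  note [measurable (raw)] = measurable_curry3[OF f0]
  obtain K C where K: "compact K" "C < \<infinity>"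
    "\<And>z. z \<in> einterval a b \<times> UNIV \<Longrightarrow> (\<integral>\<^sup>+\<theta>\<in>A. ennreal (norm (f z \<theta>) powr q) \<partial>lborel) \<le> C * indicator K z"
    by (rule C0_infty_Lq_bounded[OF _ A f]) (use q in simp, rule that)
  let ?N = "\<lambda>s y \<theta>. ennreal (norm (f0 s y \<theta>) powr q)"
  have AEu: "AE u in lborel. AE \<theta> in lborel. (u, \<theta>) \<in> (einterval a b \<times> UNIV) \<times> A \<longrightarrow> f u \<theta> = f0 (fst u) (snd u) \<theta>"
  proof -
    have "AE z in lborel \<Otimes>\<^sub>M lborel. z \<in> (einterval a b \<times> UNIV) \<times> A \<longrightarrow> (case z of ((s, y), \<theta>) \<Rightarrow> f (s, y) \<theta> = f0 s y \<theta>)"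
      using eq by (subst lborel_prod)
    from lborel_pair.AE_pair[OF this] show ?thesis
      by (rule eventually_mono) (auto elim!: eventually_mono simp: split_beta')
  qed
  have "(\<integral>\<^sup>+s. \<integral>\<^sup>+\<theta>. \<integral>\<^sup>+y. ?N s y \<theta> \<partial>lborel \<partial>lborel \<partial>lborel) = (\<integral>\<^sup>+s. \<integral>\<^sup>+y. \<integral>\<^sup>+\<theta>. ?N s y \<theta> \<partial>lborel \<partial>lborel \<partial>lborel)"
    by (intro nn_integral_cong lborel_pair.Fubini') measurable
  also have "\<dots> = (\<integral>\<^sup>+u. \<integral>\<^sup>+\<theta>. ?N (fst u) (snd u) \<theta> \<partial>lborel \<partial>(lborel \<Otimes>\<^sub>M lborel))"
    by (subst lborel.nn_integral_fst[symmetric]) simp_all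
  also have "\<dots> = (\<integral>\<^sup>+u. \<integral>\<^sup>+\<theta>. ?N (fst u) (snd u) \<theta> \<partial>lborel \<partial>lborel)" by (simp only: lborel_prod)
  also have "\<dots> \<le> (\<integral>\<^sup>+u. C * indicator K u \<partial>lborel)"
  proof (rule nn_integral_mono_AE)
    show "AE u in lborel. (\<integral>\<^sup>+\<theta>. ?N (fst u) (snd u) \<theta> \<partial>lborel) \<le> C * indicator K u"
      using AEu
    proof eventually_elim
      fix u :: "real \<times> (real^'n)"
      assume AE: "AE \<theta> in lborel. (u, \<theta>) \<in> (einterval a b \<times> UNIV) \<times> A \<longrightarrow> f u \<theta> = f0 (fst u) (snd u) \<theta>"
      show "(\<integral>\<^sup>+\<theta>. ?N (fst u) (snd u) \<theta> \<partial>lborel) \<le> C * indicator K u"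
      proof (cases "u \<in> einterval a b \<times> UNIV")
        case True
        have "(\<integral>\<^sup>+\<theta>. ?N (fst u) (snd u) \<theta> \<partial>lborel) = (\<integral>\<^sup>+\<theta>\<in>A. ennreal (norm (f u \<theta>) powr q) \<partial>lborel)"
        proof (rule nn_integral_cong_AE)
          show "AE \<theta> in lborel. ?N (fst u) (snd u) \<theta> = ennreal (norm (f u \<theta>) powr q) * indicator A \<theta>"
            using AE by eventually_elim (use True in \<open>auto simp: indicator_def z\<close>)
        qed
        then show ?thesis using K(3)[OF True] by simp
      next
        case False
        then have "fst u \<notin> einterval a b" by (cases u) auto
        then show ?thesis by (simp add: z)
      qed
    qed
  qed
  also have "\<dots> = C * emeasure lborel K" using K(1) by (intro nn_integral_cmult_indicator) (simp add: borel_compact)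
  also have "\<dots> < \<infinity>" using K(2) emeasure_compact_finite[OF K(1)] by (simp add: ennreal_mult_less_top)
  finally have "(\<integral>\<^sup>+s. \<integral>\<^sup>+\<theta>. \<integral>\<^sup>+y. ?N s y \<theta> \<partial>lborel \<partial>lborel \<partial>lborel) < \<infinity>" .
  then have "AE s in lborel. (\<integral>\<^sup>+\<theta>. \<integral>\<^sup>+y. ?N s y \<theta> \<partial>lborel \<partial>lborel) \<noteq> \<infinity>"
    by (intro nn_integral_noteq_infinite) auto
  then show ?thesis
  proof eventually_elim
    fix s assume "(\<integral>\<^sup>+\<theta>. \<integral>\<^sup>+y. ?N s y \<theta> \<partial>lborel \<partial>lborel) \<noteq> \<infinity>"
    then have "AE \<theta> in lborel. (\<integral>\<^sup>+y. ?N s y \<theta> \<partial>lborel) \<noteq> \<infinity>"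
      by (intro nn_integral_noteq_infinite) auto
    then show "AE \<theta> in lborel. heat_admissible (\<lambda>y. f0 s y \<theta>)"
    proof eventually_elim
      fix \<theta> assume "(\<integral>\<^sup>+y. ?N s y \<theta> \<partial>lborel) \<noteq> \<infinity>"
      then show "heat_admissible (\<lambda>y. f0 s y \<theta>)"
        by (intro heat_admissible_Lp[OF _ q]) (auto simp: less_top[symmetric])
    qed
  qed
qed

lemma norm_vec_lambda_le: "(\<And>i. norm (u i) \<le> norm (v i)) \<Longrightarrow> norm (\<chi> i. u i) \<le> norm (\<chi> i. v i)"
  unfolding norm_vec_def by (intro L2_set_mono) auto

theorem theoremA2:
  fixes p H :: real and a b \<alpha> \<beta> :: ereal
    and f :: "real \<times> (real ^ 'n) \<Rightarrow> real \<Rightarrow> 'v::{real_inner, complete_space}"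
  assumes "2 \<le> p"
    and "1 / 2 < H" and "H < 1"
    and "a < b" and "\<alpha> < \<beta>"
    and "C0_infty_Lq (1 / H) a b (einterval \<alpha> \<beta>) f"
  shows "gradient_square_integral p H a b \<alpha> \<beta> f
           \<le> ennreal (gradient_const TYPE('n) p) * mixed_norm_integral p H a b \<alpha> \<beta> f"
proof -
  let ?I = "einterval a b" and ?A = "einterval \<alpha> \<beta>"
  have H: "0 < H" "0 < 1 / H" "1 \<le> 1 / H" using assms(2,3) by auto
  have sm: "strongly_measurable (restrict_space lborel ((?I \<times> UNIV) \<times> ?A)) (\<lambda>(z, \<theta>). f z \<theta>)"
    using assms(6) by (simp add: C0_infty_Lq_def)
  \<comment> \<open>One sequence \<open>d\<close> serves all \<open>(t, x, \<theta>)\<close>,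
    because it is extracted from joint measurability. The coordinate map is then the same at every
    point and commutes with the semigroup and the gradient.\<close>
  obtain d :: "nat \<Rightarrow> 'v" where d: "AE x in restrict_space lborel ((?I \<times> UNIV) \<times> ?A).
      gram_vec d (gram_coord d ((\<lambda>(z, \<theta>). f z \<theta>) x)) = (\<lambda>(z, \<theta>). f z \<theta>) x"
    by (rule strongly_measurable_gram[OF sm]) (rule that)
  define f' where "f' z \<theta> = gram_coord d (f z \<theta>)" for z \<theta>
  have S: "(?I \<times> UNIV) \<times> ?A \<in> sets (borel :: ((real \<times> (real^'n)) \<times> real) measure)"
    by (intro borel_open open_Times open_einterval open_UNIV)
  have "AE x in lborel. x \<in> (?I \<times> UNIV) \<times> ?A \<longrightarrow> gram_vec d (gram_coord d ((\<lambda>(z, \<theta>). f z \<theta>) x)) = (\<lambda>(z, \<theta>). f z \<theta>) x"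
    using d S by (subst (asm) AE_restrict_space_iff) auto
  from AE_lborel_swap[OF this]
  have rec: "AE s in lborel. AE \<theta> in lborel. AE y in lborel. s \<in> ?I \<longrightarrow> \<theta> \<in> ?A \<longrightarrow> f (s, y) \<theta> = gram_vec d (f' (s, y) \<theta>)"
    unfolding f'_def by (rule eventually_mono) (auto elim!: eventually_mono)
  have C0: "C0_infty_Lq (1 / H) a b ?A f'"
    unfolding f'_def by (rule C0_infty_Lq_contraction[OF H(2) bounded_linear_gram_coord norm_gram_coord_le assms(6)])
  then have sm': "strongly_measurable (restrict_space lborel ((?I \<times> UNIV) \<times> ?A)) (\<lambda>(z, \<theta>). f' z \<theta>)"
    by (simp add: C0_infty_Lq_def)
  obtain f0 :: "real \<Rightarrow> real^'n \<Rightarrow> real \<Rightarrow> ell2" where f0: "(\<lambda>(s, y, \<theta>). f0 s y \<theta>) \<in> borel_measurable (borel \<Otimes>\<^sub>M borel \<Otimes>\<^sub>M borel)"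
    "AE s in lborel. AE \<theta> in lborel. s \<in> ?I \<longrightarrow> \<theta> \<in> ?A \<longrightarrow> (AE y in lborel. f' (s, y) \<theta> = f0 s y \<theta>)"
    "AE z in lborel. z \<in> (?I \<times> UNIV) \<times> ?A \<longrightarrow> (case z of ((s, y), \<theta>) \<Rightarrow> f' (s, y) \<theta> = f0 s y \<theta>)"
    "\<And>s y \<theta>. s \<notin> ?I \<or> \<theta> \<notin> ?A \<Longrightarrow> f0 s y \<theta> = 0"
    by (rule borel_representative[OF einterval_borel einterval_borel sm']) (rule that)
  \<comment> \<open>The sign of the chosen constant is not known, so an infinite mixed norm would
    not settle the estimate; admissibility is therefore taken from the test function
    property.\<close>
  have adm: "AE s in lborel. AE \<theta> in lborel. heat_admissible (\<lambda>y. f0 s y \<theta>)"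
    by (rule AE_heat_admissible_C0_infty[OF H(3) einterval_borel C0 f0(1,3)]) (rule f0(4))
  \<comment> \<open>Two contractions in opposite directions: \<open>f\<close> is recovered from
    \<open>f'\<close> by \<open>gram_vec\<close>, which bounds the left-hand side here, and
    \<open>f'\<close> arises from \<open>f\<close> by \<open>gram_coord\<close>, which bounds the
    right-hand side at the end.\<close>
  have "gradient_square_integral p H a b \<alpha> \<beta> f \<le> gradient_square_integral p H a b \<alpha> \<beta> f'"
  proof (rule gradient_square_integral_mono)
    show "AE s in lborel. AE \<theta> in lborel. s \<in> ?I \<longrightarrow> \<theta> \<in> ?A \<longrightarrow>
      (\<forall>\<tau>>0. \<forall>x. norm (gradient (heat_semigroup \<tau> (\<lambda>y. f (s, y) \<theta>)) x) \<le> norm (gradient (heat_semigroup \<tau> (\<lambda>y. f' (s, y) \<theta>)) x))"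
      using rec f0(2) adm
    proof eventually_elim
      fix s
      assume "AE \<theta> in lborel. AE y in lborel. s \<in> ?I \<longrightarrow> \<theta> \<in> ?A \<longrightarrow> f (s, y) \<theta> = gram_vec d (f' (s, y) \<theta>)"
        "AE \<theta> in lborel. s \<in> ?I \<longrightarrow> \<theta> \<in> ?A \<longrightarrow> (AE y in lborel. f' (s, y) \<theta> = f0 s y \<theta>)"
        "AE \<theta> in lborel. heat_admissible (\<lambda>y. f0 s y \<theta>)"
      then show "AE \<theta> in lborel. s \<in> ?I \<longrightarrow> \<theta> \<in> ?A \<longrightarrow>
        (\<forall>\<tau>>0. \<forall>x. norm (gradient (heat_semigroup \<tau> (\<lambda>y. f (s, y) \<theta>)) x) \<le> norm (gradient (heat_semigroup \<tau> (\<lambda>y. f' (s, y) \<theta>)) x))"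
      proof eventually_elim
        fix \<theta>
        assume r: "AE y in lborel. s \<in> ?I \<longrightarrow> \<theta> \<in> ?A \<longrightarrow> f (s, y) \<theta> = gram_vec d (f' (s, y) \<theta>)"
          and e: "s \<in> ?I \<longrightarrow> \<theta> \<in> ?A \<longrightarrow> (AE y in lborel. f' (s, y) \<theta> = f0 s y \<theta>)"
          and ad: "heat_admissible (\<lambda>y. f0 s y \<theta>)"
        show "s \<in> ?I \<longrightarrow> \<theta> \<in> ?A \<longrightarrow>
          (\<forall>\<tau>>0. \<forall>x. norm (gradient (heat_semigroup \<tau> (\<lambda>y. f (s, y) \<theta>)) x) \<le> norm (gradient (heat_semigroup \<tau> (\<lambda>y. f' (s, y) \<theta>)) x))"
        proof (intro impI allI)
          fix \<tau> :: real and x assume sI: "s \<in> ?I" and \<theta>A: "\<theta> \<in> ?A" and \<tau>: "0 < \<tau>"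
          have e': "AE y in lborel. f' (s, y) \<theta> = f0 s y \<theta>" using e sI \<theta>A by blast
          have r': "AE y in lborel. f (s, y) \<theta> = gram_vec d (f0 s y \<theta>)"
            using r e' by eventually_elim (use sI \<theta>A in auto)
          have "gradient (heat_semigroup \<tau> (\<lambda>y. f (s, y) \<theta>)) x = (\<chi> i. gram_vec d (heat_deriv \<tau> i (\<lambda>y. f0 s y \<theta>) x))"
            by (rule gradient_heat_semigroup[OF ad \<tau> bounded_linear_gram_vec r'])
          moreover have "gradient (heat_semigroup \<tau> (\<lambda>y. f' (s, y) \<theta>)) x = (\<chi> i. heat_deriv \<tau> i (\<lambda>y. f0 s y \<theta>) x)"
            by (rule gradient_heat_semigroup[OF ad \<tau> bounded_linear_ident e'])
          ultimately show "norm (gradient (heat_semigroup \<tau> (\<lambda>y. f (s, y) \<theta>)) x) \<le> norm (gradient (heat_semigroup \<tau> (\<lambda>y. f' (s, y) \<theta>)) x)"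
            by (simp add: norm_vec_lambda_le norm_gram_vec_le)
        qed
      qed
    qed
  qed (use assms H in auto)
  also have "\<dots> \<le> ennreal (gradient_const TYPE('n) p) * mixed_norm_integral p H a b \<alpha> \<beta> f'"
  proof -
    have "gradient_estimate_ell2 TYPE('n) p (gradient_const TYPE('n) p)"
      unfolding gradient_const_def by (rule someI_ex[OF gradient_estimate_ell2_exists[OF assms(1)]])
    then show ?thesis using assms C0 unfolding gradient_estimate_ell2_def by blast
  qed
  also have "\<dots> \<le> ennreal (gradient_const TYPE('n) p) * mixed_norm_integral p H a b \<alpha> \<beta> f"
    unfolding f'_def using assms(1) H by (intro mult_left_mono mixed_norm_integral_contraction norm_gram_coord_le) auto
  finally show ?thesis .
qed

end
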